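(* For every integer $m\ge 1$, the multiplication tensor $T_A\in A^*\otimes A^*\otimes A$ of the $(3m+3)$-dimensional commutative algebra $A=A(m)$ defined in the context has minimal border rank, i.e. $\underline{\mathrm{rk}}(T_A)=3m+3$. Moreover, for every probability distribution $P$ on $$\Phi=\{(0,0,2),(0,2,0),(2,0,0),(1,1,0),(1,0,1),(0,1,1)\}$$ with marginal distributions $P_1,P_2,P_3$ on $\{0,1,2\}$ (with respect to the first, second and third coordinate), one has \begin{multline*} 3\log(3m+3)\ \ge\ \log V_\omega(\widetilde{T_A})\ \ge\ H(P_1)+H(P_2)+H(P_3)+P(1,1,0)\log\left(4(2m)^{\omega}\right)\\ +\left(P(2,0,0)+P(0,2,0)\right)\log(2^\omega)+\left(P(1,0,1)+P(0,1,1)\right)\log\left((3m)^{\omega}\right). \end{multline*} Consequently (by taking $m=4$ and optimizing over $P$) the exponent of matrix multiplication satisfies $\omega<2.431$.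
   Context: All vector spaces are finite-dimensional over $\mathbb{C}$, and $\log$ is the natural logarithm. The algebra: $A=A(m)=\mathbb{C}[a_1,\ldots,a_{3m+2}]/I$, where $I$ is generated by $a_{3m+1}-a_ia_{m+i}$ for $1\le i\le m$, by $a_{3m+2}-a_ia_{2m+i}$ for $1\le i\le m$, and by all products $a_ia_j$ with $1\le i\le j\le 3m+2$ not occurring in one of the previous generators. It has basis $a_0=1,a_1,\dots,a_{3m+2}$. Its multiplication map $A\otimes A\to A$ is regarded as a tensor $T_A\in A^*\otimes A^*\otimes A$. The border rank $\underline{\mathrm{rk}}(T)$ of $T\in U\otimes V\otimes W$ is the least $r$ such that $T$ is a limit of tensors of rank at most $r$. A concise tensor in $\mathbb{C}^d\otimes\mathbb{C}^d\otimes\mathbb{C}^d$ has border rank at least $d$; it has minimal border rank if equality holds. $M_{\langle a,b,c\rangle}\in\mathbb{C}^{ab}\otimes\mathbb{C}^{bc}\otimes\mathbb{C}^{ca}$ denotes the tensor of multiplication of $a\times b$ by $b\times c$ matrices. The constant $\omega$ is the smallest number such that for every $\epsilon>0$ the rank (equivalently border rank) of $M_{\langle n,n,n\rangle}$ is $O(n^{\omega+\epsilon})$. The Kronecker product $T\boxtimes T'$ of $T\in U\otimes V\otimes W$ and $T'\in U'\otimes V'\otimes W'$ is $T\otimes T'$ viewed as a 3-way tensor in $(U\otimes U')\otimes(V\otimes V')\otimes(W\otimes W')$. A tensor $T'$ is a degeneration of $T$, written $T\trianglerighteq T'$, if (after embedding both in a common space $U\otimes V\otimes W$) $T'$ lies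 in the closure of the orbit of $T$ under $GL(U)\times GL(V)\times GL(W)$. The value of $T$ is $V_\omega(T)=\sup_N V_{\omega,N}(T)^{1/N}$, where $$V_{\omega,N}(T)=\sup\Big\{\sum_{i=1}^q (a_ib_ic_i)^{\omega/3}\ \Big|\ T^{\boxtimes N}\trianglerighteq\bigoplus_{i=1}^q M_{\langle a_i,b_i,c_i\rangle}\Big\}.$$ The symmetrization of $T\in U\otimes V\otimes W$ is $\widetilde T=T\boxtimes T'\boxtimes T''$, where $T'\in V\otimes W\otimes U$ and $T''\in W\otimes U\otimes V$ are obtained from $T$ by cyclically permuting the factors. For a probability distribution $p$ on a finite set, $H(p)=-\sum_i p(i)\log p(i)$ (with $0\log 0=0$). *)

theory Defs
  imports
    "HOL-Probability.Probability"
    "HOL-Library.Poly_Mapping"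
    "HOL-Library.Landau_Symbols"
    "HOL-Algebra.QuotRing"
    "Jordan_Normal_Form.Matrix"
begin

section \<open>Tensors in coordinates\<close>

text \<open>
  An element of \<open>C^d1 \<otimes> C^d2 \<otimes> C^d3\<close>. Only the values of the coefficient function inside the
  box \<open>d1 \<times> d2 \<times> d3\<close> are meaningful: tensors are always read through \<open>entry\<close>, which is zero
  outside the box. Hence \<open>entry T\<close> is also the image of \<open>T\<close> under the embedding into any larger
  coordinate space.
\<close>

datatype tensor =
  Tensor (dim1: nat) (dim2: nat) (dim3: nat) (raw: "nat \<Rightarrow> nat \<Rightarrow> nat \<Rightarrow> complex")

definition entry :: "tensor \<Rightarrow> nat \<Rightarrow> nat \<Rightarrow> nat \<Rightarrow> complex" where
  "entry T i j k = (if i < dim1 T \<and> j < dim2 T \<and> k < dim3 T then raw T i j k else 0)"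

definition tensor_rank :: "tensor \<Rightarrow> nat" where
  "tensor_rank T = (LEAST r. \<exists>u v w :: nat \<Rightarrow> nat \<Rightarrow> complex.
     \<forall>i<dim1 T. \<forall>j<dim2 T. \<forall>k<dim3 T. entry T i j k = (\<Sum>l<r. u l i * v l j * w l k))"

text \<open>
  Closures are taken in the product topology on \<open>nat \<Rightarrow> nat \<Rightarrow> nat \<Rightarrow> complex\<close>; on functions
  supported in a fixed finite box this is the usual topology.
\<close>

definition border_rank :: "tensor \<Rightarrow> nat" where
  "border_rank T = (LEAST r. entry T \<in> closure
     {entry S | S. dim1 S = dim1 T \<and> dim2 S = dim2 T \<and> dim3 S = dim3 T \<and> tensor_rank S \<le> r})"

definition concise :: "tensor \<Rightarrow> bool" where
  "concise T \<longleftrightarrow>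
     (\<forall>u :: nat \<Rightarrow> complex. (\<forall>j<dim2 T. \<forall>k<dim3 T. (\<Sum>i<dim1 T. u i * entry T i j k) = 0)
        \<longrightarrow> (\<forall>i<dim1 T. u i = 0)) \<and>
     (\<forall>v :: nat \<Rightarrow> complex. (\<forall>i<dim1 T. \<forall>k<dim3 T. (\<Sum>j<dim2 T. v j * entry T i j k) = 0)
        \<longrightarrow> (\<forall>j<dim2 T. v j = 0)) \<and>
     (\<forall>w :: nat \<Rightarrow> complex. (\<forall>i<dim1 T. \<forall>j<dim2 T. (\<Sum>k<dim3 T. w k * entry T i j k) = 0)
        \<longrightarrow> (\<forall>k<dim3 T. w k = 0))"

definition minimal_border_rank :: "tensor \<Rightarrow> bool" where
  "minimal_border_rank T \<longleftrightarrow>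
     dim1 T = dim2 T \<and> dim2 T = dim3 T \<and> concise T \<and> border_rank T = dim1 T"

text \<open>The basis vector \<open>e_i \<otimes> e_i'\<close> of a Kronecker product has index \<open>i * d' + i'\<close>.\<close>

definition kron :: "tensor \<Rightarrow> tensor \<Rightarrow> tensor" where
  "kron T T' = Tensor (dim1 T * dim1 T') (dim2 T * dim2 T') (dim3 T * dim3 T')
     (\<lambda>i j k. entry T (i div dim1 T') (j div dim2 T') (k div dim3 T')
            * entry T' (i mod dim1 T') (j mod dim2 T') (k mod dim3 T'))"

primrec kron_power :: "tensor \<Rightarrow> nat \<Rightarrow> tensor" where
  "kron_power T 0 = Tensor 1 1 1 (\<lambda>_ _ _. 1)"
| "kron_power T (Suc N) = kron T (kron_power T N)"

definition cyclic_perm :: "tensor \<Rightarrow> tensor" where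
  "cyclic_perm T = Tensor (dim2 T) (dim3 T) (dim1 T) (\<lambda>j k i. entry T i j k)"

definition symmetrization :: "tensor \<Rightarrow> tensor" where
  "symmetrization T = kron (kron T (cyclic_perm T)) (cyclic_perm (cyclic_perm T))"

definition direct_sum :: "tensor \<Rightarrow> tensor \<Rightarrow> tensor" where
  "direct_sum T T' = Tensor (dim1 T + dim1 T') (dim2 T + dim2 T') (dim3 T + dim3 T')
     (\<lambda>i j k. if i < dim1 T \<and> j < dim2 T \<and> k < dim3 T then entry T i j k
              else if dim1 T \<le> i \<and> dim2 T \<le> j \<and> dim3 T \<le> k
                then entry T' (i - dim1 T) (j - dim2 T) (k - dim3 T)
              else 0)"

definition direct_sum_list :: "tensor list \<Rightarrow> tensor" where
  "direct_sum_list Ts = foldr direct_sum Ts (Tensor 0 0 0 (\<lambda>_ _ _. 0))"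

definition GL :: "nat \<Rightarrow> complex mat set" where
  "GL n = {A \<in> carrier_mat n n. invertible_mat A}"

definition gl_act ::
  "complex mat \<Rightarrow> complex mat \<Rightarrow> complex mat \<Rightarrow> (nat \<Rightarrow> nat \<Rightarrow> nat \<Rightarrow> complex)
     \<Rightarrow> nat \<Rightarrow> nat \<Rightarrow> nat \<Rightarrow> complex" where
  "gl_act A B C t i j k =
     (if i < dim_row A \<and> j < dim_row B \<and> k < dim_row C then
        \<Sum>i'<dim_col A. \<Sum>j'<dim_col B. \<Sum>k'<dim_col C.
          A $$ (i, i') * B $$ (j, j') * C $$ (k, k') * t i' j' k'
      else 0)"

definition degenerates_to :: "tensor \<Rightarrow> tensor \<Rightarrow> bool" (infix "\<unrhd>" 50) where
  "T \<unrhd> T' \<longleftrightarrow> (\<exists>n1 n2 n3.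
     dim1 T \<le> n1 \<and> dim1 T' \<le> n1 \<and> dim2 T \<le> n2 \<and> dim2 T' \<le> n2 \<and> dim3 T \<le> n3 \<and> dim3 T' \<le> n3 \<and>
     entry T' \<in> closure {gl_act A B C (entry T) | A B C. A \<in> GL n1 \<and> B \<in> GL n2 \<and> C \<in> GL n3})"


section \<open>Matrix multiplication\<close>

text \<open>
  \<open>\<Sum> x_ij \<otimes> y_jk \<otimes> z_ki\<close>, where the pair \<open>(i, j)\<close> has index \<open>i * b + j\<close>, and so on cyclically.
\<close>

definition matmul :: "nat \<Rightarrow> nat \<Rightarrow> nat \<Rightarrow> tensor" where
  "matmul a b c = Tensor (a * b) (b * c) (c * a)
     (\<lambda>p q r. if \<exists>i<a. \<exists>j<b. \<exists>k<c. p = i * b + j \<and> q = j * c + k \<and> r = k * a + i then 1 else 0)"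

definition omega :: real where
  "omega = Inf {\<tau> :: real. \<forall>\<epsilon>>0.
     (\<lambda>n. real (tensor_rank (matmul n n n))) \<in> O(\<lambda>n. real n powr (\<tau> + \<epsilon>))}"


section \<open>The value of a tensor\<close>

text \<open>
  The suprema are over bounded sets of reals: if \<open>T\<close> has dimensions \<open>d1, d2, d3\<close> then, since
  \<open>omega \<le> 3\<close> and \<open>abc\<close> is the square root of \<open>(ab)(bc)(ca)\<close>, each sum is at most
  \<open>sqrt (d1 * d2 * d3) ^ N\<close>.
\<close>

definition value_level :: "nat \<Rightarrow> tensor \<Rightarrow> real" where
  "value_level N T = Sup {\<Sum>(a, b, c)\<leftarrow>abcs. real (a * b * c) powr (omega / 3) | abcs.
     (\<forall>(a, b, c)\<in>set abcs. 1 \<le> a \<and> 1 \<le> b \<and> 1 \<le> c) \<and>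
     kron_power T N \<unrhd> direct_sum_list (map (\<lambda>(a, b, c). matmul a b c) abcs)}"

definition tensor_value :: "tensor \<Rightarrow> real" where
  "tensor_value T = (SUP N\<in>{1..}. value_level N T powr (1 / real N))"


section \<open>The algebra\<close>

type_synonym cpoly = "(nat \<Rightarrow>\<^sub>0 nat) \<Rightarrow>\<^sub>0 complex"

definition X :: "nat \<Rightarrow> cpoly" where
  "X i = Poly_Mapping.single (Poly_Mapping.single i 1) 1"

definition poly_ring :: "nat set \<Rightarrow> cpoly ring" where
  "poly_ring V = \<lparr>carrier = {p. \<forall>mon\<in>Poly_Mapping.keys p. Poly_Mapping.keys mon \<subseteq> V},
     mult = (*), one = 1, zero = 0, add = (+)\<rparr>"

definition A_poly_ring :: "nat \<Rightarrow> cpoly ring" where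
  "A_poly_ring m = poly_ring {1..3*m+2}"

definition A_relations :: "nat \<Rightarrow> cpoly set" where
  "A_relations m =
     {X (3*m+1) - X i * X (m+i) | i. i \<in> {1..m}} \<union>
     {X (3*m+2) - X i * X (2*m+i) | i. i \<in> {1..m}} \<union>
     {X i * X j | i j. 1 \<le> i \<and> i \<le> j \<and> j \<le> 3*m+2 \<and>
        \<not> (i \<in> {1..m} \<and> (j = m+i \<or> j = 2*m+i))}"

definition A_ideal :: "nat \<Rightarrow> cpoly set" where
  "A_ideal m = Idl\<^bsub>A_poly_ring m\<^esub> (A_relations m)"

definition A_alg :: "nat \<Rightarrow> cpoly set ring" where
  "A_alg m = A_poly_ring m Quot A_ideal m"

definition A_basis :: "nat \<Rightarrow> nat \<Rightarrow> cpoly set" where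
  "A_basis m k = A_ideal m +>\<^bsub>A_poly_ring m\<^esub> (if k = 0 then 1 else X k)"

definition A_scalar :: "nat \<Rightarrow> complex \<Rightarrow> cpoly set" where
  "A_scalar m z = A_ideal m +>\<^bsub>A_poly_ring m\<^esub> Poly_Mapping.single 0 z"

definition A_coords :: "nat \<Rightarrow> cpoly set \<Rightarrow> nat \<Rightarrow> complex" where
  "A_coords m x = (THE c. (\<forall>k\<ge>3*m+3. c k = 0) \<and>
     x = (\<Oplus>\<^bsub>A_alg m\<^esub>k\<in>{..<3*m+3}. A_scalar m (c k) \<otimes>\<^bsub>A_alg m\<^esub> A_basis m k))"

text \<open>
  The multiplication tensor, in the basis \<open>1, a_1, \<dots>, a_(3m+2)\<close> of \<open>A\<close> in the third factor and
  its dual basis in the first two.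
\<close>

definition T_A :: "nat \<Rightarrow> tensor" where
  "T_A m = Tensor (3*m+3) (3*m+3) (3*m+3)
     (\<lambda>i j k. A_coords m (A_basis m i \<otimes>\<^bsub>A_alg m\<^esub> A_basis m j) k)"


section \<open>Probability distributions\<close>

definition pmf_entropy :: "'a pmf \<Rightarrow> real" where
  "pmf_entropy p = - (\<Sum>x\<in>set_pmf p. pmf p x * ln (pmf p x))"

definition Phi :: "(nat \<times> nat \<times> nat) set" where
  "Phi = {(0,0,2), (0,2,0), (2,0,0), (1,1,0), (1,0,1), (0,1,1)}"

definition marg1 :: "(nat \<times> nat \<times> nat) pmf \<Rightarrow> nat pmf" where
  "marg1 P = map_pmf (\<lambda>(i, j, k). i) P"

definition marg2 :: "(nat \<times> nat \<times> nat) pmf \<Rightarrow> nat pmf" where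
  "marg2 P = map_pmf (\<lambda>(i, j, k). j) P"

definition marg3 :: "(nat \<times> nat \<times> nat) pmf \<Rightarrow> nat pmf" where
  "marg3 P = map_pmf (\<lambda>(i, j, k). k) P"

end

theory Submission
  imports
    Defs
    "HOL-Real_Asymp.Real_Asymp"
    "Jordan_Normal_Form.Char_Poly"
begin

text \<open>
  The structure tensor is the limit, as \<open>t\<close> tends to \<open>0\<close>, of explicit sums of \<open>3 m + 3\<close> rank one
  tensors. So the border rank of \<open>N\<close>-th powers of its symmetrization is at most \<open>(3 m + 3)^(3 N)\<close>, and
  the upper bound on the value is the asymptotic sum inequality.

  For the lower bound the basis is graded such that the nonzero blocks of the structure tensor are
  indexed by \<open>Phi\<close>. In the \<open>N\<close>-th power only the blocks of a type approximating \<open>N P\<close> are kept. Among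
  these, hashing selects a family that degenerates to a direct sum. Each block of the family is a
  product of matrix multiplication tensors and of copies of the component \<open>(1, 1, 0)\<close>, which is a sum of
  two matrix multiplication tensors; a further degeneration of Strassen's type turns it into a direct
  sum of matrix multiplication tensors of equal volume. Stirling's formula for the number of blocks
  gives the entropies.
\<close>

section \<open>Rank and border rank of coefficient functions\<close>

text \<open>A distribution on \<open>Phi\<close> is determined by its three marginals. So every
  nonzero triple of blocks with the chosen marginals is again of the chosen type, and the number of
  independent blocks is, up to a constant, the product of the three marginal counts. The obstacle is
  the component (1,1,0): its two summands share the third factor, so they do not form a direct sum.
  After symmetrization each of the three factors is the shared one in exactly one copy, and this
  symmetry is what the label argument exploits. With K labels per copy, where K is 2 to the number
  of occurrences of (1,1,0), the condition p + q + r = K - 1 keeps about half of K^2 label triples.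
  This is the origin of the factor 4 in the bound, while (2m)^omega comes from one summand in each
  of the three copies. On the upper side, border rank is not turned into rank for a single tensor;
  powers of a limit are bounded up to polynomial factors. These factors, the constants of the
  hashing argument and the error of the factorial estimate all disappear under N-th roots.\<close>

definition rk_le :: "nat \<Rightarrow> ('a \<Rightarrow> 'b \<Rightarrow> 'c \<Rightarrow> complex) \<Rightarrow> bool" where
  "rk_le r t \<longleftrightarrow> (\<exists>u v w. \<forall>i j k. t i j k = (\<Sum>l<r. u l i * v l j * w l k))"

text \<open>Summands may be indexed by any finite set, so products and disjoint unions serve
  directly as sets of summands; if there are fewer than \<open>r\<close>, they are padded with
  zeros.\<close>

lemma rk_leI:
  assumes L: "finite L" "card L \<le> r"
    and eq: "\<And>i j k. t i j k = (\<Sum>l\<in>L. u l i * v l j * w l k)"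
  shows "rk_le r t"
proof -
  obtain h where h: "bij_betw h {0..<card L} L"
    using ex_bij_betw_nat_finite[OF L(1)] by blast
  let ?g = "\<lambda>f l i. if l < card L then f (h l) i else 0"
  have "t i j k = (\<Sum>l<r. ?g u l i * ?g v l j * ?g w l k)" for i j k
  proof -
    have "t i j k = (\<Sum>l<card L. u (h l) i * v (h l) j * w (h l) k)"
      unfolding eq lessThan_atLeast0 by (rule sum.reindex_bij_betw[OF h, symmetric])
    also have "\<dots> = (\<Sum>l<r. ?g u l i * ?g v l j * ?g w l k)"
      using L(2) by (intro sum.mono_neutral_cong_left) auto
    finally show ?thesis .
  qed
  then show ?thesis unfolding rk_le_def
    by (intro exI[of _ "?g u"] exI[of _ "?g v"] exI[of _ "?g w"]) blast
qed

lemma rk_leE: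
  assumes "rk_le r t"
  obtains u v w where "\<And>i j k. t i j k = (\<Sum>l<r. u l i * v l j * w l k)"
  using assms unfolding rk_le_def by metis

lemma rk_le_mono: "rk_le r t \<Longrightarrow> r \<le> s \<Longrightarrow> rk_le s t"
  by (erule rk_leE, rule rk_leI[where L = "{..<r}"]) auto

lemma rk_le_0: "rk_le r (\<lambda>i j k. 0)"
  by (rule rk_leI[where L = "{}"]) auto

lemma rk_le_1: "rk_le (Suc 0) (\<lambda>i j k. u i * v j * w k)"
  by (rule rk_leI[where L = "{()}" and u = "\<lambda>_. u" and v = "\<lambda>_. v" and w = "\<lambda>_. w"]) auto

lemma rk_le_add:
  assumes "rk_le r t" "rk_le s t'"
  shows "rk_le (r + s) (\<lambda>i j k. t i j k + t' i j k)"
proof -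
  obtain u v w where 1: "\<And>i j k. t i j k = (\<Sum>l<r. u l i * v l j * w l k)"
    using rk_leE[OF assms(1)] by blast
  obtain u' v' w' where 2: "\<And>i j k. t' i j k = (\<Sum>l<s. u' l i * v' l j * w' l k)"
    using rk_leE[OF assms(2)] by blast
  show ?thesis
    by (rule rk_leI[where L = "{..<r} <+> {..<s}" and u = "case_sum u u'"
          and v = "case_sum v v'" and w = "case_sum w w'"])
      (auto simp: 1 2 sum.Plus card_Plus)
qed

lemma rk_le_sum:
  assumes "finite S" "\<And>s. s \<in> S \<Longrightarrow> rk_le r (t s)"
  shows "rk_le (card S * r) (\<lambda>i j k. \<Sum>s\<in>S. t s i j k)"
  using assms
proof (induction S rule: finite_induct)
  case (insert x S)
  have "rk_le (r + card S * r) (\<lambda>i j k. t x i j k + (\<Sum>s\<in>S. t s i j k))"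
    using insert by (intro rk_le_add) auto
  then show ?case using insert by (simp add: algebra_simps)
qed (simp add: rk_le_0)

lemma rk_le_reindex:
  assumes "rk_le r t"
  shows "rk_le r (\<lambda>i j k. t (f i) (g j) (h k))"
proof -
  obtain u v w where "\<And>i j k. t i j k = (\<Sum>l<r. u l i * v l j * w l k)"
    using rk_leE[OF assms] by blast
  then show ?thesis
    by (intro rk_leI[where L = "{..<r}" and u = "\<lambda>l i. u l (f i)"
          and v = "\<lambda>l j. v l (g j)" and w = "\<lambda>l k. w l (h k)"]) auto
qed

lemma rk_le_scale:
  assumes "rk_le r t"
  shows "rk_le r (\<lambda>i j k. a i * b j * c k * t i j k)"
proof -
  obtain u v w where 1: "\<And>i j k. t i j k = (\<Sum>l<r. u l i * v l j * w l k)"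
    using rk_leE[OF assms(1)] by blast
  show ?thesis
    by (rule rk_leI[where L = "{..<r}" and u = "\<lambda>l i. a i * u l i"
          and v = "\<lambda>l i. b i * v l i" and w = "\<lambda>l i. c i * w l i"])
      (auto simp: 1 sum_distrib_left mult_ac)
qed

lemma sum_prod3:
  fixes f :: "'a \<Rightarrow> 'd::comm_semiring_0"
  shows "(\<Sum>i\<in>I. f i) * (\<Sum>j\<in>J. g j) * (\<Sum>k\<in>K. h k) = (\<Sum>i\<in>I. \<Sum>j\<in>J. \<Sum>k\<in>K. f i * g j * h k)"
proof -
  have "(\<Sum>i\<in>I. f i) * (\<Sum>j\<in>J. g j) * (\<Sum>k\<in>K. h k) = (\<Sum>i\<in>I. f i * (\<Sum>j\<in>J. g j * (\<Sum>k\<in>K. h k)))"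
    by (simp only: mult.assoc sum_distrib_right)
  then show ?thesis
    by (simp only: sum_distrib_left mult.assoc)
qed

lemma rk_le_linear:
  assumes "rk_le r t"
  shows "rk_le r (\<lambda>i j k. \<Sum>i'\<in>I. \<Sum>j'\<in>J. \<Sum>k'\<in>K. a i i' * b j j' * c k k' * t i' j' k')"
proof -
  obtain u v w where 1: "\<And>i j k. t i j k = (\<Sum>l<r. u l i * v l j * w l k)"
    using rk_leE[OF assms(1)] by blast
  have "(\<Sum>i'\<in>I. \<Sum>j'\<in>J. \<Sum>k'\<in>K. a i i' * b j j' * c k k' * t i' j' k')
    = (\<Sum>l<r. (\<Sum>i'\<in>I. a i i' * u l i') * (\<Sum>j'\<in>J. b j j' * v l j') * (\<Sum>k'\<in>K. c k k' * w l k'))"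
    for i j k
  proof -
    have "(\<Sum>i'\<in>I. \<Sum>j'\<in>J. \<Sum>k'\<in>K. a i i' * b j j' * c k k' * t i' j' k')
      = (\<Sum>i'\<in>I. \<Sum>j'\<in>J. \<Sum>k'\<in>K. \<Sum>l<r. (a i i' * u l i') * (b j j' * v l j') * (c k k' * w l k'))"
      by (simp add: 1 sum_distrib_left mult_ac)
    also have "\<dots> = (\<Sum>l<r. \<Sum>i'\<in>I. \<Sum>j'\<in>J. \<Sum>k'\<in>K. (a i i' * u l i') * (b j j' * v l j') * (c k k' * w l k'))"
      by (simp only: sum.swap[of _ _ "{..<r}"])
    finally show ?thesis
      by (simp only: sum_prod3)
  qed
  then show ?thesis
    by (intro rk_leI[where L = "{..<r}"]) auto
qed

lemma rk_le_mult:
  assumes "rk_le r t" "rk_le s t'"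
  shows "rk_le (r * s) (\<lambda>i j k. t (f i) (g j) (h k) * t' (f' i) (g' j) (h' k))"
proof -
  obtain u v w where 1: "\<And>i j k. t i j k = (\<Sum>l<r. u l i * v l j * w l k)"
    using rk_leE[OF assms(1)] by blast
  obtain u' v' w' where 2: "\<And>i j k. t' i j k = (\<Sum>l<s. u' l i * v' l j * w' l k)"
    using rk_leE[OF assms(2)] by blast
  show ?thesis
  proof (rule rk_leI)
    fix i j k
    show "t (f i) (g j) (h k) * t' (f' i) (g' j) (h' k) = (\<Sum>l\<in>{..<r} \<times> {..<s}.
       (u (fst l) (f i) * u' (snd l) (f' i)) * (v (fst l) (g j) * v' (snd l) (g' j)) *
       (w (fst l) (h k) * w' (snd l) (h' k)))"
      unfolding 1 2 sum_product sum.cartesian_product by (intro sum.cong refl) auto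
  qed auto
qed

lemma rk_le_rotate:
  assumes "rk_le r t"
  shows "rk_le r (\<lambda>j k i. t i j k)"
proof -
  obtain u v w where 1: "\<And>i j k. t i j k = (\<Sum>l<r. u l i * v l j * w l k)"
    using rk_leE[OF assms(1)] by blast
  show ?thesis
    by (rule rk_leI[where L = "{..<r}" and u = v and v = w and w = u]) (auto simp: 1 mult_ac)
qed

text \<open>Expansion along the unit vectors of the first two factors. This trivial bound ensures
  that the \<open>LEAST\<close> in \<open>tensor_rank\<close> is attained.\<close>

lemma rk_le_box:
  fixes t :: "nat \<Rightarrow> nat \<Rightarrow> nat \<Rightarrow> complex"
  assumes "\<And>i j k. t i j k \<noteq> 0 \<Longrightarrow> i < a \<and> j < b"
  shows "rk_le (a * b) t"
proof (rule rk_leI)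
  fix i j k
  let ?u = "\<lambda>(p, q) i. if p = i then 1 else 0 :: complex"
  let ?v = "\<lambda>(p, q) j. if q = j then 1 else 0 :: complex"
  let ?w = "\<lambda>(p, q) k. t p q k"
  have "(\<Sum>l\<in>{..<a} \<times> {..<b}. ?u l i * ?v l j * ?w l k)
    = (\<Sum>p<a. \<Sum>q<b. (if p = i then 1 else 0) * (if q = j then 1 else 0) * t p q k)"
    by (simp add: sum.cartesian_product split_def)
  also have "\<dots> = (\<Sum>p<a. \<Sum>q<b. if p = i then if q = j then t p q k else 0 else 0)"
    by (intro sum.cong refl) auto
  also have "\<dots> = (\<Sum>p<a. if p = i then (\<Sum>q<b. if q = j then t p q k else 0) else 0)"
    by (intro sum.cong refl) auto
  also have "\<dots> = (if i < a \<and> j < b then t i j k else 0)"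
    by auto
  finally show "t i j k = (\<Sum>l\<in>{..<a} \<times> {..<b}. ?u l i * ?v l j * ?w l k)"
    using assms[of i j k] by auto
qed auto

lemma rk_le_entryI:
  assumes "\<And>i j k. i < dim1 T \<Longrightarrow> j < dim2 T \<Longrightarrow> k < dim3 T \<Longrightarrow>
    entry T i j k = (\<Sum>l<r. u l i * v l j * w l k)"
  shows "rk_le r (entry T)"
proof (rule rk_leI)
  fix i j k
  show "entry T i j k = (\<Sum>l<r. (if i < dim1 T then u l i else 0) *
      (if j < dim2 T then v l j else 0) * (if k < dim3 T then w l k else 0))"
    using assms[of i j k] by (auto simp: entry_def)
qed auto

lemma tensor_rank_le:
  assumes "rk_le r (entry T)"
  shows "tensor_rank T \<le> r"
proof -
  obtain u v w where "\<And>i j k. entry T i j k = (\<Sum>l<r. u l i * v l j * w l k)"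
    using rk_leE[OF assms] by blast
  then show ?thesis
    unfolding tensor_rank_def by (intro Least_le exI[of _ u] exI[of _ v] exI[of _ w]) simp
qed

lemma rk_le_tensor_rank: "rk_le (tensor_rank T) (entry T)"
proof -
  have "rk_le (dim1 T * dim2 T) (entry T)"
    by (rule rk_le_box) (auto simp: entry_def split: if_splits)
  then obtain u v w where
    "\<And>i j k. entry T i j k = (\<Sum>l<dim1 T * dim2 T. u l i * v l j * w l k)"
    using rk_leE by blast
  then have "\<exists>(r::nat) u v w. \<forall>i<dim1 T. \<forall>j<dim2 T. \<forall>k<dim3 T.
      entry T i j k = (\<Sum>l<r. u l i * v l j * w l k)"
    by (intro exI[of _ "dim1 T * dim2 T"] exI[of _ u] exI[of _ v] exI[of _ w]) simp
  from LeastI_ex[OF this] obtain u v w where "\<forall>i<dim1 T. \<forall>j<dim2 T. \<forall>k<dim3 T.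
      entry T i j k = (\<Sum>l<tensor_rank T. u l i * v l j * w l k)"
    unfolding tensor_rank_def by blast
  then show ?thesis
    by (intro rk_le_entryI[where u = u and v = v and w = w]) blast
qed

text \<open>A slice factors through a space of dimension \<open>r\<close>. Both matrix factors are
  padded to size \<open>d\<close> so that determinants multiply, and row \<open>r\<close> of the
  second one is zero.\<close>

lemma rk_le_slice_det:
  fixes t :: "nat \<Rightarrow> nat \<Rightarrow> nat \<Rightarrow> complex"
  assumes "rk_le r t" "r < d"
  shows "det (mat d d (\<lambda>(j, k). t i j k)) = 0"
proof -
  obtain u v w where 1: "\<And>i j k. t i j k = (\<Sum>l<r. u l i * v l j * w l k)"
    using rk_leE[OF assms(1)] by blast
  define A where "A = mat d d (\<lambda>(j, l). if l < r then u l i * v l j else 0)"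
  define B where "B = mat d d (\<lambda>(l, k). if l < r then w l k else 0)"
  have "mat d d (\<lambda>(j, k). t i j k) = A * B"
  proof (rule eq_matI)
    fix j k assume jk: "j < dim_row (A * B)" "k < dim_col (A * B)"
    then have jk: "j < d" "k < d" by (auto simp: A_def B_def)
    then have "(A * B) $$ (j, k) = (\<Sum>l<d. (if l < r then u l i * v l j else 0) * (if l < r then w l k else 0))"
      by (simp add: A_def B_def scalar_prod_def lessThan_atLeast0)
    also have "\<dots> = (\<Sum>l<r. u l i * v l j * w l k)"
      using assms(2) by (intro sum.mono_neutral_cong_right) auto
    finally show "mat d d (\<lambda>(j, k). t i j k) $$ (j, k) = (A * B) $$ (j, k)"
      using jk by (simp add: 1)
  qed (auto simp: A_def B_def)
  moreover have "det B = 0"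
  proof -
    have "(\<Prod>i = 0..<d. B $$ (i, p i)) = 0" if "p permutes {0..<d}" for p
      by (rule prod_zero[OF _ bexI[of _ r]])
        (use assms(2) permutes_in_image[OF that, of r] in \<open>auto simp: B_def\<close>)
    moreover have "B \<in> carrier_mat d d" by (simp add: B_def)
    ultimately show ?thesis
      by (subst det_def'[of _ d]) (auto intro!: sum.neutral)
  qed
  ultimately show ?thesis
    by (simp add: A_def B_def det_mult[of _ d])
qed

text \<open>Contracting the first factor with the all-ones vector turns the unit tensor of size
  \<open>d\<close> into an identity matrix, whose determinant does not vanish.\<close>

lemma rk_le_diag_imp_le:
  fixes t :: "nat \<Rightarrow> nat \<Rightarrow> nat \<Rightarrow> complex"
  assumes "rk_le r t" "\<And>i j k. i < d \<Longrightarrow> j < d \<Longrightarrow> k < d \<Longrightarrow> t i j k = of_bool (i = j \<and> j = k)"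
  shows "d \<le> r"
proof (rule ccontr)
  assume "\<not> d \<le> r"
  have "rk_le r (\<lambda>i j k. \<Sum>i'<d. \<Sum>j'<d. \<Sum>k'<d. 1 * of_bool (j = j') * of_bool (k = k') * t i' j' k')"
    (is "rk_le r ?s") by (rule rk_le_linear[OF assms(1)])
  then have "det (mat d d (\<lambda>(j, k). ?s 0 j k)) = 0"
    using \<open>\<not> d \<le> r\<close> by (intro rk_le_slice_det) auto
  moreover have "mat d d (\<lambda>(j, k). ?s 0 j k) = 1\<^sub>m d"
  proof (rule eq_matI)
    fix j k assume "j < dim_row (1\<^sub>m d)" "k < dim_col (1\<^sub>m d)"
    then have jk: "j < d" "k < d" by auto
    have "?s 0 j k = (\<Sum>i'<d. \<Sum>j'<d. if j' = j then \<Sum>k'<d. if k' = k then t i' j' k' else 0 else 0)"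
      by (intro sum.cong refl) (auto intro!: sum.cong)
    also have "\<dots> = (\<Sum>i'<d. t i' j k)" using jk by simp
    also have "\<dots> = (\<Sum>i'<d. if i' = j then of_bool (j = k) else 0)"
      using jk by (intro sum.cong refl) (auto simp: assms(2))
    finally show "mat d d (\<lambda>(j, k). ?s 0 j k) $$ (j, k) = 1\<^sub>m d $$ (j, k)"
      using jk by simp
  qed auto
  ultimately show False by simp
qed

section \<open>Border rank as membership in a closure\<close>

definition brk_le :: "nat \<Rightarrow> (nat \<Rightarrow> nat \<Rightarrow> nat \<Rightarrow> complex) \<Rightarrow> bool" where
  "brk_le r t \<longleftrightarrow> t \<in> closure (Collect (rk_le r))"

lemma continuous_on_tensor_coord:
  "continuous_on S (\<lambda>t :: nat \<Rightarrow> nat \<Rightarrow> nat \<Rightarrow> complex. t i j k)"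
  by (rule continuous_on_product_then_coordinatewise[OF
        continuous_on_product_then_coordinatewise[OF
          continuous_on_product_then_coordinatewise[OF continuous_on_id]]])

lemma continuous_on_tensorI:
  fixes F :: "'x::topological_space \<Rightarrow> nat \<Rightarrow> nat \<Rightarrow> nat \<Rightarrow> complex"
  assumes "\<And>i j k. continuous_on S (\<lambda>t. F t i j k)"
  shows "continuous_on S F"
  by (intro continuous_on_coordinatewise_then_product assms)

text \<open>Border rank bounds pass through every continuous construction that respects rank bounds;
  base changes and symmetrized Kronecker powers are treated in this way.\<close>

lemma brk_le_image:
  fixes F :: "(nat \<Rightarrow> nat \<Rightarrow> nat \<Rightarrow> complex) \<Rightarrow> nat \<Rightarrow> nat \<Rightarrow> nat \<Rightarrow> complex"
  assumes "brk_le r t" "\<And>i j k. continuous_on UNIV (\<lambda>t. F t i j k)"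
    and "\<And>t. rk_le r t \<Longrightarrow> rk_le s (F t)"
  shows "brk_le s (F t)"
proof -
  have "F ` closure (Collect (rk_le r)) \<subseteq> closure (Collect (rk_le s))"
    using assms(3) closure_subset[of "Collect (rk_le s)"]
    by (intro image_closure_subset continuous_on_subset[OF continuous_on_tensorI[OF assms(2)]]) auto
  then show ?thesis using assms(1) by (auto simp: brk_le_def)
qed

lemma brk_le_seq:
  assumes "brk_le r t"
  obtains s where "\<And>n. rk_le r (s n)" "\<And>i j k. (\<lambda>n. s n i j k) \<longlonglongrightarrow> t i j k"
proof -
  obtain s where s: "\<And>n. s n \<in> Collect (rk_le r)" "s \<longlonglongrightarrow> t"
    using assms unfolding brk_le_def closure_sequential by blast
  have "(\<lambda>n. s n i j k) \<longlonglongrightarrow> t i j k" for i j k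
  proof -
    have "isCont (\<lambda>t :: nat \<Rightarrow> nat \<Rightarrow> nat \<Rightarrow> complex. t i j k) t"
      using continuous_on_tensor_coord[of UNIV i j k] by (simp add: continuous_on_eq_continuous_at)
    from isCont_tendsto_compose[OF this s(2)] show ?thesis .
  qed
  then show ?thesis using s(1) by (intro that[of s]) auto
qed

lemma tendsto_funI:
  fixes f :: "'x \<Rightarrow> 'a \<Rightarrow> 'b::topological_space"
  assumes "\<And>x. ((\<lambda>n. f n x) \<longlongrightarrow> l x) F"
  shows "(f \<longlongrightarrow> l) F"
  using assms unfolding limitin_canonical_iff[symmetric] euclidean_product_topology[symmetric]
    limitin_componentwise by auto

section \<open>Kronecker powers of limits\<close>

text \<open>Finite-dimensional subspaces are closed. The induction is Gaussian elimination: a vector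
  that is nonzero at the new coordinate is used to clear it, so every coordinate costs at most one
  spanning vector.\<close>

lemma limit_in_span:
  fixes s :: "nat \<Rightarrow> 'e \<Rightarrow> complex"
  assumes "finite E" "\<And>e. e \<in> E \<Longrightarrow> (\<lambda>n. s n e) \<longlonglongrightarrow> f e"
  shows "\<exists>F c. finite F \<and> card F \<le> card E \<and> (\<forall>e\<in>E. f e = (\<Sum>n\<in>F. c n * s n e))"
  using assms
proof (induction E arbitrary: s f rule: finite_induct)
  case empty
  then show ?case by (intro exI[of _ "{}"]) auto
next
  case (insert e0 E)
  show ?case
  proof (cases "\<forall>n. s n e0 = 0")
    case True
    have "(\<lambda>n. s n e0) \<longlonglongrightarrow> f e0" using insert.prems by simp
    then have "f e0 = 0" using True by (simp add: LIMSEQ_const_iff)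
    obtain F c where "finite F" "card F \<le> card E" "\<forall>e\<in>E. f e = (\<Sum>n\<in>F. c n * s n e)"
      using insert.IH[of s f] insert.prems by auto
    then show ?thesis
      using True \<open>f e0 = 0\<close> insert.hyps by (intro exI[of _ F] exI[of _ c]) auto
  next
    case False
    then obtain n0 where n0: "s n0 e0 \<noteq> 0" by auto
    define s' where "s' = (\<lambda>n e. s n e - s n e0 / s n0 e0 * s n0 e)"
    define f' where "f' = (\<lambda>e. f e - f e0 / s n0 e0 * s n0 e)"
    have "\<And>e. e \<in> E \<Longrightarrow> (\<lambda>n. s' n e) \<longlonglongrightarrow> f' e"
      unfolding s'_def f'_def using insert.prems n0 by (intro tendsto_intros) auto
    then have "\<exists>F c. finite F \<and> card F \<le> card E \<and> (\<forall>e\<in>E. f' e = (\<Sum>n\<in>F. c n * s' n e))"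
      by (rule insert.IH)
    then obtain F c where F: "finite F" "card F \<le> card E"
      and f': "\<forall>e\<in>E. f' e = (\<Sum>n\<in>F. c n * s' n e)" by (elim exE conjE)
    define d where "d = f e0 / s n0 e0 - (\<Sum>n\<in>F. c n * s n e0) / s n0 e0"
    \<comment> \<open>The pivot \<open>n0\<close> may already occur in \<open>F\<close>; its two
      coefficients are then added.\<close>
    define c' where "c' = (\<lambda>n. (if n \<in> F then c n else 0) + (if n = n0 then d else 0))"
    have sum': "(\<Sum>n\<in>insert n0 F. c' n * s n e) = (\<Sum>n\<in>F. c n * s n e) + d * s n0 e" for e
    proof -
      have "(\<Sum>n\<in>insert n0 F. c' n * s n e) =
          (\<Sum>n\<in>insert n0 F. if n \<in> F then c n * s n e else 0)
        + (\<Sum>n\<in>insert n0 F. if n = n0 then d * s n e else 0)"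
        unfolding c'_def sum.distrib[symmetric] by (intro sum.cong) (auto simp: algebra_simps)
      also have "(\<Sum>n\<in>insert n0 F. if n \<in> F then c n * s n e else 0) = (\<Sum>n\<in>F. c n * s n e)"
        using F(1) by (intro sum.mono_neutral_cong_right) auto
      finally show ?thesis using F(1) by simp
    qed
    have "f e = (\<Sum>n\<in>insert n0 F. c' n * s n e)" if "e \<in> insert e0 E" for e
    proof (cases "e = e0")
      case True
      then show ?thesis unfolding sum' d_def using n0 by (simp add: field_simps)
    next
      case False
      then have "f e = (\<Sum>n\<in>F. c n * s' n e) + f e0 / s n0 e0 * s n0 e"
        using bspec[OF f', of e] that unfolding f'_def by (simp add: algebra_simps)
      also have "(\<Sum>n\<in>F. c n * s' n e) =
          (\<Sum>n\<in>F. c n * s n e) - (\<Sum>n\<in>F. c n * s n e0) / s n0 e0 * s n0 e"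
        by (simp add: s'_def sum_subtractf sum_distrib_left sum_distrib_right sum_divide_distrib algebra_simps)
      finally show ?thesis unfolding sum' d_def by (simp add: algebra_simps)
    qed
    moreover have "card (insert n0 F) \<le> card (insert e0 E)"
      using F insert.hyps by (simp add: card_insert_if)
    ultimately show ?thesis using F(1) by (intro exI[of _ "insert n0 F"] exI[of _ c']) auto
  qed
qed

text \<open>The Kronecker power indexed by sequences instead of numbers; only positions below
  \<open>N\<close> are read.\<close>

definition tpow :: "nat \<Rightarrow> ('a \<Rightarrow> 'b \<Rightarrow> 'c \<Rightarrow> complex) \<Rightarrow> (nat \<Rightarrow> 'a) \<Rightarrow> (nat \<Rightarrow> 'b) \<Rightarrow> (nat \<Rightarrow> 'c) \<Rightarrow> complex"
  where "tpow N t x y z = (\<Prod>p<N. t (x p) (y p) (z p))"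

lemma rk_le_tpow: "rk_le r t \<Longrightarrow> rk_le (r ^ N) (tpow N t)"
proof (induction N)
  case 0
  show ?case
    using rk_le_1[of "\<lambda>_. 1" "\<lambda>_. 1" "\<lambda>_. 1"] by (simp add: tpow_def)
next
  case (Suc N)
  have "rk_le (r * r ^ N) (\<lambda>x y z. t (x N) (y N) (z N) * tpow N t x y z)"
    using rk_le_mult[of r t "r ^ N" "tpow N t" "\<lambda>x. x N" "\<lambda>x. x N" "\<lambda>x. x N" "\<lambda>x. x" "\<lambda>x. x" "\<lambda>x. x"]
      Suc by auto
  then show ?case by (simp add: tpow_def mult.commute)
qed

text \<open>The \<open>N\<close>-th Kronecker power of a tensor is a linear function of the vector of degree-\<open>N\<close>
  monomials in its entries. These vectors span a space of polynomial dimension, and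
  finite-dimensional subspaces are closed; so the power of a limit of tensors of rank at most \<open>r\<close>
  is a combination of polynomially many powers of tensors of rank at most \<open>r\<close>.\<close>

lemma rk_le_tpow_limit:
  fixes t :: "'a \<Rightarrow> 'b \<Rightarrow> 'c \<Rightarrow> complex"
  assumes fin: "finite I" "finite J" "finite K"
    and supp: "\<And>i j k. t i j k \<noteq> 0 \<Longrightarrow> i \<in> I \<and> j \<in> J \<and> k \<in> K"
    and lim: "\<And>i j k. i \<in> I \<Longrightarrow> j \<in> J \<Longrightarrow> k \<in> K \<Longrightarrow> (\<lambda>n. s n i j k) \<longlonglongrightarrow> t i j k"
    and rk: "\<And>n. rk_le r (s n)"
  shows "rk_le ((N + 1) ^ (card I * card J * card K) * r ^ N) (tpow N t)"
proof -
  define B where "B = I \<times> J \<times> K"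
  have B: "finite B" "card B = card I * card J * card K"
    using fin by (auto simp: B_def card_cartesian_product)
  define E where "E = (B \<rightarrow>\<^sub>E {..N})"
  have E: "finite E" "card E = (N + 1) ^ card B"
    using B by (auto simp: E_def finite_PiE card_PiE)
  define mon where "mon = (\<lambda>(s :: 'a \<Rightarrow> 'b \<Rightarrow> 'c \<Rightarrow> complex) e. \<Prod>(i, j, k)\<in>B. s i j k ^ e (i, j, k))"
  have "(\<lambda>n. mon (s n) e) \<longlonglongrightarrow> mon t e" for e
    unfolding mon_def using lim by (auto simp: B_def intro!: tendsto_prod tendsto_power)
  from limit_in_span[OF E(1), of "\<lambda>n. mon (s n)" "mon t", OF this] obtain F c where F:
    "finite F" "card F \<le> card E" "\<And>e. e \<in> E \<Longrightarrow> mon t e = (\<Sum>n\<in>F. c n * mon (s n) e)"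
    by blast
  define e where "e = (\<lambda>x y z. \<lambda>b\<in>B. card {p \<in> {..<N}. (x p, y p, z p) = b})"
  have eE: "e x y z \<in> E" for x y z
    using card_mono[of "{..<N}" "{p \<in> {..<N}. (x p, y p, z p) = b}" for b] by (auto simp: E_def e_def)
  have pow: "tpow N s x y z = mon s (e x y z)"
    if "\<forall>p<N. x p \<in> I \<and> y p \<in> J \<and> z p \<in> K" for x y z s
  proof -
    have "tpow N s x y z = (\<Prod>p<N. (\<lambda>(i, j, k). s i j k) (x p, y p, z p))"
      by (simp add: tpow_def)
    also have "\<dots> = (\<Prod>b\<in>B. \<Prod>p\<in>{p \<in> {..<N}. (x p, y p, z p) = b}. (\<lambda>(i, j, k). s i j k) (x p, y p, z p))"
      using B(1) that by (intro prod.group[symmetric]) (auto simp: B_def)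
    also have "\<dots> = (\<Prod>b\<in>B. \<Prod>p\<in>{p \<in> {..<N}. (x p, y p, z p) = b}. (\<lambda>(i, j, k). s i j k) b)"
      by (intro prod.cong refl) auto
    also have "\<dots> = mon s (e x y z)"
      unfolding mon_def e_def by (intro prod.cong refl) (auto simp: prod_constant)
    finally show ?thesis .
  qed
  define ind where "ind = (\<lambda>P :: bool. of_bool P :: complex)"
  have "rk_le (card F * r ^ N) (\<lambda>x y z. \<Sum>n\<in>F. c n * 1 * 1 * tpow N (s n) x y z)"
    using F(1) rk by (intro rk_le_sum rk_le_scale rk_le_tpow)
  \<comment> \<open>Outside the box the approximating tensors are arbitrary, so the combination is
    cut off by indicators that act on each factor separately.\<close>
  from rk_le_scale[OF this, of "\<lambda>x. ind (\<forall>p<N. x p \<in> I)" "\<lambda>x. ind (\<forall>p<N. x p \<in> J)" "\<lambda>x. ind (\<forall>p<N. x p \<in> K)"]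
  have "rk_le (card F * r ^ N) (tpow N t)"
  proof (rule back_subst[of "rk_le (card F * r ^ N)"], intro ext)
    fix x :: "nat \<Rightarrow> 'a" and y :: "nat \<Rightarrow> 'b" and z :: "nat \<Rightarrow> 'c"
    show "ind (\<forall>p<N. x p \<in> I) * ind (\<forall>p<N. y p \<in> J) * ind (\<forall>p<N. z p \<in> K) *
        (\<Sum>n\<in>F. c n * 1 * 1 * tpow N (s n) x y z) = tpow N t x y z"
    proof (cases "\<forall>p<N. x p \<in> I \<and> y p \<in> J \<and> z p \<in> K")
      case True
      then show ?thesis using F(3)[OF eE, of x y z] pow[OF True] by (simp add: ind_def)
    next
      case False
      then have "tpow N t x y z = 0" using supp unfolding tpow_def by (subst prod_zero_iff) auto
      then show ?thesis using False by (auto simp: ind_def)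
    qed
  qed
  moreover have "card F * r ^ N \<le> (N + 1) ^ (card I * card J * card K) * r ^ N"
    using F(2) E B by simp
  ultimately show ?thesis by (rule rk_le_mono)
qed

section \<open>The asymptotic sum inequality\<close>

text \<open>The direct sum of M_(a s, b s, c s) over s < q, indexed by triples (summand, row,
  column). As in \<open>matmul\<close>, the third factor has the pair (k, i).\<close>

definition matmul_sum :: "nat \<Rightarrow> (nat \<Rightarrow> nat) \<Rightarrow> (nat \<Rightarrow> nat) \<Rightarrow> (nat \<Rightarrow> nat) \<Rightarrow>
    nat \<times> nat \<times> nat \<Rightarrow> nat \<times> nat \<times> nat \<Rightarrow> nat \<times> nat \<times> nat \<Rightarrow> complex" where
  "matmul_sum q a b c = (\<lambda>(s, i, j) (s', j', k) (s'', k', i').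
     of_bool (s < q \<and> s = s' \<and> s = s'' \<and> i = i' \<and> j = j' \<and> k = k' \<and> i < a s \<and> j < b s \<and> k < c s))"

abbreviation "copies q a b c \<equiv> matmul_sum q (\<lambda>_. a) (\<lambda>_. b) (\<lambda>_. c)"

text \<open>Matrices of blocks: quotients by the inner dimensions select the block, remainders the
  position inside it.\<close>

lemma copies_mult:
  assumes "a' > 0" "b' > 0" "c' > 0"
  shows "copies K (a * a') (b * b') (c * c') (s, i, j) (s', j', k) (s'', k', i')
    = copies K a b c (s, i div a', j div b') (s', j' div b', k div c') (s'', k' div c', i' div a')
    * copies 1 a' b' c' (0, i mod a', j mod b') (0, j' mod b', k mod c') (0, k' mod c', i' mod a')"
proof -
  have *: "n = n' \<longleftrightarrow> n div d = n' div d \<and> n mod d = n' mod d" for n n' d :: nat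
    by (metis div_mult_mod_eq)
  have "n < d * d' \<longleftrightarrow> n div d' < d" if "d' > 0" for n d d' :: nat
    using that by (simp add: less_mult_imp_div_less div_less_iff_less_mult)
  then show ?thesis
    using assms *[of i i' a'] *[of j j' b'] *[of k k' c']
    by (auto simp: matmul_sum_def)
qed

text \<open>The outer \<open>K\<close> products are computed with \<open>K * L\<close> products of blocks, which are grouped into \<open>L\<close>
  batches of \<open>K\<close> independent products. This is how a bound on \<open>K\<close> copies can be iterated although
  it does not bound the rank of a single copy.\<close>

lemma rk_le_copies_mult:
  assumes "rk_le (K * L) (copies K a b c)" "rk_le r (copies K a' b' c')"
    and pos: "a' > 0" "b' > 0" "c' > 0"
  shows "rk_le (L * r) (copies K (a * a') (b * b') (c * c'))"
proof -
  obtain u v w where 1: "\<And>i j k. copies K a b c i j k = (\<Sum>l<K * L. u l i * v l j * w l k)"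
    using rk_leE[OF assms(1)] by blast
  obtain u' v' w' where 2: "\<And>i j k. copies K a' b' c' i j k = (\<Sum>l<r. u' l i * v' l j * w' l k)"
    using rk_leE[OF assms(2)] by blast
  \<comment> \<open>Outer product number \<open>\<kappa> + m * K\<close> is the
    \<open>\<kappa>\<close>-th one of batch \<open>m\<close>. Summation over \<open>\<kappa>\<close>
    feeds the whole batch into the inner algorithm for \<open>K\<close> independent
    products.\<close>
  define U where "U = (\<lambda>(m, l) (s, i, j). \<Sum>\<kappa><K. u (\<kappa> + m * K) (s, i div a', j div b') * u' l (\<kappa>, i mod a', j mod b'))"
  define V where "V = (\<lambda>(m, l) (s, j, k). \<Sum>\<kappa><K. v (\<kappa> + m * K) (s, j div b', k div c') * v' l (\<kappa>, j mod b', k mod c'))"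
  define W where "W = (\<lambda>(m, l) (s, k, i). \<Sum>\<kappa><K. w (\<kappa> + m * K) (s, k div c', i div a') * w' l (\<kappa>, k mod c', i mod a'))"
  show ?thesis
  proof (rule rk_leI)
    fix X Y Z :: "nat \<times> nat \<times> nat"
    obtain s i j s' j' k s'' k' i' where XYZ: "X = (s, i, j)" "Y = (s', j', k)" "Z = (s'', k', i')"
      by (metis prod_cases3)
    let ?X = "(s, i div a', j div b')" and ?Y = "(s', j' div b', k div c')" and ?Z = "(s'', k' div c', i' div a')"
    let ?x = "\<lambda>\<kappa>. (\<kappa>, i mod a', j mod b')" and ?y = "\<lambda>\<kappa>. (\<kappa>, j' mod b', k mod c')" and ?z = "\<lambda>\<kappa>. (\<kappa>, k' mod c', i' mod a')"
    have m: "(\<Sum>l<r. U (m, l) X * V (m, l) Y * W (m, l) Z)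
      = (\<Sum>\<kappa><K. u (\<kappa> + m * K) ?X * v (\<kappa> + m * K) ?Y * w (\<kappa> + m * K) ?Z) *
        copies 1 a' b' c' (?x 0) (?y 0) (?z 0)" for m
    proof -
      have "(\<Sum>l<r. U (m, l) X * V (m, l) Y * W (m, l) Z)
        = (\<Sum>l<r. \<Sum>\<kappa><K. \<Sum>\<kappa>'<K. \<Sum>\<kappa>''<K. (u (\<kappa> + m * K) ?X * u' l (?x \<kappa>)) *
           (v (\<kappa>' + m * K) ?Y * v' l (?y \<kappa>')) * (w (\<kappa>'' + m * K) ?Z * w' l (?z \<kappa>'')))"
        by (simp add: U_def V_def W_def XYZ sum_prod3)
      also have "\<dots> = (\<Sum>\<kappa><K. \<Sum>\<kappa>'<K. \<Sum>\<kappa>''<K. \<Sum>l<r. (u (\<kappa> + m * K) ?X * u' l (?x \<kappa>)) *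
           (v (\<kappa>' + m * K) ?Y * v' l (?y \<kappa>')) * (w (\<kappa>'' + m * K) ?Z * w' l (?z \<kappa>'')))"
        by (simp only: sum.swap[of _ "{..<K}" "{..<r}"])
      also have "\<dots> = (\<Sum>\<kappa><K. \<Sum>\<kappa>'<K. \<Sum>\<kappa>''<K. u (\<kappa> + m * K) ?X * v (\<kappa>' + m * K) ?Y * w (\<kappa>'' + m * K) ?Z *
           copies K a' b' c' (?x \<kappa>) (?y \<kappa>') (?z \<kappa>''))"
        unfolding 2 sum_distrib_left by (intro sum.cong refl) (simp add: mult_ac)
      also have "\<dots> = (\<Sum>\<kappa><K. \<Sum>\<kappa>'<K. \<Sum>\<kappa>''<K. if \<kappa>'' = \<kappa> then if \<kappa>' = \<kappa> then
           u (\<kappa> + m * K) ?X * v (\<kappa>' + m * K) ?Y * w (\<kappa>'' + m * K) ?Z *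
           copies 1 a' b' c' (?x 0) (?y 0) (?z 0) else 0 else 0)"
        by (intro sum.cong refl) (auto simp: matmul_sum_def)
      also have "\<dots> = (\<Sum>\<kappa><K. u (\<kappa> + m * K) ?X * v (\<kappa> + m * K) ?Y * w (\<kappa> + m * K) ?Z *
           copies 1 a' b' c' (?x 0) (?y 0) (?z 0))"
        by (intro sum.cong refl) simp
      finally show ?thesis by (simp only: sum_distrib_right)
    qed
    have "(\<Sum>l\<in>{..<L} \<times> {..<r}. U l X * V l Y * W l Z) = (\<Sum>m<L. \<Sum>l<r. U (m, l) X * V (m, l) Y * W (m, l) Z)"
      by (simp add: sum.cartesian_product split_def)
    also have "\<dots> = (\<Sum>m<L. \<Sum>\<kappa><K. u (\<kappa> + m * K) ?X * v (\<kappa> + m * K) ?Y * w (\<kappa> + m * K) ?Z) *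
        copies 1 a' b' c' (?x 0) (?y 0) (?z 0)"
      unfolding m by (simp only: sum_distrib_right)
    also have "(\<Sum>m<L. \<Sum>\<kappa><K. u (\<kappa> + m * K) ?X * v (\<kappa> + m * K) ?Y * w (\<kappa> + m * K) ?Z)
      = copies K a b c ?X ?Y ?Z"
      unfolding 1 mult.commute[of K L]
      by (simp add: sum.nat_group[symmetric] atLeast0LessThan sum.shift_bounds_nat_ivl
          sum.atLeastLessThan_shift_0 add.commute flip: lessThan_atLeast0)
    finally show "copies K (a * a') (b * b') (c * c') X Y Z = (\<Sum>l\<in>{..<L} \<times> {..<r}. U l X * V l Y * W l Z)"
      unfolding XYZ copies_mult[OF pos] by simp
  qed auto
qed

text \<open>Only \<open>L\<close> is raised to the power \<open>s\<close>; the factor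
  \<open>K\<close> occurs once and becomes a constant in the asymptotics. For s = 0 this is the unit
  tensor of size \<open>K\<close>.\<close>

lemma rk_le_copies_power:
  assumes "rk_le (K * L) (copies K a b c)" "a > 0" "b > 0" "c > 0"
  shows "rk_le (K * L ^ s) (copies K (a ^ s) (b ^ s) (c ^ s))"
proof (induction s)
  case 0
  show ?case
  proof (rule rk_leI)
    fix X Y Z :: "nat \<times> nat \<times> nat"
    have "(\<Sum>l<K. of_bool (X = (l, 0, 0)) * of_bool (Y = (l, 0, 0)) * of_bool (Z = (l, 0, 0)))
      = (\<Sum>l<K. if l = fst X then of_bool (X = (l, 0, 0) \<and> Y = (l, 0, 0) \<and> Z = (l, 0, 0)) else 0 :: complex)"
      by (intro sum.cong) auto
    then show "copies K (a ^ 0) (b ^ 0) (c ^ 0) X Y Z = (\<Sum>l<K. of_bool (X = (l, 0, 0)) *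
        of_bool (Y = (l, 0, 0)) * of_bool (Z = (l, 0, 0)))"
      by (cases X; cases Y; cases Z) (auto simp: matmul_sum_def)
  qed auto
next
  case (Suc s)
  have "rk_le (L * (K * L ^ s)) (copies K (a * a ^ s) (b * b ^ s) (c * c ^ s))"
    using assms Suc by (intro rk_le_copies_mult) auto
  then show ?case by (simp add: mult_ac)
qed

lemma rk_le_copies_cyclic:
  assumes "rk_le r (copies q a b c)"
  shows "rk_le r (copies q b c a)"
proof -
  have "copies q b c a = (\<lambda>j k i. copies q a b c i j k)"
    by (intro ext) (auto simp: matmul_sum_def split: prod.splits)
  then show ?thesis using rk_le_rotate[OF assms] by simp
qed

text \<open>The three cyclic rotations obey the same rank bound, and their Kronecker product has
  square format.\<close>

lemma rk_le_copies_cube: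
  assumes "rk_le r (copies 1 a b c)" "a > 0" "b > 0" "c > 0"
  shows "rk_le (r ^ 3) (copies 1 (a * b * c) (a * b * c) (a * b * c))"
proof -
  have 2: "rk_le r (copies 1 b c a)" and 3: "rk_le r (copies 1 c a b)"
    using assms(1) by (auto intro: rk_le_copies_cyclic)
  have "rk_le (r * r) (copies 1 (a * b) (b * c) (c * a))"
    using rk_le_copies_mult[of 1 r a b c r b c a] assms 2 by simp
  then have "rk_le (r * r * r) (copies 1 (a * b * c) (b * c * a) (c * a * b))"
    using rk_le_copies_mult[of 1 "r * r" "a * b" "b * c" "c * a" r c a b] assms 3 by simp
  then show ?thesis by (simp add: power3_eq_cube mult_ac)
qed

section \<open>Coordinates of matrix multiplication tensors\<close>

lemma index_less:
  fixes m n :: nat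
  assumes "i < m" "j < n"
  shows "i * n + j < m * n"
proof -
  have "i * n + j < Suc i * n" using assms by simp
  also have "\<dots> \<le> m * n" using assms by (intro mult_le_mono1) simp
  finally show ?thesis .
qed

lemma index_eq_iff:
  fixes n :: nat
  assumes "j < n" "j' < n"
  shows "i * n + j = i' * n + j' \<longleftrightarrow> i = i' \<and> j = j'"
proof
  assume eq: "i * n + j = i' * n + j'"
  have "(i * n + j) div n = i" "(i' * n + j') div n = i'" using assms by auto
  with eq show "i = i' \<and> j = j'" by auto
qed auto

lemma index_obtain:
  fixes m n :: nat
  assumes "p < m * n"
  obtains i j where "i < m" "j < n" "p = i * n + j"
proof
  show "p div n < m" "p mod n < n" "p = p div n * n + p mod n"
    using assms by (auto simp: less_mult_imp_div_less intro!: mod_less_divisor gr0I)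
qed

lemma entry_matmul:
  assumes "i < a" "j < b" "j' < b" "k < c" "k' < c" "i' < a"
  shows "entry (matmul a b c) (i * b + j) (j' * c + k) (k' * a + i') = of_bool (i = i' \<and> j = j' \<and> k = k')"
proof -
  have "(\<exists>x<a. \<exists>y<b. \<exists>z<c. i * b + j = x * b + y \<and> j' * c + k = y * c + z \<and> k' * a + i' = z * a + x)
    \<longleftrightarrow> i = i' \<and> j = j' \<and> k = k'"
    using assms by (auto simp: index_eq_iff)
  then show ?thesis
    using assms by (simp add: entry_def matmul_def index_less)
qed

lemma tensor_rank_matmul_le:
  assumes "rk_le r (copies 1 a b c)"
  shows "tensor_rank (matmul a b c) \<le> r"
proof (rule tensor_rank_le)
  obtain u v w where 1: "\<And>i j k. copies 1 a b c i j k = (\<Sum>l<r. u l i * v l j * w l k)"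
    using rk_leE[OF assms] by blast
  show "rk_le r (entry (matmul a b c))"
  proof (rule rk_le_entryI)
    fix p q r'
    assume "p < dim1 (matmul a b c)" "q < dim2 (matmul a b c)" "r' < dim3 (matmul a b c)"
    then have "p < a * b" "q < b * c" "r' < c * a" by (auto simp: matmul_def)
    then obtain i j j' k k' i' where *: "i < a" "j < b" "p = i * b + j" "j' < b" "k < c" "q = j' * c + k"
      "k' < c" "i' < a" "r' = k' * a + i'"
      by (elim index_obtain) blast
    then show "entry (matmul a b c) p q r' = (\<Sum>l<r. u l (0, p div b, p mod b) *
        v l (0, q div c, q mod c) * w l (0, r' div a, r' mod a))"
      unfolding 1[symmetric] using entry_matmul[of i a j b j' k c k' i'] by (auto simp: matmul_sum_def)
  qed
qed

lemma rk_le_copies_mono: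
  assumes "rk_le r (copies K a b c)" "K' \<le> K" "a' \<le> a" "b' \<le> b" "c' \<le> c"
  shows "rk_le r (copies K' a' b' c')"
proof -
  let ?f = "\<lambda>X. of_bool (fst X < K' \<and> fst (snd X) < a' \<and> snd (snd X) < b') :: complex"
  let ?g = "\<lambda>Y. of_bool (snd (snd Y) < c') :: complex"
  have "copies K' a' b' c' = (\<lambda>X Y Z. ?f X * ?g Y * 1 * copies K a b c X Y Z)"
    using assms(2-) by (intro ext) (auto simp: matmul_sum_def split: prod.splits)
  then show ?thesis using rk_le_scale[OF assms(1), of ?f ?g "\<lambda>_. 1"] by simp
qed

lemma tensor_rank_matmul_pos:
  assumes "n > 0"
  shows "tensor_rank (matmul n n n) > 0"
proof (rule ccontr)
  assume "\<not> ?thesis"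
  then have "rk_le 0 (entry (matmul n n n))"
    using rk_le_tensor_rank[of "matmul n n n"] by simp
  then have "entry (matmul n n n) (0 * n + 0) (0 * n + 0) (0 * n + 0) = 0"
    by (simp add: rk_le_def)
  then show False using assms by (subst (asm) entry_matmul) auto
qed

section \<open>Rank bounds and the exponent\<close>

abbreviation omega_set :: "real set" where
  "omega_set \<equiv> {\<tau> :: real. \<forall>\<epsilon>>0.
     (\<lambda>n. real (tensor_rank (matmul n n n))) \<in> O(\<lambda>n. real n powr (\<tau> + \<epsilon>))}"

text \<open>A lower bound of the set is required before \<open>Inf\<close> can be compared with its
  elements. If \<open>\<tau>\<close> were negative, the choice of - \<open>\<tau>\<close> / 2 as
  tolerance would force the rank to 0, yet it is at least 1 for n >= 1.\<close>

lemma omega_set_nonneg: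
  assumes "\<tau> \<in> omega_set"
  shows "0 \<le> \<tau>"
proof (rule ccontr)
  assume "\<not> 0 \<le> \<tau>"
  then have neg: "\<tau> / 2 < 0" by simp
  have "(\<lambda>n. 1 :: real) \<in> O(\<lambda>n. real (tensor_rank (matmul n n n)))"
    using tensor_rank_matmul_pos by (intro bigoI[of _ 1] eventually_sequentiallyI[of 1])
      (auto simp: Suc_le_eq real_of_nat_ge_one_iff)
  also have "(\<lambda>n. real (tensor_rank (matmul n n n))) \<in> O(\<lambda>n. real n powr (\<tau> + (- \<tau> / 2)))"
  proof -
    have all: "\<forall>\<epsilon>>0. (\<lambda>n. real (tensor_rank (matmul n n n))) \<in> O(\<lambda>n. real n powr (\<tau> + \<epsilon>))"
      using assms by blast
    have "- \<tau> / 2 > 0" using neg by simp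
    with spec[OF all, of "- \<tau> / 2"] show ?thesis by (rule mp)
  qed
  also have "(\<lambda>n. real n powr (\<tau> + (- \<tau> / 2))) = (\<lambda>n. real n powr (\<tau> / 2))" by simp
  also have "(\<lambda>n. real n powr (\<tau> / 2)) \<in> o(\<lambda>n. 1 :: real)"
    using neg by real_asymp
  finally have "(\<lambda>n :: nat. 1 :: real) \<in> o(\<lambda>n. 1 :: real)" .
  from landau_o.smallD[OF this, of "1 / 2"] show False by simp
qed

text \<open>The exponent log_q B' is admissible: every \<open>n\<close> is rounded up to the next
  power of \<open>q\<close>, which costs one more factor \<open>B'\<close>.\<close>

lemma powr_omega_le:
  fixes B :: real
  assumes rk: "\<And>s. rk_le (C * B' ^ s) (copies 1 (q ^ s) (q ^ s) (q ^ s))"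
    and "q \<ge> 2" "B' \<ge> 1"
  shows "real q powr omega \<le> real B'"
proof -
  define \<tau> where "\<tau> = log (real q) (real B')"
  have q: "real q > 1" using assms by simp
  have B: "real q powr \<tau> = real B'" unfolding \<tau>_def using assms q by (intro powr_log_cancel) auto
  have "\<tau> \<ge> 0" unfolding \<tau>_def using assms q by (subst zero_le_log_cancel_iff) auto
  have bound: "real (tensor_rank (matmul n n n)) \<le> real C * real B' * real n powr \<tau>" if "n \<ge> 1" for n
  proof -
    define s where "s = (LEAST s. n \<le> q ^ s)"
    have "n < q ^ n" using assms by (intro power_gt_expt) simp
    then have s: "n \<le> q ^ s" unfolding s_def by (intro LeastI[of "\<lambda>s. n \<le> q ^ s" n]) simp
    have "rk_le (C * B' ^ s) (copies 1 n n n)"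
      using s by (intro rk_le_copies_mono[OF rk[of s]]) auto
    then have "tensor_rank (matmul n n n) \<le> C * B' ^ s" by (rule tensor_rank_matmul_le)
    then have "real (tensor_rank (matmul n n n)) \<le> real C * real B' ^ s"
      by (metis of_nat_le_iff of_nat_mult of_nat_power)
    also have "real B' ^ s \<le> real B' * real n powr \<tau>"
    proof (cases s)
      case 0
      then have "n = 1" using s that by simp
      then show ?thesis using 0 assms by simp
    next
      case (Suc s')
      then have "\<not> n \<le> q ^ s'" unfolding s_def using not_less_Least[of s' "\<lambda>s. n \<le> q ^ s"] by simp
      then have "real q ^ s' \<le> real n" by (metis of_nat_le_iff of_nat_power nat_le_linear)
      then have "(real q ^ s') powr \<tau> \<le> real n powr \<tau>" using \<open>\<tau> \<ge> 0\<close> by (intro powr_mono2) auto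
      also have "(real q ^ s') powr \<tau> = real B' ^ s'"
        unfolding B[symmetric] using q by (simp add: powr_powr powr_realpow[symmetric] mult.commute)
      finally show ?thesis using Suc by (simp add: mult_left_mono)
    qed
    finally show ?thesis by (simp add: mult_left_mono mult.assoc)
  qed
  have "\<tau> \<in> omega_set"
  proof (intro CollectI allI impI bigoI[of _ "real C * real B'"] eventually_sequentiallyI[of 1])
    fix \<epsilon> :: real and n :: nat assume "\<epsilon> > 0" "1 \<le> n"
    then have "real n powr \<tau> \<le> real n powr (\<tau> + \<epsilon>)" by (intro powr_mono) auto
    then show "norm (real (tensor_rank (matmul n n n))) \<le> real C * real B' * norm (real n powr (\<tau> + \<epsilon>))"
      using bound[OF \<open>1 \<le> n\<close>] mult_left_mono[of "real n powr \<tau>" "real n powr (\<tau> + \<epsilon>)" "real C * real B'"]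
      by simp
  qed
  then have "omega \<le> \<tau>"
    unfolding omega_def using omega_set_nonneg by (intro cInf_lower bdd_belowI[of _ 0]) auto
  then have "real q powr omega \<le> real q powr \<tau>" using q by (intro powr_mono) auto
  then show ?thesis using B by simp
qed

text \<open>\<open>L\<close> is R / K rounded up. Since the copies contain a unit tensor of size
  \<open>K\<close>, one has K <= R, and rounding at most doubles the bound. The factor 2 disappears
  later, when this is applied to \<open>N\<close>-th powers.\<close>

lemma copies_powr_omega_le:
  assumes rk: "rk_le R (copies K a b c)" and pos: "a \<ge> 1" "b \<ge> 1" "c \<ge> 1"
  shows "real K * real (a * b * c) powr (omega / 3) \<le> 2 * real R"
proof (cases "K = 0")
  case False
  have "rk_le R (\<lambda>i j k. copies K a b c (i, 0, 0) (j, 0, 0) (k, 0, 0))"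
    by (rule rk_le_reindex[OF rk])
  then have "K \<le> R"
    by (rule rk_le_diag_imp_le) (use pos in \<open>auto simp: matmul_sum_def\<close>)
  define L where "L = (R + K - 1) div K"
  have L1: "R \<le> K * L"
  proof -
    have "R + K - 1 = K * L + (R + K - 1) mod K" unfolding L_def by simp
    moreover have "(R + K - 1) mod K \<le> K - 1" using False by (simp add: Suc_leI[of _ K] less_Suc_eq_le[symmetric])
    ultimately show ?thesis using False by linarith
  qed
  have L2: "K * L \<le> 2 * R"
  proof -
    have "K * L \<le> R + K - 1" unfolding L_def by (metis times_div_less_eq_dividend)
    then show ?thesis using \<open>K \<le> R\<close> by linarith
  qed
  have "L \<ge> 1" using L1 \<open>K \<le> R\<close> False by (cases L) auto
  define q where "q = a * b * c"
  have "real q powr (omega / 3) \<le> real L"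
  proof (cases "q = 1")
    case False
    moreover have "q \<ge> 1" using pos by (simp add: q_def)
    ultimately have "q \<ge> 2" by simp
    \<comment> \<open>Passing to a single copy after taking the power leaves \<open>K ^ 3\<close> as
      a constant, and the growth rate is \<open>L ^ 3\<close>.\<close>
    have "rk_le (K ^ 3 * (L ^ 3) ^ s) (copies 1 (q ^ s) (q ^ s) (q ^ s))" for s
    proof -
      have "rk_le (K * L ^ s) (copies K (a ^ s) (b ^ s) (c ^ s))"
        using pos rk_le_mono[OF rk L1] by (intro rk_le_copies_power) auto
      then have "rk_le (K * L ^ s) (copies 1 (a ^ s) (b ^ s) (c ^ s))"
        using \<open>K \<noteq> 0\<close> by (elim rk_le_copies_mono) auto
      from rk_le_copies_cube[OF this] pos
      show ?thesis by (simp add: q_def power_mult_distrib power_mult[symmetric] mult.commute)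
    qed
    from powr_omega_le[OF this \<open>q \<ge> 2\<close>] \<open>L \<ge> 1\<close> have "real q powr omega \<le> real L ^ 3" by simp
    then have "(real q powr omega) powr (1 / 3) \<le> (real L ^ 3) powr (1 / 3)" by (intro powr_mono2) auto
    also have "(real L ^ 3) powr (1 / 3) = real L"
      using \<open>L \<ge> 1\<close> by (simp add: powr_realpow[symmetric] powr_powr del: powr_numeral)
    finally show ?thesis by (simp add: powr_powr)
  qed (use \<open>L \<ge> 1\<close> in simp)
  then have "real K * real q powr (omega / 3) \<le> real (K * L)" by (simp add: mult_left_mono)
  also have "\<dots> \<le> 2 * real R" using L2 by (metis of_nat_le_iff of_nat_mult of_nat_numeral)
  finally show ?thesis by (simp add: q_def)
qed simp

section \<open>Grouping a power of a direct sum by types\<close>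

lemma prod_by_type:
  fixes g :: "nat \<Rightarrow> 'x::comm_monoid_mult" and N :: nat
  assumes "\<And>p. p < N \<Longrightarrow> \<sigma> p < q"
  shows "(\<Prod>p<N. g (\<sigma> p)) = (\<Prod>s<q. g s ^ card {p \<in> {..<N}. \<sigma> p = s})"
proof -
  have "(\<Prod>p<N. g (\<sigma> p)) = (\<Prod>s<q. \<Prod>p\<in>{p \<in> {..<N}. \<sigma> p = s}. g (\<sigma> p))"
    using assms by (intro prod.group[symmetric]) auto
  also have "\<dots> = (\<Prod>s<q. \<Prod>p\<in>{p \<in> {..<N}. \<sigma> p = s}. g s)"
    by (intro prod.cong refl) auto
  finally show ?thesis by (simp add: prod_constant)
qed

text \<open>Each sequence in \<open>Fib\<close> selects a summand of the power, and all these
  summands have the common format A, B, C. Numbering their index tuples, which is possible by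
  counting, turns them into equal copies.\<close>

lemma copies_in_tpow:
  assumes rk: "rk_le R (tpow N (matmul_sum q a b c))"
    and Fib: "finite Fib" "Fib \<subseteq> {..<N} \<rightarrow>\<^sub>E {..<q}"
    and dims: "\<And>\<sigma>. \<sigma> \<in> Fib \<Longrightarrow> (\<Prod>p<N. a (\<sigma> p)) = A" "\<And>\<sigma>. \<sigma> \<in> Fib \<Longrightarrow> (\<Prod>p<N. b (\<sigma> p)) = B"
      "\<And>\<sigma>. \<sigma> \<in> Fib \<Longrightarrow> (\<Prod>p<N. c (\<sigma> p)) = C"
  shows "rk_le R (copies (card Fib) A B C)"
proof -
  obtain e where e: "bij_betw e {0..<card Fib} Fib"
    using ex_bij_betw_nat_finite[OF Fib(1)] by blast
  then have eF: "e \<kappa> \<in> Fib" if "\<kappa> < card Fib" for \<kappa>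
    using that by (auto simp: bij_betw_def)
  have ex: "\<exists>h. bij_betw h {..<d} (PiE {..<N} (\<lambda>p. {..<g (e \<kappa> p)}))"
    if "(\<Prod>p<N. g (e \<kappa> p)) = d" for g and d :: nat and \<kappa>
    using that by (intro finite_same_card_bij) (auto simp: finite_PiE card_PiE)
  obtain \<alpha> where \<alpha>: "\<And>\<kappa>. \<kappa> < card Fib \<Longrightarrow> bij_betw (\<alpha> \<kappa>) {..<A} (PiE {..<N} (\<lambda>p. {..<a (e \<kappa> p)}))"
    using ex[of a _ A] dims(1)[OF eF] by metis
  obtain \<beta> where \<beta>: "\<And>\<kappa>. \<kappa> < card Fib \<Longrightarrow> bij_betw (\<beta> \<kappa>) {..<B} (PiE {..<N} (\<lambda>p. {..<b (e \<kappa> p)}))"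
    using ex[of b _ B] dims(2)[OF eF] by metis
  obtain \<gamma> where \<gamma>: "\<And>\<kappa>. \<kappa> < card Fib \<Longrightarrow> bij_betw (\<gamma> \<kappa>) {..<C} (PiE {..<N} (\<lambda>p. {..<c (e \<kappa> p)}))"
    using ex[of c _ C] dims(3)[OF eF] by metis
  have inj: "(\<forall>p<N. h x p = h y p) \<longleftrightarrow> x = y" and rng: "p < N \<Longrightarrow> h x p < g p"
    if "bij_betw h {..<d} (PiE {..<N} (\<lambda>p. {..<g p}))" "x < d" "y < d" for h :: "nat \<Rightarrow> nat \<Rightarrow> nat" and d g x y p
  proof -
    have "h x \<in> PiE {..<N} (\<lambda>p. {..<g p})" "h y \<in> PiE {..<N} (\<lambda>p. {..<g p})"
      using that by (auto simp: bij_betw_def)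
    then have "(\<forall>p<N. h x p = h y p) \<longleftrightarrow> h x = h y"
      by (intro iffI) (rule PiE_ext, assumption+, simp_all)
    then show "(\<forall>p<N. h x p = h y p) \<longleftrightarrow> x = y"
      using that by (auto simp: bij_betw_def inj_on_def)
    show "p < N \<Longrightarrow> h x p < g p" using \<open>h x \<in> _\<close> by auto
  qed
  have e_inj: "(\<forall>p<N. e x p = e y p) \<longleftrightarrow> x = y" if "x < card Fib" "y < card Fib" for x y
  proof -
    have "(\<forall>p<N. e x p = e y p) \<longleftrightarrow> e x = e y"
      using subsetD[OF Fib(2) eF[OF that(1)]] subsetD[OF Fib(2) eF[OF that(2)]]
      by (intro iffI) (rule PiE_ext, assumption+, simp_all)
    then show ?thesis using that e by (auto simp: bij_betw_def inj_on_def)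
  qed
  define ind where "ind = (\<lambda>(A :: nat) (B :: nat) (\<kappa>, i, j). of_bool (\<kappa> < card Fib \<and> i < A \<and> j < B) :: complex)"
  define em where "em = (\<lambda>(\<alpha> :: nat \<Rightarrow> nat \<Rightarrow> nat \<Rightarrow> nat) (\<beta> :: nat \<Rightarrow> nat \<Rightarrow> nat \<Rightarrow> nat) (\<kappa>, i, j) p. (e \<kappa> p, \<alpha> \<kappa> i p, \<beta> \<kappa> j p))"
  have "copies (card Fib) A B C = (\<lambda>X Y Z. ind A B X * ind B C Y * ind C A Z *
      tpow N (matmul_sum q a b c) (em \<alpha> \<beta> X) (em \<beta> \<gamma> Y) (em \<gamma> \<alpha> Z))"
  proof (intro ext)
    fix X Y Z :: "nat \<times> nat \<times> nat"
    obtain \<kappa> i j \<kappa>' j' k \<kappa>'' k' i' where XYZ: "X = (\<kappa>, i, j)" "Y = (\<kappa>', j', k)" "Z = (\<kappa>'', k', i')"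
      by (metis prod_cases3)
    show "copies (card Fib) A B C X Y Z = ind A B X * ind B C Y * ind C A Z *
      tpow N (matmul_sum q a b c) (em \<alpha> \<beta> X) (em \<beta> \<gamma> Y) (em \<gamma> \<alpha> Z)"
    proof (cases "\<kappa> < card Fib \<and> \<kappa>' < card Fib \<and> \<kappa>'' < card Fib \<and> i < A \<and> i' < A \<and> j < B \<and> j' < B \<and> k < C \<and> k' < C")
      case False
      then show ?thesis by (auto simp: XYZ ind_def matmul_sum_def)
    next
      case True
      have prod_of_bool: "(\<Prod>p<N. of_bool (Q p) :: complex) = of_bool (\<forall>p<N. Q p)" for Q
        by (induction N) (auto simp: less_Suc_eq)
      have "tpow N (matmul_sum q a b c) (em \<alpha> \<beta> X) (em \<beta> \<gamma> Y) (em \<gamma> \<alpha> Z) = of_bool (\<forall>p<N.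
          e \<kappa> p < q \<and> e \<kappa> p = e \<kappa>' p \<and> e \<kappa> p = e \<kappa>'' p \<and> \<alpha> \<kappa> i p = \<alpha> \<kappa>'' i' p \<and>
          \<beta> \<kappa> j p = \<beta> \<kappa>' j' p \<and> \<gamma> \<kappa>' k p = \<gamma> \<kappa>'' k' p \<and> \<alpha> \<kappa> i p < a (e \<kappa> p) \<and> \<beta> \<kappa> j p < b (e \<kappa> p) \<and> \<gamma> \<kappa>' k p < c (e \<kappa> p))"
        unfolding tpow_def em_def XYZ matmul_sum_def by (simp add: prod_of_bool)
      also have "\<dots> = of_bool (\<kappa> = \<kappa>' \<and> \<kappa> = \<kappa>'' \<and> i = i' \<and> j = j' \<and> k = k')"
      proof (cases "\<kappa> = \<kappa>' \<and> \<kappa> = \<kappa>''")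
        case False
        then show ?thesis using e_inj[of \<kappa> \<kappa>'] e_inj[of \<kappa> \<kappa>''] True by auto
      next
        case eq: True
        have "e \<kappa> p < q" if "p < N" for p using eF[of \<kappa>] True Fib(2) that by (auto simp: PiE_iff)
        then show ?thesis
          using eq True inj[OF \<alpha>[of \<kappa>], of i i'] inj[OF \<beta>[of \<kappa>], of j j'] inj[OF \<gamma>[of \<kappa>], of k k']
            rng[OF \<alpha>[of \<kappa>], of i i'] rng[OF \<beta>[of \<kappa>], of j j'] rng[OF \<gamma>[of \<kappa>], of k k']
          by (intro arg_cong[where f = of_bool]) blast
      qed
      finally show ?thesis using True by (auto simp: XYZ ind_def matmul_sum_def)
    qed
  qed
  then show ?thesis
    using rk_le_scale[OF rk_le_reindex[OF rk]] by simp
qed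

text \<open>Otherwise (x / y)^N would outgrow every polynomial in \<open>N\<close>. This removes the
  polynomial losses incurred by passing to powers.\<close>

lemma le_of_powers_le:
  fixes x y :: real
  assumes le: "\<And>N. x ^ N \<le> C * (real N + 1) ^ d * y ^ N" and y: "y \<ge> 0"
  shows "x \<le> y"
proof (rule ccontr)
  assume "\<not> x \<le> y"
  then have "x > y" by simp
  show False
  proof (cases "y = 0")
    case True
    then show False using le[of 1] \<open>x > y\<close> by simp
  next
    case False
    define r where "r = x / y"
    have r: "r > 1" unfolding r_def using False y \<open>x > y\<close> by simp
    have "r ^ N \<le> C * (real N + 1) ^ d" for N
      using le[of N] False y by (simp add: r_def power_divide field_simps)
    moreover have "filterlim (\<lambda>N. r ^ N - C * (real N + 1) ^ d) at_top sequentially"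
      using r by real_asymp
    ultimately have "eventually (\<lambda>N. r ^ N - C * (real N + 1) ^ d \<le> 0) sequentially"
      "eventually (\<lambda>N. r ^ N - C * (real N + 1) ^ d > 0) sequentially"
      by (auto simp: filterlim_at_top_dense simp del: diff_gt_0_iff_gt)
    then have "eventually (\<lambda>N :: nat. False) sequentially" by eventually_elim simp
    then show False by simp
  qed
qed

text \<open>Schoenhage's asymptotic sum inequality for limits. The \<open>N\<close>-th power of the
  sum is expanded over sequences and grouped by type; there are polynomially many types, and each
  one yields copies of a single matrix multiplication tensor.\<close>

lemma sum_powr_omega_le_matmul_sum:
  assumes pos: "\<And>s. s < q \<Longrightarrow> a s \<ge> 1 \<and> b s \<ge> 1 \<and> c s \<ge> 1"
    and rk: "\<And>n. rk_le R (S n)"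
    and lim: "\<And>s i j s' j' k s'' k' i'. s < q \<Longrightarrow> s' < q \<Longrightarrow> s'' < q \<Longrightarrow> i < a s \<Longrightarrow> j < b s \<Longrightarrow>
      j' < b s' \<Longrightarrow> k < c s' \<Longrightarrow> k' < c s'' \<Longrightarrow> i' < a s'' \<Longrightarrow>
      (\<lambda>n. S n (s, i, j) (s', j', k) (s'', k', i')) \<longlonglongrightarrow> matmul_sum q a b c (s, i, j) (s', j', k) (s'', k', i')"
  shows "(\<Sum>s<q. real (a s * b s * c s) powr (omega / 3)) \<le> real R"
proof -
  define f where "f = (\<lambda>s. real (a s * b s * c s) powr (omega / 3))"
  define I J K where "I = Sigma {..<q} (\<lambda>s. {..<a s} \<times> {..<b s})"
    and "J = Sigma {..<q} (\<lambda>s. {..<b s} \<times> {..<c s})" and "K = Sigma {..<q} (\<lambda>s. {..<c s} \<times> {..<a s})"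
  define D where "D = card I * card J * card K"
  have power_rk: "rk_le ((N + 1) ^ D * R ^ N) (tpow N (matmul_sum q a b c))" for N
    unfolding D_def
  proof (rule rk_le_tpow_limit[where s = S])
    show "i \<in> I \<and> j \<in> J \<and> k \<in> K" if "matmul_sum q a b c i j k \<noteq> 0" for i j k
      using that by (auto simp: matmul_sum_def I_def J_def K_def split: prod.splits if_splits)
    show "(\<lambda>n. S n i j k) \<longlonglongrightarrow> matmul_sum q a b c i j k" if "i \<in> I" "j \<in> J" "k \<in> K" for i j k
      using that lim by (auto simp: I_def J_def K_def)
  qed (auto simp: I_def J_def K_def rk)
  have "(\<Sum>s<q. f s) ^ N \<le> 2 * (real N + 1) ^ (q + D) * real R ^ N" for N
  proof -
    define ty where "ty = (\<lambda>\<sigma>. \<lambda>s\<in>{..<q}. card {p \<in> {..<N}. \<sigma> p = s})"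
    define \<Sigma> where "\<Sigma> = ({..<N} \<rightarrow>\<^sub>E {..<q})"
    define Ty where "Ty = ({..<q} \<rightarrow>\<^sub>E {..N})"
    have fin: "finite \<Sigma>" "finite Ty" "card Ty = (N + 1) ^ q"
      by (auto simp: \<Sigma>_def Ty_def finite_PiE card_PiE)
    have tyT: "ty ` \<Sigma> \<subseteq> Ty"
    proof (intro subsetI; elim imageE)
      fix \<tau> \<sigma> assume "\<tau> = ty \<sigma>"
      moreover have "card {p \<in> {..<N}. \<sigma> p = s} \<le> N" for s
        using card_mono[of "{..<N}" "{p \<in> {..<N}. \<sigma> p = s}"] by auto
      ultimately show "\<tau> \<in> Ty" by (auto simp: ty_def Ty_def)
    qed
    have by_ty: "(\<Prod>p<N. g (\<sigma> p)) = (\<Prod>s<q. g s ^ \<tau> s)" if "\<sigma> \<in> \<Sigma>" "ty \<sigma> = \<tau>"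
      for g :: "nat \<Rightarrow> nat" and \<sigma> \<tau>
    proof -
      have "\<And>p. p < N \<Longrightarrow> \<sigma> p < q" using that(1) by (auto simp: \<Sigma>_def)
      then have "(\<Prod>p<N. g (\<sigma> p)) = (\<Prod>s<q. g s ^ card {p \<in> {..<N}. \<sigma> p = s})"
        by (rule prod_by_type)
      then show ?thesis unfolding that(2)[symmetric] by (simp add: ty_def)
    qed
    have "(\<Sum>s<q. f s) ^ N = (\<Prod>p<N. \<Sum>s<q. f s)" by simp
    also have "\<dots> = (\<Sum>\<sigma>\<in>\<Sigma>. \<Prod>p<N. f (\<sigma> p))"
      unfolding \<Sigma>_def by (rule prod_sum_PiE) auto
    also have "\<dots> = (\<Sum>\<tau>\<in>Ty. \<Sum>\<sigma>\<in>{\<sigma> \<in> \<Sigma>. ty \<sigma> = \<tau>}. \<Prod>p<N. f (\<sigma> p))"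
      by (rule sum.group[symmetric, OF fin(1,2) tyT])
    also have "\<dots> \<le> (\<Sum>\<tau>\<in>Ty. 2 * real ((N + 1) ^ D * R ^ N))"
    proof (rule sum_mono)
      fix \<tau> assume "\<tau> \<in> Ty"
      define Fib where "Fib = {\<sigma> \<in> \<Sigma>. ty \<sigma> = \<tau>}"
      define A B C where "A = (\<Prod>s<q. a s ^ \<tau> s)" and "B = (\<Prod>s<q. b s ^ \<tau> s)" and "C = (\<Prod>s<q. c s ^ \<tau> s)"
      have "rk_le ((N + 1) ^ D * R ^ N) (copies (card Fib) A B C)"
      proof (rule copies_in_tpow[OF power_rk])
        show "finite Fib" "Fib \<subseteq> {..<N} \<rightarrow>\<^sub>E {..<q}"
          using fin(1) by (auto simp: Fib_def \<Sigma>_def)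
      qed (auto simp: Fib_def A_def B_def C_def intro: by_ty)
      moreover have "A \<ge> 1" "B \<ge> 1" "C \<ge> 1"
        unfolding A_def B_def C_def using pos by (auto simp: Suc_le_eq intro!: prod_pos)
      ultimately have "real (card Fib) * real (A * B * C) powr (omega / 3) \<le> 2 * real ((N + 1) ^ D * R ^ N)"
        by (rule copies_powr_omega_le)
      moreover have "(\<Prod>p<N. f (\<sigma> p)) = real (A * B * C) powr (omega / 3)" if "\<sigma> \<in> Fib" for \<sigma>
      proof -
        have "(\<Prod>p<N. f (\<sigma> p)) = real (\<Prod>p<N. a (\<sigma> p) * b (\<sigma> p) * c (\<sigma> p)) powr (omega / 3)"
          by (simp add: f_def prod_powr_distrib[symmetric])
        also have "(\<Prod>p<N. a (\<sigma> p) * b (\<sigma> p) * c (\<sigma> p)) = A * B * C"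
          using that by (simp add: Fib_def prod.distrib by_ty A_def B_def C_def)
        finally show ?thesis .
      qed
      ultimately show "(\<Sum>\<sigma>\<in>{\<sigma> \<in> \<Sigma>. ty \<sigma> = \<tau>}. \<Prod>p<N. f (\<sigma> p)) \<le> 2 * real ((N + 1) ^ D * R ^ N)"
        unfolding Fib_def[symmetric] by simp
    qed
    also have "\<dots> = 2 * (real N + 1) ^ (q + D) * real R ^ N"
      using fin(3) by (simp add: power_add algebra_simps)
    finally show ?thesis .
  qed
  from le_of_powers_le[OF this] show ?thesis by (simp add: f_def)
qed

section \<open>The structure constants of the algebra\<close>

lemma poly_ring_simps [simp]:
  "carrier (poly_ring V) = {p. \<forall>mon\<in>Poly_Mapping.keys p. Poly_Mapping.keys mon \<subseteq> V}"
  "x \<otimes>\<^bsub>poly_ring V\<^esub> y = x * y" "x \<oplus>\<^bsub>poly_ring V\<^esub> y = x + y"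
  "\<one>\<^bsub>poly_ring V\<^esub> = 1" "\<zero>\<^bsub>poly_ring V\<^esub> = 0"
  by (auto simp: poly_ring_def)

lemma cring_poly_ring: "cring (poly_ring V)"
proof (rule cringI)
  show "abelian_group (poly_ring V)"
  proof (rule abelian_groupI)
    fix x y :: cpoly
    assume "x \<in> carrier (poly_ring V)" "y \<in> carrier (poly_ring V)"
    then show "x \<oplus>\<^bsub>poly_ring V\<^esub> y \<in> carrier (poly_ring V)"
      using Poly_Mapping.keys_add[of x y] by auto
    have "- x \<in> carrier (poly_ring V)" using \<open>x \<in> _\<close> by simp
    then show "\<exists>y\<in>carrier (poly_ring V). y \<oplus>\<^bsub>poly_ring V\<^esub> x = \<zero>\<^bsub>poly_ring V\<^esub>"
      by (intro bexI[of _ "- x"]) auto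
  qed (auto simp: add_ac)
  show "Group.comm_monoid (poly_ring V)"
  proof (rule comm_monoidI)
    fix x y :: cpoly
    assume xy: "x \<in> carrier (poly_ring V)" "y \<in> carrier (poly_ring V)"
    show "x \<otimes>\<^bsub>poly_ring V\<^esub> y \<in> carrier (poly_ring V)"
    proof (unfold poly_ring_simps, intro CollectI ballI)
      fix w assume "w \<in> Poly_Mapping.keys (x * y)"
      then obtain a b where "w = a + b" "a \<in> Poly_Mapping.keys x" "b \<in> Poly_Mapping.keys y"
        using Poly_Mapping.keys_mult[of x y] by blast
      then show "Poly_Mapping.keys w \<subseteq> V"
        using xy Poly_Mapping.keys_add[of a b] by fastforce
    qed
  qed (auto simp: mult_ac)
qed (auto simp: algebra_simps)

lemma X_in_carrier: "i \<in> V \<Longrightarrow> X i \<in> carrier (poly_ring V)"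
  by (auto simp: X_def)

lemma single_0_in_carrier: "Poly_Mapping.single 0 z \<in> carrier (poly_ring V)"
  by (auto split: if_splits)

lemma a_minus_poly_ring:
  assumes "p \<in> carrier (poly_ring V)" "q \<in> carrier (poly_ring V)"
  shows "p \<ominus>\<^bsub>poly_ring V\<^esub> q = p - q"
proof -
  interpret cring "poly_ring V" by (rule cring_poly_ring)
  have "- q \<in> carrier (poly_ring V)" using assms by simp
  then have "\<ominus>\<^bsub>poly_ring V\<^esub> q = - q"
    using assms by (intro minus_equality) auto
  then show ?thesis by (simp add: a_minus_def)
qed

lemma finsum_poly_ring:
  assumes "finite S" "\<And>k. k \<in> S \<Longrightarrow> f k \<in> carrier (poly_ring V)"
  shows "finsum (poly_ring V) f S = sum f S"
proof -
  interpret cring "poly_ring V" by (rule cring_poly_ring)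
  show ?thesis
    using assms
  proof (induction S rule: finite_induct)
    case (insert x F)
    have "f \<in> F \<rightarrow> carrier (poly_ring V)" "f x \<in> carrier (poly_ring V)"
      using insert.prems by blast+
    then have "finsum (poly_ring V) f (insert x F) = f x \<oplus>\<^bsub>poly_ring V\<^esub> finsum (poly_ring V) f F"
      by (rule finsum_insert[OF insert.hyps])
    moreover have "finsum (poly_ring V) f F = sum f F"
      using insert.prems by (intro insert.IH) blast
    ultimately show ?case using insert.hyps by simp
  qed simp
qed

section \<open>Monomials and coordinate functionals modulo the ideal\<close>

definition var_monom :: "nat \<Rightarrow> (nat \<Rightarrow>\<^sub>0 nat)" where
  "var_monom i = Poly_Mapping.single i 1"

lemma X_eq_single: "X i = Poly_Mapping.single (var_monom i) 1"
  by (simp add: X_def var_monom_def)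

lemma add_var_monom_eq_var_monom_iff: "u + var_monom j = var_monom b \<longleftrightarrow> u = 0 \<and> j = b"
proof
  assume eq: "u + var_monom j = var_monom b"
  then have "Poly_Mapping.lookup (u + var_monom j) j = Poly_Mapping.lookup (var_monom b) j" by simp
  then have "j = b" by (auto simp: lookup_add lookup_single when_def var_monom_def split: if_splits)
  then show "u = 0 \<and> j = b" using eq by simp
qed auto

lemma add_var_monom_neq_0: "u + var_monom j \<noteq> 0"
proof
  assume "u + var_monom j = 0"
  then have "Poly_Mapping.lookup (u + var_monom j) j = 0" by simp
  then show False by (simp add: lookup_add lookup_single var_monom_def)
qed

lemma add_add_var_monom_neq_var_monom: "u + var_monom i + var_monom j \<noteq> var_monom b"
  using add_var_monom_eq_var_monom_iff[of "u + var_monom i" j b] add_var_monom_neq_0[of u i] by simp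

lemma add_add_var_monom_eq_iff: "u + var_monom i + var_monom j = var_monom a + var_monom b \<longleftrightarrow> u = 0 \<and> (i = a \<and> j = b \<or> i = b \<and> j = a)"
proof
  assume eq: "u + var_monom i + var_monom j = var_monom a + var_monom b"
  then have "Poly_Mapping.lookup (u + var_monom i + var_monom j) i = Poly_Mapping.lookup (var_monom a + var_monom b) i" by simp
  then have "i = a \<or> i = b" by (auto simp: lookup_add lookup_single when_def var_monom_def split: if_splits)
  then show "u = 0 \<and> (i = a \<and> j = b \<or> i = b \<and> j = a)"
  proof
    assume [simp]: "i = a"
    have "(u + var_monom j) + var_monom a = var_monom b + var_monom a" using eq by (simp add: add_ac)
    then have "u + var_monom j = var_monom b" by simp
    then show ?thesis by (simp add: add_var_monom_eq_var_monom_iff)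
  next
    assume [simp]: "i = b"
    have "(u + var_monom j) + var_monom b = var_monom a + var_monom b" using eq by (simp add: add_ac)
    then have "u + var_monom j = var_monom a" by simp
    then show ?thesis by (simp add: add_var_monom_eq_var_monom_iff)
  qed
qed (auto simp: add_ac)

lemma add_var_monom_eq_iff: "u + var_monom i = var_monom a + var_monom b \<longleftrightarrow> i = a \<and> u = var_monom b \<or> i = b \<and> u = var_monom a"
proof
  assume eq: "u + var_monom i = var_monom a + var_monom b"
  then have "Poly_Mapping.lookup (u + var_monom i) i = Poly_Mapping.lookup (var_monom a + var_monom b) i" by simp
  then have "i = a \<or> i = b" by (auto simp: lookup_add lookup_single when_def var_monom_def split: if_splits)
  then show "i = a \<and> u = var_monom b \<or> i = b \<and> u = var_monom a"
  proof
    assume [simp]: "i = a"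
    have "u + var_monom a = var_monom b + var_monom a" using eq by (simp add: add_ac)
    then show ?thesis by simp
  next
    assume [simp]: "i = b"
    have "u + var_monom b = var_monom a + var_monom b" using eq by (simp add: add_ac)
    then show ?thesis by simp
  qed
qed (auto simp: add_ac)

text \<open>The monomials congruent to the basis element \<open>a_k\<close> modulo the ideal.\<close>

definition class_monomials :: "nat \<Rightarrow> nat \<Rightarrow> (nat \<Rightarrow>\<^sub>0 nat) set" where
  "class_monomials m k = (if k = 0 then {0} else {var_monom k}) \<union>
     (if k = 3*m+1 then (\<lambda>i. var_monom i + var_monom (m+i)) ` {1..m} else {}) \<union>
     (if k = 3*m+2 then (\<lambda>i. var_monom i + var_monom (2*m+i)) ` {1..m} else {})"

text \<open>Adding the coefficients over a whole congruence class makes this functional vanish on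
  the ideal, so it represents the \<open>k\<close>-th coordinate of the quotient without a choice of
  normal forms.\<close>

definition coord :: "nat \<Rightarrow> nat \<Rightarrow> cpoly \<Rightarrow> complex" where
  "coord m k p = (\<Sum>w\<in>class_monomials m k. Poly_Mapping.lookup p w)"

lemma finite_class_monomials [simp]: "finite (class_monomials m k)"
  by (auto simp: class_monomials_def)

lemma coord_add: "coord m k (p + q) = coord m k p + coord m k q"
  by (simp add: coord_def lookup_add sum.distrib)

lemma coord_diff: "coord m k (p - q) = coord m k p - coord m k q"
  by (simp add: coord_def lookup_minus sum_subtractf)

lemma coord_sum: "coord m k (sum f S) = (\<Sum>s\<in>S. coord m k (f s))"
  by (induction S rule: infinite_finite_induct) (auto simp: coord_add, auto simp: coord_def)

lemma coord_single: "coord m k (Poly_Mapping.single w z) = (if w \<in> class_monomials m k then z else 0)"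
  by (simp add: coord_def lookup_single when_def)

lemma sum_single_lookup: "(\<Sum>w\<in>Poly_Mapping.keys p. Poly_Mapping.single w (Poly_Mapping.lookup p w)) = p"
  by (rule poly_mapping_eqI)
    (auto simp: lookup_sum lookup_single when_def in_keys_iff)

lemma coord_mult_eq_0:
  assumes "\<And>u z. coord m k (Poly_Mapping.single u z * g) = 0"
  shows "coord m k (q * g) = 0"
proof -
  have "q * g = (\<Sum>w\<in>Poly_Mapping.keys q. Poly_Mapping.single w (Poly_Mapping.lookup q w) * g)"
    by (subst sum_single_lookup[symmetric]) (simp add: sum_distrib_right)
  then show ?thesis by (simp add: coord_sum assms)
qed

lemma X_mult_X: "X i * X j = Poly_Mapping.single (var_monom i + var_monom j) 1"
  by (simp add: X_eq_single mult_single)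

lemma single_mult_X: "Poly_Mapping.single u z * X i = Poly_Mapping.single (u + var_monom i) z"
  by (simp add: X_eq_single mult_single)

lemma single_mult_X_X: "Poly_Mapping.single u z * (X i * X j) = Poly_Mapping.single (u + var_monom i + var_monom j) z"
  by (simp add: X_mult_X mult_single add.assoc)

lemma add_var_monom_in_class_iff: "u + var_monom i \<in> class_monomials m k \<longleftrightarrow> (k \<noteq> 0 \<and> u = 0 \<and> i = k) \<or>
    (k = 3*m+1 \<and> (\<exists>l\<in>{1..m}. i = l \<and> u = var_monom (m+l) \<or> i = m+l \<and> u = var_monom l)) \<or>
    (k = 3*m+2 \<and> (\<exists>l\<in>{1..m}. i = l \<and> u = var_monom (2*m+l) \<or> i = 2*m+l \<and> u = var_monom l))"
  by (cases "k = 0") (auto simp: class_monomials_def add_var_monom_neq_0 add_var_monom_eq_var_monom_iff add_var_monom_eq_iff image_iff)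

lemma add_add_var_monom_in_class_iff: "u + var_monom i + var_monom j \<in> class_monomials m k \<longleftrightarrow> u = 0 \<and>
    ((k = 3*m+1 \<and> (\<exists>l\<in>{1..m}. i = l \<and> j = m+l \<or> i = m+l \<and> j = l)) \<or>
     (k = 3*m+2 \<and> (\<exists>l\<in>{1..m}. i = l \<and> j = 2*m+l \<or> i = 2*m+l \<and> j = l)))"
  by (auto simp: class_monomials_def add_var_monom_neq_0 add_add_var_monom_neq_var_monom add_add_var_monom_eq_iff image_iff)

lemma zero_neq_var_monom: "0 \<noteq> var_monom l"
  using add_var_monom_neq_0[of 0 l] by (metis add_0)

lemma zero_in_class_iff: "0 \<in> class_monomials m k \<longleftrightarrow> k = 0"
proof -
  have "0 \<noteq> var_monom a + var_monom b" for a b using add_var_monom_neq_0[of "var_monom a" b] by metis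
  then show ?thesis using zero_neq_var_monom by (auto simp only: class_monomials_def split: if_splits)
qed

lemma var_monom_in_class_iff: "var_monom i \<in> class_monomials m k \<longleftrightarrow> k \<noteq> 0 \<and> i = k"
proof -
  have "var_monom i \<in> class_monomials m k \<longleftrightarrow> 0 + var_monom i \<in> class_monomials m k" by (simp only: add_0)
  then show ?thesis unfolding add_var_monom_in_class_iff using zero_neq_var_monom by blast
qed

text \<open>By linearity only monomial multiples matter. With a constant multiplier the two terms of
  a binomial relation belong to the same class and cancel; with any other multiplier no term belongs
  to a class. The products among the relations belong to no class at all.\<close>

lemma coord_relation:
  assumes "g \<in> A_relations m"
  shows "coord m k (q * g) = 0"
proof (rule coord_mult_eq_0)
  fix u z
  show "coord m k (Poly_Mapping.single u z * g) = 0"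
    using assms unfolding A_relations_def
  proof (elim UnE CollectE exE conjE)
    fix i assume g: "g = X (3*m+1) - X i * X (m+i)" and i: "i \<in> {1..m}"
    show ?thesis
      using i unfolding g right_diff_distrib coord_diff single_mult_X single_mult_X_X coord_single
        add_add_var_monom_in_class_iff unfolding add_var_monom_in_class_iff by auto
  next
    fix i assume g: "g = X (3*m+2) - X i * X (2*m+i)" and i: "i \<in> {1..m}"
    show ?thesis
      using i unfolding g right_diff_distrib coord_diff single_mult_X single_mult_X_X coord_single
        add_add_var_monom_in_class_iff unfolding add_var_monom_in_class_iff by auto
  next
    fix i j assume g: "g = X i * X j" and ij: "1 \<le> i" "i \<le> j" "j \<le> 3*m+2"
      "\<not> (i \<in> {1..m} \<and> (j = m+i \<or> j = 2*m+i))"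
    show ?thesis
      using ij unfolding g single_mult_X_X coord_single add_add_var_monom_in_class_iff by auto
  qed
qed

lemma relations_in_carrier: "A_relations m \<subseteq> carrier (A_poly_ring m)"
proof
  interpret cring "A_poly_ring m" unfolding A_poly_ring_def by (rule cring_poly_ring)
  have X: "X i \<in> carrier (A_poly_ring m)" if "1 \<le> i" "i \<le> 3*m+2" for i
    using that unfolding A_poly_ring_def by (intro X_in_carrier) auto
  have XX: "X i * X j \<in> carrier (A_poly_ring m)" if "1 \<le> i" "i \<le> 3*m+2" "1 \<le> j" "j \<le> 3*m+2" for i j
    using m_closed[OF X X] that by (simp add: A_poly_ring_def)
  have D: "p - q \<in> carrier (A_poly_ring m)"
    if "p \<in> carrier (A_poly_ring m)" "q \<in> carrier (A_poly_ring m)" for p q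
    using minus_closed[OF that] a_minus_poly_ring[of p "{1..3*m+2}" q] that by (simp add: A_poly_ring_def)
  fix g assume "g \<in> A_relations m"
  then show "g \<in> carrier (A_poly_ring m)"
    unfolding A_relations_def by (elim UnE CollectE exE conjE) (auto intro!: D X XX)
qed

lemma ideal_A_ideal: "ideal (A_ideal m) (A_poly_ring m)"
proof -
  interpret cring "A_poly_ring m" unfolding A_poly_ring_def by (rule cring_poly_ring)
  show ?thesis unfolding A_ideal_def by (rule genideal_ideal[OF relations_in_carrier])
qed

text \<open>The polynomials all of whose multiples have zero coordinates form an ideal that contains
  the relations. Quantifying over the multiples is what makes this set closed under
  multiplication.\<close>

lemma coord_A_ideal:
  assumes "p \<in> A_ideal m"
  shows "coord m k p = 0"
proof -
  interpret cring "A_poly_ring m" unfolding A_poly_ring_def by (rule cring_poly_ring)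
  let ?J = "{p \<in> carrier (A_poly_ring m). \<forall>q k. coord m k (q * p) = 0}"
  have "ideal ?J (A_poly_ring m)"
  proof (rule idealI)
    show "ring (A_poly_ring m)" by (rule ring_axioms)
    show "subgroup ?J (add_monoid (A_poly_ring m))"
    proof (rule add.subgroupI)
      show "?J \<noteq> {}" using zero_closed by (auto simp: A_poly_ring_def coord_def intro!: exI[of _ 0])
    next
      fix a assume a: "a \<in> ?J"
      have "\<ominus>\<^bsub>A_poly_ring m\<^esub> a = - a"
        using a by (intro minus_equality) (auto simp: A_poly_ring_def)
      moreover have "coord m k (q * - a) = 0" for q k
        using a coord_diff[of m k 0 "q * a"] by (simp add: coord_def)
      ultimately show "\<ominus>\<^bsub>A_poly_ring m\<^esub> a \<in> ?J" using a a_inv_closed[of a] by auto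
    next
      fix a b assume "a \<in> ?J" "b \<in> ?J"
      then show "a \<oplus>\<^bsub>A_poly_ring m\<^esub> b \<in> ?J"
        using a_closed[of a b] by (auto simp: A_poly_ring_def distrib_left coord_add)
    qed auto
    fix a x assume "a \<in> ?J" "x \<in> carrier (A_poly_ring m)"
    then show "x \<otimes>\<^bsub>A_poly_ring m\<^esub> a \<in> ?J" "a \<otimes>\<^bsub>A_poly_ring m\<^esub> x \<in> ?J"
      using m_closed[of x a] m_closed[of a x]
      by (auto simp: A_poly_ring_def mult.assoc[symmetric] mult.commute[of a x])
  qed
  moreover have "A_relations m \<subseteq> ?J"
    using relations_in_carrier coord_relation by auto
  ultimately have "A_ideal m \<subseteq> ?J"
    unfolding A_ideal_def by (rule genideal_minimal)
  then have "coord m k (1 * p) = 0" using assms by blast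
  then show ?thesis by simp
qed

abbreviation basis_poly :: "nat \<Rightarrow> cpoly" where
  "basis_poly k \<equiv> (if k = 0 then 1 else X k)"

definition str_rel :: "nat \<Rightarrow> nat \<Rightarrow> nat \<Rightarrow> nat \<Rightarrow> bool" where
  "str_rel m i j k \<longleftrightarrow> i = 0 \<and> j = k \<or> j = 0 \<and> i = k \<or>
     k = 3*m+1 \<and> (\<exists>l\<in>{1..m}. i = l \<and> j = m+l \<or> i = m+l \<and> j = l) \<or>
     k = 3*m+2 \<and> (\<exists>l\<in>{1..m}. i = l \<and> j = 2*m+l \<or> i = 2*m+l \<and> j = l)"

lemma coord_basis_mult: "coord m k (basis_poly i * basis_poly j) = of_bool (str_rel m i j k)"
proof -
  have X: "X i = Poly_Mapping.single (var_monom i) 1" for i by (rule X_eq_single)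
  consider "i = 0" "j = 0" | "i = 0" "j \<noteq> 0" | "i \<noteq> 0" "j = 0" | "i \<noteq> 0" "j \<noteq> 0" by blast
  then show ?thesis
  proof cases
    case 1
    then show ?thesis using coord_single[of m k 0 1] by (auto simp: str_rel_def zero_in_class_iff)
  next
    case 2
    then show ?thesis using coord_single[of m k "var_monom j" 1] by (auto simp: str_rel_def X var_monom_in_class_iff)
  next
    case 3
    then show ?thesis using coord_single[of m k "var_monom i" 1] by (auto simp: str_rel_def X var_monom_in_class_iff)
  next
    case 4
    then have "coord m k (basis_poly i * basis_poly j) = of_bool (var_monom i + var_monom j \<in> class_monomials m k)"
      by (simp add: X_mult_X coord_single)
    then show ?thesis using add_add_var_monom_in_class_iff[of 0 i j m k] 4 by (simp add: str_rel_def)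
  qed
qed

lemma basis_poly_in_carrier:
  assumes "k < 3*m+3"
  shows "basis_poly k \<in> carrier (A_poly_ring m)"
proof -
  interpret cring "A_poly_ring m" unfolding A_poly_ring_def by (rule cring_poly_ring)
  show ?thesis
    using assms one_closed X_in_carrier[of k "{1..3*m+2}"] unfolding A_poly_ring_def by auto
qed

text \<open>The reduction half of the structure constants: a product of two basis elements is
  congruent to one basis element or to 0. Uniqueness of the coefficients comes from
  \<open>coord\<close>.\<close>

lemma basis_mult_cong:
  assumes "i < 3*m+3" "j < 3*m+3" "1 \<le> m"
  shows "basis_poly i * basis_poly j -
    (\<Sum>k<3*m+3. Poly_Mapping.single 0 (of_bool (str_rel m i j k)) * basis_poly k) \<in> A_ideal m"
    (is "?p - ?s \<in> _")
proof -
  interpret cring "A_poly_ring m" unfolding A_poly_ring_def by (rule cring_poly_ring)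
  interpret I: ideal "A_ideal m" "A_poly_ring m" by (rule ideal_A_ideal)
  have rel: "g \<in> A_ideal m" if "g \<in> A_relations m" for g
    using that genideal_self[OF relations_in_carrier] unfolding A_ideal_def by auto
  have zero: "0 \<in> A_ideal m" using I.zero_closed by (simp add: A_poly_ring_def)
  have s: "?s = basis_poly k0" if "\<And>k. k < 3*m+3 \<Longrightarrow> str_rel m i j k \<longleftrightarrow> k = k0" "k0 < 3*m+3" for k0
  proof -
    have "?s = (\<Sum>k<3*m+3. if k = k0 then basis_poly k else 0)"
      using that(1) by (intro sum.cong refl) auto
    then show ?thesis using that(2) by simp
  qed
  have s0: "?s = 0" if "\<And>k. k < 3*m+3 \<Longrightarrow> \<not> str_rel m i j k"
    using that by (intro sum.neutral) auto
  have neg: "- g \<in> A_ideal m" if "g \<in> A_relations m" for g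
  proof -
    have "g \<in> carrier (A_poly_ring m)" using that relations_in_carrier by auto
    then have "\<ominus>\<^bsub>A_poly_ring m\<^esub> g = - g"
      by (intro minus_equality) (auto simp: A_poly_ring_def)
    then show ?thesis using I.a_inv_closed[OF rel[OF that]] by simp
  qed
  \<comment> \<open>The relations list products in increasing order of indices only; the other order
    is reduced to this one by symmetry of \<open>str_rel\<close>.\<close>
  have main: "?p - ?s \<in> A_ideal m"
    if ij: "\<And>k. str_rel m i j k \<longleftrightarrow> str_rel m i' j' k" "?p = X i' * X j'" "1 \<le> i'" "i' \<le> j'" "j' < 3*m+3" for i' j'
  proof (cases "i' \<in> {1..m} \<and> (j' = m+i' \<or> j' = 2*m+i')")
    case True
    then consider "j' = m+i'" | "j' = 2*m+i'" by blast
    then show ?thesis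
    proof cases
      case 1
      have "?s = basis_poly (3*m+1)"
        by (rule s) (use True ij 1 assms(3) in \<open>auto simp: str_rel_def\<close>)
      then have "?p - ?s = - (X (3*m+1) - X i' * X (m+i'))" using 1 ij by simp
      then show ?thesis
        using True by (simp only:) (intro neg, auto simp: A_relations_def)
    next
      case 2
      have "?s = basis_poly (3*m+2)"
        by (rule s) (use True ij 2 assms(3) in \<open>auto simp: str_rel_def\<close>)
      then have "?p - ?s = - (X (3*m+2) - X i' * X (2*m+i'))" using 2 ij by simp
      then show ?thesis
        using True by (simp only:) (intro neg, auto simp: A_relations_def)
    qed
  next
    case False
    have "?s = 0" by (rule s0) (use False ij in \<open>auto simp: str_rel_def\<close>)
    then have "?p - ?s = X i' * X j'" using ij by simp
    also have "X i' * X j' \<in> A_relations m"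
      unfolding A_relations_def by (intro UnI2 CollectI exI[of _ i'] exI[of _ j']) (use False ij in auto)
    then have "X i' * X j' \<in> A_ideal m" by (rule rel)
    finally show ?thesis .
  qed
  have sym: "str_rel m i j k \<longleftrightarrow> str_rel m j i k" for i j k by (auto simp: str_rel_def)
  consider "i = 0" | "i \<noteq> 0" "j = 0" | "1 \<le> i" "i \<le> j" | "1 \<le> j" "j \<le> i" by linarith
  then show ?thesis
  proof cases
    case 1
    have "?s = basis_poly j" by (rule s) (use 1 assms in \<open>auto simp: str_rel_def\<close>)
    then have "?p - ?s = 0" using 1 by simp
    then show ?thesis using zero by simp
  next
    case 2
    have "?s = basis_poly i" by (rule s) (use 2 assms in \<open>auto simp: str_rel_def\<close>)
    then have "?p - ?s = 0" using 2 by simp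
    then show ?thesis using zero by simp
  next
    case 3
    then show ?thesis by (intro main[of i j]) (use assms in auto)
  next
    case 4
    then show ?thesis by (intro main[of j i]) (use assms sym in \<open>auto simp: mult.commute\<close>)
  qed
qed

text \<open>The description in \<open>A_coords\<close> determines the coefficients: existence is
  \<open>basis_mult_cong\<close>, and applying the functionals \<open>coord\<close> to any other
  representation of the product gives the same values.\<close>

lemma A_coords_basis_mult:
  assumes "i < 3*m+3" "j < 3*m+3" "1 \<le> m" "k < 3*m+3"
  shows "A_coords m (A_basis m i \<otimes>\<^bsub>A_alg m\<^esub> A_basis m j) k = of_bool (str_rel m i j k)"
proof -
  interpret cring "A_poly_ring m" unfolding A_poly_ring_def by (rule cring_poly_ring)
  interpret I: ideal "A_ideal m" "A_poly_ring m" by (rule ideal_A_ideal)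
  interpret Q: cring "A_alg m" unfolding A_alg_def by (rule I.quotient_is_cring[OF is_cring])
  let ?h = "(+>\<^bsub>A_poly_ring m\<^esub>) (A_ideal m)"
  interpret h: ring_hom_cring "A_poly_ring m" "A_alg m" ?h
    unfolding A_alg_def by (rule I.rcos_ring_hom_cring[OF is_cring])
  have bc: "basis_poly k \<in> carrier (A_poly_ring m)" if "k < 3*m+3" for k
    using that by (rule basis_poly_in_carrier)
  have sc: "Poly_Mapping.single 0 z \<in> carrier (A_poly_ring m)" for z
    using single_0_in_carrier by (simp only: A_poly_ring_def)
  have scb: "Poly_Mapping.single 0 z * basis_poly k \<in> carrier (A_poly_ring m)" if "k < 3*m+3" for k z
    using m_closed[OF sc bc[OF that]] by (simp only: A_poly_ring_def poly_ring_simps)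
  define S where "S = (\<lambda>c. \<Sum>k<3*m+3. Poly_Mapping.single 0 (c k) * basis_poly k)"
  have SC: "S c \<in> carrier (A_poly_ring m)" for c
  proof -
    have "finsum (A_poly_ring m) (\<lambda>k. Poly_Mapping.single 0 (c k) * basis_poly k) {..<3*m+3} = S c"
      unfolding S_def A_poly_ring_def by (rule finsum_poly_ring) (use scb in \<open>auto simp only: A_poly_ring_def lessThan_iff\<close>)
    moreover have "finsum (A_poly_ring m) (\<lambda>k. Poly_Mapping.single 0 (c k) * basis_poly k) {..<3*m+3} \<in> carrier (A_poly_ring m)"
      using scb by (intro finsum_closed) auto
    ultimately show ?thesis by simp
  qed
  have sum: "(\<Oplus>\<^bsub>A_alg m\<^esub>k\<in>{..<3*m+3}. A_scalar m (c k) \<otimes>\<^bsub>A_alg m\<^esub> A_basis m k) = ?h (S c)" for c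
  proof -
    have "(\<Oplus>\<^bsub>A_alg m\<^esub>k\<in>{..<3*m+3}. A_scalar m (c k) \<otimes>\<^bsub>A_alg m\<^esub> A_basis m k)
      = (\<Oplus>\<^bsub>A_alg m\<^esub>k\<in>{..<3*m+3}. ?h (Poly_Mapping.single 0 (c k) * basis_poly k))"
    proof (rule Q.finsum_cong')
      fix k assume k: "k \<in> {..<3*m+3}"
      have "A_scalar m (c k) \<otimes>\<^bsub>A_alg m\<^esub> A_basis m k
        = ?h (Poly_Mapping.single 0 (c k) \<otimes>\<^bsub>A_poly_ring m\<^esub> basis_poly k)"
        unfolding A_scalar_def A_basis_def using bc[of k] k sc by (subst h.hom_mult) auto
      then show "A_scalar m (c k) \<otimes>\<^bsub>A_alg m\<^esub> A_basis m k = ?h (Poly_Mapping.single 0 (c k) * basis_poly k)"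
        by (simp only: A_poly_ring_def poly_ring_simps)
    qed (use scb in auto)
    also have "\<dots> = ?h (finsum (A_poly_ring m) (\<lambda>k. Poly_Mapping.single 0 (c k) * basis_poly k) {..<3*m+3})"
      using scb by (subst h.hom_finsum) (auto simp: comp_def)
    also have "finsum (A_poly_ring m) (\<lambda>k. Poly_Mapping.single 0 (c k) * basis_poly k) {..<3*m+3} = S c"
      unfolding S_def A_poly_ring_def by (rule finsum_poly_ring) (use scb in \<open>auto simp only: A_poly_ring_def lessThan_iff\<close>)
    finally show ?thesis .
  qed
  have pc: "basis_poly i * basis_poly j \<in> carrier (A_poly_ring m)"
    using m_closed[OF bc bc] assms by (simp only: A_poly_ring_def poly_ring_simps)
  have x: "A_basis m i \<otimes>\<^bsub>A_alg m\<^esub> A_basis m j = ?h (basis_poly i * basis_poly j)"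
  proof -
    have "A_basis m i \<otimes>\<^bsub>A_alg m\<^esub> A_basis m j = ?h (basis_poly i \<otimes>\<^bsub>A_poly_ring m\<^esub> basis_poly j)"
      unfolding A_basis_def using bc assms by (subst h.hom_mult) auto
    then show ?thesis by (simp only: A_poly_ring_def poly_ring_simps)
  qed
  have eq_iff: "?h p = ?h q \<longleftrightarrow> p - q \<in> A_ideal m"
    if "p \<in> carrier (A_poly_ring m)" "q \<in> carrier (A_poly_ring m)" for p q
    using quotient_eq_iff_same_a_r_cos[OF ideal_A_ideal that] that a_minus_poly_ring[of p "{1..3*m+2}" q]
    by (simp only: A_poly_ring_def)
  have coordS: "coord m k (S c) = c k" if "k < 3*m+3" for k c
  proof -
    have "coord m k (S c) = (\<Sum>l<3*m+3. if l = k then c l else 0)"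
      unfolding S_def coord_sum
    proof (intro sum.cong refl)
      fix l assume "l \<in> {..<3*m+3}"
      have *: "Poly_Mapping.single 0 (c l) * basis_poly l = Poly_Mapping.single (if l = 0 then 0 else var_monom l) (c l)"
        by (simp add: single_mult_X)
      show "coord m k (Poly_Mapping.single 0 (c l) * basis_poly l) = (if l = k then c l else 0)"
        unfolding * coord_single by (simp add: zero_in_class_iff var_monom_in_class_iff)
    qed
    then show ?thesis using that by simp
  qed
  define c0 where "c0 = (\<lambda>k. if k < 3*m+3 then of_bool (str_rel m i j k) else 0 :: complex)"
  have "A_coords m (A_basis m i \<otimes>\<^bsub>A_alg m\<^esub> A_basis m j) = c0"
    unfolding A_coords_def x sum
  proof (rule the_equality)
    have "S c0 = (\<Sum>k<3*m+3. Poly_Mapping.single 0 (of_bool (str_rel m i j k)) * basis_poly k)"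
      unfolding S_def c0_def by (intro sum.cong) auto
    then have "?h (basis_poly i * basis_poly j) = ?h (S c0)"
      unfolding eq_iff[OF pc SC] using basis_mult_cong assms by simp
    then show "(\<forall>k\<ge>3*m+3. c0 k = 0) \<and> ?h (basis_poly i * basis_poly j) = ?h (S c0)"
      by (simp add: c0_def)
    fix c assume c: "(\<forall>k\<ge>3*m+3. c k = 0) \<and> ?h (basis_poly i * basis_poly j) = ?h (S c)"
    then have "basis_poly i * basis_poly j - S c \<in> A_ideal m" using eq_iff[OF pc SC] by blast
    then have "coord m k (basis_poly i * basis_poly j) = coord m k (S c)" for k
      using coord_A_ideal[of "basis_poly i * basis_poly j - S c" m k] by (simp only: coord_diff) simp
    then show "c = c0"
      using c coordS unfolding coord_basis_mult c0_def by (intro ext) (metis not_less)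
  qed
  then show ?thesis using assms by (simp add: c0_def)
qed

lemma entry_T_A:
  assumes "1 \<le> m"
  shows "entry (T_A m) i j k = of_bool (i < 3*m+3 \<and> j < 3*m+3 \<and> k < 3*m+3 \<and> str_rel m i j k)"
  using assms by (auto simp: entry_def T_A_def A_coords_basis_mult)

section \<open>The border rank of the structure tensor\<close>

text \<open>A trilinear form with 3 products for each \<open>i\<close> and 3 more. For each
  \<open>i\<close>, the products with \<open>x i + t * x (m+i)\<close> and
  \<open>x i + t * x (2*m+i)\<close> minus the one with \<open>x i\<close> alone isolate the mixed
  terms of order t^5 that form \<open>a_(3m+1)\<close> and \<open>a_(3m+2)\<close>. What remains are
  poles: mixed terms with \<open>x 0\<close> or \<open>y 0\<close> of order t^-2, which the two
  products containing sums over \<open>i\<close> cancel for all \<open>i\<close> at once, and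
  multiples of \<open>x 0 * y 0\<close>, which the last product cancels.\<close>

definition approx_tensor :: "nat \<Rightarrow> complex \<Rightarrow> (nat \<Rightarrow> complex) \<Rightarrow> (nat \<Rightarrow> complex) \<Rightarrow> (nat \<Rightarrow> complex) \<Rightarrow> complex" where
  "approx_tensor m t x y z =
    (\<Sum>i\<in>{1..m}.
       (x 0 + t^2 * (x i + t * x (m+i))) * (y 0 + t^2 * (y i + t * y (m+i))) * (z (m+i) / t^3 + z (3*m+1) / t^5)
     + (x 0 + t^2 * (x i + t * x (2*m+i))) * (y 0 + t^2 * (y i + t * y (2*m+i))) * (z (2*m+i) / t^3 + z (3*m+2) / t^5)
     + (x 0 + t^2 * x i) * (y 0 + t^2 * y i) *
        (z i / t^2 - (z (m+i) + z (2*m+i)) / t^3 - (z (3*m+1) + z (3*m+2)) / t^5))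
   + (x 0 - t^4 * (\<Sum>i\<in>{1..m}. x (m+i)) + t^6 * x (3*m+1)) *
      (y 0 - t^4 * (\<Sum>i\<in>{1..m}. y (m+i)) + t^6 * y (3*m+1)) * (z (3*m+1) / t^6)
   + (x 0 - t^4 * (\<Sum>i\<in>{1..m}. x (2*m+i)) + t^6 * x (3*m+2)) *
      (y 0 - t^4 * (\<Sum>i\<in>{1..m}. y (2*m+i)) + t^6 * y (3*m+2)) * (z (3*m+2) / t^6)
   + x 0 * y 0 * (z 0 - (\<Sum>i\<in>{1..m}. z i) / t^2 - (z (3*m+1) + z (3*m+2)) / t^6)"

definition limit_tensor :: "nat \<Rightarrow> (nat \<Rightarrow> complex) \<Rightarrow> (nat \<Rightarrow> complex) \<Rightarrow> (nat \<Rightarrow> complex) \<Rightarrow> complex" where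
  "limit_tensor m x y z = x 0 * y 0 * z 0
    + (\<Sum>i\<in>{1..m}. (x 0 * y i + x i * y 0) * z i + (x 0 * y (m+i) + x (m+i) * y 0) * z (m+i)
        + (x 0 * y (2*m+i) + x (2*m+i) * y 0) * z (2*m+i)
        + (x i * y (m+i) + x (m+i) * y i) * z (3*m+1) + (x i * y (2*m+i) + x (2*m+i) * y i) * z (3*m+2))
    + (x 0 * y (3*m+1) + x (3*m+1) * y 0) * z (3*m+1) + (x 0 * y (3*m+2) + x (3*m+2) * y 0) * z (3*m+2)"

lemma approx_tensor_summand:
  fixes t :: complex
  assumes "t \<noteq> 0"
  shows "(x0 + t^2 * (x1 + t * x2)) * (y0 + t^2 * (y1 + t * y2)) * (z2 / t^3 + zc / t^5)
     + (x0 + t^2 * (x1 + t * x3)) * (y0 + t^2 * (y1 + t * y3)) * (z3 / t^3 + zd / t^5)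
     + (x0 + t^2 * x1) * (y0 + t^2 * y1) * (z1 / t^2 - (z2 + z3) / t^3 - (zc + zd) / t^5)
    = ((x0 * y1 + x1 * y0) * z1 + (x0 * y2 + x2 * y0) * z2 + (x0 * y3 + x3 * y0) * z3
        + (x1 * y2 + x2 * y1) * zc + (x1 * y3 + x3 * y1) * zd)
      + x0 * y0 * z1 / t^2 + (x0 * y2 + x2 * y0) * zc / t^2 + (x0 * y3 + x3 * y0) * zd / t^2
      + t * (x2 * y2 * zc + x3 * y3 * zd + t * (x1 * y1 * z1 + (x1 * y2 + x2 * y1 + t * x2 * y2) * z2
           + (x1 * y3 + x3 * y1 + t * x3 * y3) * z3))"
  using assms by (simp add: field_simps) (simp add: algebra_simps eval_nat_numeral)

lemma approx_tensor_tail: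
  fixes t :: complex
  assumes "t \<noteq> 0"
  shows "(x0 - t^4 * sx + t^6 * xc) * (y0 - t^4 * sy + t^6 * yc) * (zc / t^6)
    = x0 * y0 * zc / t^6 + (x0 * yc + xc * y0) * zc - (x0 * sy + sx * y0) * zc / t^2
      + t * (t * (sx - t^2 * xc) * (sy - t^2 * yc) * zc)"
  using assms by (simp add: field_simps) (simp add: algebra_simps eval_nat_numeral)

text \<open>All poles cancel and the error is \<open>t\<close> times a polynomial in
  \<open>t\<close>, so the limit at 0 follows by continuity.\<close>

lemma approx_tensor_eq:
  assumes "t \<noteq> 0"
  shows "approx_tensor m t x y z = limit_tensor m x y z + t * (
     (\<Sum>i\<in>{1..m}. x (m+i) * y (m+i) * z (3*m+1) + x (2*m+i) * y (2*m+i) * z (3*m+2) + t * (x i * y i * z i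
        + (x i * y (m+i) + x (m+i) * y i + t * x (m+i) * y (m+i)) * z (m+i)
        + (x i * y (2*m+i) + x (2*m+i) * y i + t * x (2*m+i) * y (2*m+i)) * z (2*m+i)))
     + t * ((\<Sum>i\<in>{1..m}. x (m+i)) - t^2 * x (3*m+1)) * ((\<Sum>i\<in>{1..m}. y (m+i)) - t^2 * y (3*m+1)) * z (3*m+1)
     + t * ((\<Sum>i\<in>{1..m}. x (2*m+i)) - t^2 * x (3*m+2)) * ((\<Sum>i\<in>{1..m}. y (2*m+i)) - t^2 * y (3*m+2)) * z (3*m+2))"
proof -
  have sums: "(\<Sum>i\<in>{1..m}. x 0 * y 0 * z i / t^2) = x 0 * y 0 * (\<Sum>i\<in>{1..m}. z i) / t^2"
    "(\<Sum>i\<in>{1..m}. (x 0 * y (n+i) + x (n+i) * y 0) * w / t^2)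
      = (x 0 * (\<Sum>i\<in>{1..m}. y (n+i)) + (\<Sum>i\<in>{1..m}. x (n+i)) * y 0) * w / t^2"
    for n w
    by (simp_all add: sum_distrib_left sum_distrib_right sum_divide_distrib sum.distrib algebra_simps add_divide_distrib)
  show ?thesis
    unfolding approx_tensor_def limit_tensor_def approx_tensor_summand[OF assms] approx_tensor_tail[OF assms]
      sum.distrib[of _ _ "{1..m}"] sum_distrib_left[of t _ "{1..m}", symmetric] sums
    by (simp add: algebra_simps add_divide_distrib diff_divide_distrib)
qed

lemma approx_tensor_tendsto:
  assumes "s \<longlonglongrightarrow> 0" "\<And>n. s n \<noteq> 0"
  shows "(\<lambda>n. approx_tensor m (s n) x y z) \<longlonglongrightarrow> limit_tensor m x y z"
  unfolding approx_tensor_eq[OF assms(2)]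
  by (rule tendsto_eq_intros assms(1) refl | simp)+

lemma limit_tensor_str_rel:
  assumes "1 \<le> m" "p < 3*m+3" "q < 3*m+3" "r < 3*m+3"
  shows "limit_tensor m (\<lambda>l. of_bool (l = p)) (\<lambda>l. of_bool (l = q)) (\<lambda>l. of_bool (l = r)) = of_bool (str_rel m p q r)"
proof -
  let ?b = "\<lambda>P. of_bool P :: complex"
  have split: "f 0 + (\<Sum>i\<in>{1..m}. f i + f (m+i) + f (2*m+i)) + f (3*m+1) + f (3*m+2) = (\<Sum>k<3*m+3. f k)"
    for f :: "nat \<Rightarrow> complex"
  proof -
    have sh: "(\<Sum>i\<in>{1..m}. f (n+i)) = (\<Sum>k\<in>{n+1..<n+m+1}. f k)" for n
      by (rule sum.reindex_bij_witness[of _ "\<lambda>k. k - n" "\<lambda>i. n + i"]) auto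
    have "(\<Sum>k<3*m+3. f k) = sum f {0..<1} + sum f {1..<m+1} + sum f {m+1..<2*m+1} + sum f {2*m+1..<3*m+1}
        + sum f {3*m+1..<3*m+3}"
    proof -
      have c: "sum f {0..<b} + sum f {b..<c} = sum f {0..<c}" if "b \<le> c" for b c
        using that by (simp add: sum.atLeastLessThan_concat)
      have "1 \<le> m+1" "m+1 \<le> 2*m+1" "2*m+1 \<le> 3*m+1" "3*m+1 \<le> 3*m+3" by simp_all
      then show ?thesis by (simp only: c lessThan_atLeast0)
    qed
    moreover have "sum f {3*m+1..<3*m+3} = f (3*m+1) + f (3*m+2)"
      by (simp add: numeral_3_eq_3 numeral_2_eq_2)
    moreover have "sum f {1..<m+1} = (\<Sum>i\<in>{1..m}. f i)" "sum f {m+1..<2*m+1} = (\<Sum>i\<in>{1..m}. f (m+i))"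
      "sum f {2*m+1..<3*m+1} = (\<Sum>i\<in>{1..m}. f (2*m+i))"
      using sh[of 0] sh[of m] sh[of "2*m"] by (simp_all add: mult_2[symmetric])
    ultimately have "(\<Sum>k<3*m+3. f k) = f 0 + (\<Sum>i\<in>{1..m}. f i) + (\<Sum>i\<in>{1..m}. f (m+i)) + (\<Sum>i\<in>{1..m}. f (2*m+i))
        + f (3*m+1) + f (3*m+2)"
      by simp
    then show ?thesis by (simp add: sum.distrib)
  qed
  have pick: "(\<Sum>i\<in>{1..m}. ?b (i = p) * ?b (n + i = q)) = ?b (p \<in> {1..m} \<and> q = n + p)" for n p q
  proof -
    have "(\<Sum>i\<in>{1..m}. ?b (i = p) * ?b (n + i = q)) = (\<Sum>i\<in>{1..m}. if i = p then ?b (n + i = q) else 0)"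
      by (intro sum.cong refl) auto
    then show ?thesis by auto
  qed
  \<comment> \<open>The products with the unit on the left and those with the unit on the right are
    each completed to sums over the whole basis. Both contain 1 times 1, hence the subtracted
    term.\<close>
  have "limit_tensor m (\<lambda>l. ?b (l = p)) (\<lambda>l. ?b (l = q)) (\<lambda>l. ?b (l = r))
    = ?b (0 = p) * (?b (0 = q) * ?b (0 = r) + (\<Sum>i\<in>{1..m}. ?b (i = q) * ?b (i = r) + ?b (m+i = q) * ?b (m+i = r)
          + ?b (2*m+i = q) * ?b (2*m+i = r)) + ?b (3*m+1 = q) * ?b (3*m+1 = r) + ?b (3*m+2 = q) * ?b (3*m+2 = r))
    + ?b (0 = q) * (?b (0 = p) * ?b (0 = r) + (\<Sum>i\<in>{1..m}. ?b (i = p) * ?b (i = r) + ?b (m+i = p) * ?b (m+i = r)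
          + ?b (2*m+i = p) * ?b (2*m+i = r)) + ?b (3*m+1 = p) * ?b (3*m+1 = r) + ?b (3*m+2 = p) * ?b (3*m+2 = r))
    - ?b (0 = p) * ?b (0 = q) * ?b (0 = r)
    + ((\<Sum>i\<in>{1..m}. ?b (i = p) * ?b (m+i = q)) + (\<Sum>i\<in>{1..m}. ?b (i = q) * ?b (m+i = p))) * ?b (3*m+1 = r)
    + ((\<Sum>i\<in>{1..m}. ?b (i = p) * ?b (2*m+i = q)) + (\<Sum>i\<in>{1..m}. ?b (i = q) * ?b (2*m+i = p))) * ?b (3*m+2 = r)"
    unfolding limit_tensor_def sum.distrib sum_distrib_left sum_distrib_right distrib_left distrib_right
    by (simp add: mult_ac)
  also have "\<dots> = ?b (0 = p) * ?b (q = r) + ?b (0 = q) * ?b (p = r) - ?b (0 = p) * ?b (0 = q) * ?b (0 = r)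
    + (?b (p \<in> {1..m} \<and> q = m + p) + ?b (q \<in> {1..m} \<and> p = m + q)) * ?b (3*m+1 = r)
    + (?b (p \<in> {1..m} \<and> q = 2*m + p) + ?b (q \<in> {1..m} \<and> p = 2*m + q)) * ?b (3*m+2 = r)"
  proof -
    have "(\<Sum>k<3*m+3. ?b (k = q) * ?b (k = r)) = ?b (q = r)" if "q < 3*m+3" for q
    proof -
      have "(\<Sum>k<3*m+3. ?b (k = q) * ?b (k = r)) = (\<Sum>k<3*m+3. if k = q then ?b (q = r) else 0)"
        by (intro sum.cong refl) auto
      then show ?thesis using that by simp
    qed
    then show ?thesis
      unfolding pick split[of "\<lambda>k. ?b (k = q) * ?b (k = r)"] split[of "\<lambda>k. ?b (k = p) * ?b (k = r)"]
      using assms by simp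
  qed
  also have "\<dots> = ?b (str_rel m p q r)"
  proof -
    have conv: "0 = p \<longleftrightarrow> p = 0" "0 = q \<longleftrightarrow> q = 0" "0 = r \<longleftrightarrow> r = 0"
      "3*m+1 = r \<longleftrightarrow> r = 3*m+1" "3*m+2 = r \<longleftrightarrow> r = 3*m+2" by auto
    show ?thesis
    proof (cases "p = 0 \<or> q = 0")
      case True
      then show ?thesis
        unfolding conv str_rel_def using assms(1) by (elim disjE) (cases "q = r"; cases "p = r"; simp)+
    next
      case False
      have or: "?b A + ?b B = ?b (A \<or> B)" if "\<not> (A \<and> B)" for A B using that by auto
      have "?b (p \<in> {1..m} \<and> q = n + p) + ?b (q \<in> {1..m} \<and> p = n + q)
        = ?b (\<exists>l\<in>{1..m}. p = l \<and> q = n+l \<or> p = n+l \<and> q = l)" if "n > 0" for n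
        using that by (subst or) (auto intro!: arg_cong[where f = of_bool])
      from this[of m] this[of "2*m"] False assms(1) show ?thesis
        unfolding conv str_rel_def by (cases "r = 3*m+1"; cases "r = 3*m+2") simp_all
    qed
  qed
  finally show ?thesis .
qed

lemma rk_le_approx_tensor:
  "rk_le (3*m+3) (\<lambda>p q r. approx_tensor m t (f p) (g q) (h r))"
proof -
  have "rk_le (card {1..m} * (Suc 0 + Suc 0 + Suc 0) + Suc 0 + Suc 0 + Suc 0)
    (\<lambda>p q r. approx_tensor m t (f p) (g q) (h r))"
    unfolding approx_tensor_def by (intro rk_le_add rk_le_sum rk_le_1) simp
  moreover have "card {1..m} * (Suc 0 + Suc 0 + Suc 0) + Suc 0 + Suc 0 + Suc 0 = 3*m+3" by simp
  ultimately show ?thesis by metis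
qed

lemma dims_T_A [simp]: "dim1 (T_A m) = 3*m+3" "dim2 (T_A m) = 3*m+3" "dim3 (T_A m) = 3*m+3"
  by (simp_all add: T_A_def)

lemma T_A_in_closure:
  assumes "1 \<le> m"
  shows "entry (T_A m) \<in> closure {entry S | S. dim1 S = dim1 (T_A m) \<and> dim2 S = dim2 (T_A m) \<and>
    dim3 S = dim3 (T_A m) \<and> tensor_rank S \<le> 3*m+3}"
proof -
  let ?b = "\<lambda>p l. of_bool (l = p) :: complex"
  define s where "s = (\<lambda>n. inverse (of_nat (Suc n)) :: complex)"
  define S where "S = (\<lambda>n. Tensor (3*m+3) (3*m+3) (3*m+3) (\<lambda>p q r. approx_tensor m (s n) (?b p) (?b q) (?b r)))"
  have "s \<longlonglongrightarrow> 0" unfolding s_def by (rule LIMSEQ_Suc[OF lim_inverse_n])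
  have "(\<lambda>n. entry (S n) p q r) \<longlonglongrightarrow> entry (T_A m) p q r" for p q r
  proof (cases "p < 3*m+3 \<and> q < 3*m+3 \<and> r < 3*m+3")
    case True
    have "(\<lambda>n. approx_tensor m (s n) (?b p) (?b q) (?b r)) \<longlonglongrightarrow> limit_tensor m (?b p) (?b q) (?b r)"
      using \<open>s \<longlonglongrightarrow> 0\<close> by (rule approx_tensor_tendsto) (simp add: s_def del: of_nat_Suc)
    also have "limit_tensor m (?b p) (?b q) (?b r) = entry (T_A m) p q r"
      using True assms by (simp add: entry_T_A limit_tensor_str_rel)
    also have "(\<lambda>n. approx_tensor m (s n) (?b p) (?b q) (?b r)) = (\<lambda>n. entry (S n) p q r)"
      using True by (simp add: entry_def S_def)
    finally show ?thesis .
  qed (auto simp: entry_def S_def)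
  then have "(\<lambda>n. entry (S n)) \<longlonglongrightarrow> entry (T_A m)"
    by (intro tendsto_funI)
  moreover have "tensor_rank (S n) \<le> 3*m+3" for n
  proof (rule tensor_rank_le)
    have "rk_le (3*m+3) (\<lambda>p q r. of_bool (p < 3*m+3) * of_bool (q < 3*m+3) * of_bool (r < 3*m+3) *
        approx_tensor m (s n) (?b p) (?b q) (?b r))"
      by (rule rk_le_scale[OF rk_le_approx_tensor])
    also have "(\<lambda>p q r. of_bool (p < 3*m+3) * of_bool (q < 3*m+3) * of_bool (r < 3*m+3) *
        approx_tensor m (s n) (?b p) (?b q) (?b r)) = entry (S n)"
      by (intro ext) (auto simp: S_def entry_def)
    finally show "rk_le (3*m+3) (entry (S n))" .
  qed
  ultimately show ?thesis
    unfolding closure_sequential by (intro exI[of _ "\<lambda>n. entry (S n)"]) (auto simp: S_def)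
qed

lemma closure_tensor_rank_imp_brk_le:
  assumes "t \<in> closure {entry S | S. dim1 S = d1 \<and> dim2 S = d2 \<and> dim3 S = d3 \<and> tensor_rank S \<le> r}"
  shows "brk_le r t"
proof -
  have "{entry S | S. dim1 S = d1 \<and> dim2 S = d2 \<and> dim3 S = d3 \<and> tensor_rank S \<le> r} \<subseteq> Collect (rk_le r)"
    using rk_le_mono[OF rk_le_tensor_rank] by auto
  from closure_mono[OF this] assms show ?thesis by (auto simp: brk_le_def)
qed

lemma brk_le_T_A: "1 \<le> m \<Longrightarrow> brk_le (3*m+3) (entry (T_A m))"
  by (rule closure_tensor_rank_imp_brk_le[OF T_A_in_closure])

text \<open>The determinant of a slice is a polynomial in the entries, so its zero set is closed and
  contains the closure of the tensors of rank below \<open>d\<close>. For the structure tensor the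
  slice is multiplication by 1.\<close>

lemma brk_le_identity_slice:
  assumes "brk_le r t" "\<And>j k. j < d \<Longrightarrow> k < d \<Longrightarrow> t i j k = of_bool (j = k)"
  shows "d \<le> r"
proof (rule ccontr)
  assume "\<not> d \<le> r"
  define D where "D = (\<lambda>t :: nat \<Rightarrow> nat \<Rightarrow> nat \<Rightarrow> complex. det (mat d d (\<lambda>(j, k). t i j k)))"
  have D: "D = (\<lambda>t. \<Sum>p | p permutes {0..<d}. signof p * (\<Prod>j = 0..<d. t i j (p j)))"
  proof
    fix t
    have "D t = (\<Sum>p | p permutes {0..<d}. signof p * (\<Prod>j = 0..<d. mat d d (\<lambda>(j, k). t i j k) $$ (j, p j)))"
      unfolding D_def by (rule det_def') simp
    also have "\<dots> = (\<Sum>p | p permutes {0..<d}. signof p * (\<Prod>j = 0..<d. t i j (p j)))"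
      by (intro sum.cong refl arg_cong2[where f = "(*)"] prod.cong) (auto simp: permutes_in_image)
    finally show "D t = (\<Sum>p | p permutes {0..<d}. signof p * (\<Prod>j = 0..<d. t i j (p j)))" .
  qed
  have "closed {t. D t = 0}"
    unfolding D by (intro closed_Collect_eq continuous_intros continuous_on_tensor_coord)
  moreover have "Collect (rk_le r) \<subseteq> {t. D t = 0}"
    using \<open>\<not> d \<le> r\<close> unfolding D_def by (auto intro: rk_le_slice_det)
  ultimately have "closure (Collect (rk_le r)) \<subseteq> {t. D t = 0}" by (intro closure_minimal)
  then have "D t = 0" using assms(1) by (auto simp: brk_le_def)
  moreover have "mat d d (\<lambda>(j, k). t i j k) = 1\<^sub>m d" by (rule eq_matI) (auto simp: assms(2))
  ultimately show False by (simp add: D_def)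
qed

lemma str_rel_0: "k < 3*m+3 \<Longrightarrow> str_rel m 0 j k \<longleftrightarrow> j = k" "k < 3*m+3 \<Longrightarrow> str_rel m i 0 k \<longleftrightarrow> i = k"
  by (auto simp: str_rel_def)

lemma border_rank_T_A:
  assumes "1 \<le> m"
  shows "border_rank (T_A m) = 3*m+3"
  unfolding border_rank_def
proof (rule Least_equality)
  fix r assume "entry (T_A m) \<in> closure {entry S | S. dim1 S = dim1 (T_A m) \<and> dim2 S = dim2 (T_A m) \<and>
    dim3 S = dim3 (T_A m) \<and> tensor_rank S \<le> r}"
  from closure_tensor_rank_imp_brk_le[OF this] show "3*m+3 \<le> r"
    by (rule brk_le_identity_slice[where i = 0]) (use assms in \<open>auto simp: entry_T_A str_rel_0\<close>)
qed (rule T_A_in_closure[OF assms])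

text \<open>Fixing the unit in one of the first two factors leaves an identity matrix; a linear
  relation evaluated there has only zero coefficients.\<close>

lemma concise_T_A:
  assumes "1 \<le> m"
  shows "concise (T_A m)"
proof -
  have 1: "(\<Sum>i<3*m+3. u i * entry (T_A m) i 0 k) = u k" if "k < 3*m+3" for u k
  proof -
    have "(\<Sum>i<3*m+3. u i * entry (T_A m) i 0 k) = (\<Sum>i<3*m+3. if i = k then u i else 0)"
      using that assms by (intro sum.cong) (auto simp: entry_T_A str_rel_0)
    then show ?thesis using that by simp
  qed
  have 2: "(\<Sum>i<3*m+3. u i * entry (T_A m) 0 i k) = u k" if "k < 3*m+3" for u k
  proof -
    have "(\<Sum>i<3*m+3. u i * entry (T_A m) 0 i k) = (\<Sum>i<3*m+3. if i = k then u i else 0)"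
      using that assms by (intro sum.cong) (auto simp: entry_T_A str_rel_0)
    then show ?thesis using that by simp
  qed
  have 3: "(\<Sum>k<3*m+3. u k * entry (T_A m) 0 i k) = u i" if "i < 3*m+3" for u i
  proof -
    have "(\<Sum>k<3*m+3. u k * entry (T_A m) 0 i k) = (\<Sum>k<3*m+3. if k = i then u k else 0)"
      using that assms by (intro sum.cong) (auto simp: entry_T_A str_rel_0)
    then show ?thesis using that by simp
  qed
  have 0: "0 < 3*m+3" by simp
  show ?thesis
    unfolding concise_def dims_T_A
  proof (intro conjI allI impI)
    fix u :: "nat \<Rightarrow> complex" and i :: nat
    assume i: "i < 3*m+3"
    show "u i = 0" if "\<forall>j<3*m+3. \<forall>k<3*m+3. (\<Sum>i<3*m+3. u i * entry (T_A m) i j k) = 0"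
      using 1[OF i, of u] that i 0 by simp
    show "u i = 0" if "\<forall>i<3*m+3. \<forall>k<3*m+3. (\<Sum>j<3*m+3. u j * entry (T_A m) i j k) = 0"
      using 2[OF i, of u] that i 0 by simp
    show "u i = 0" if "\<forall>i<3*m+3. \<forall>j<3*m+3. (\<Sum>k<3*m+3. u k * entry (T_A m) i j k) = 0"
      using 3[OF i, of u] that i 0 by simp
  qed
qed

lemma minimal_border_rank_T_A: "1 \<le> m \<Longrightarrow> minimal_border_rank (T_A m)"
  unfolding minimal_border_rank_def by (simp add: concise_T_A border_rank_T_A)

section \<open>The upper bound on the value\<close>

lemma entry_direct_sum: "entry (direct_sum T T') i j k =
   (if i < dim1 T \<and> j < dim2 T \<and> k < dim3 T then entry T i j k
    else if dim1 T \<le> i \<and> dim2 T \<le> j \<and> dim3 T \<le> k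
      then entry T' (i - dim1 T) (j - dim2 T) (k - dim3 T) else 0)"
  by (auto simp: entry_def direct_sum_def)

lemma direct_sum_list_simps [simp]:
  "direct_sum_list [] = Tensor 0 0 0 (\<lambda>_ _ _. 0)"
  "direct_sum_list (T # Ts) = direct_sum T (direct_sum_list Ts)"
  by (simp_all add: direct_sum_list_def)

lemma dims_direct_sum [simp]: "dim1 (direct_sum T T') = dim1 T + dim1 T'"
  "dim2 (direct_sum T T') = dim2 T + dim2 T'" "dim3 (direct_sum T T') = dim3 T + dim3 T'"
  by (simp_all add: direct_sum_def)

lemma dims_direct_sum_list: "dim1 (direct_sum_list Ts) = sum_list (map dim1 Ts)"
  "dim2 (direct_sum_list Ts) = sum_list (map dim2 Ts)" "dim3 (direct_sum_list Ts) = sum_list (map dim3 Ts)"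
  by (induction Ts) auto

definition offset :: "('x \<Rightarrow> nat) \<Rightarrow> 'x list \<Rightarrow> nat \<Rightarrow> nat" where
  "offset f xs s = sum_list (map f (take s xs))"

lemma offset_simps [simp]: "offset f xs 0 = 0" "offset f (x # xs) (Suc s) = f x + offset f xs s"
  by (simp_all add: offset_def)

lemma offset_obtain:
  assumes "p < sum_list (map f xs)"
  obtains s p' where "s < length xs" "p' < f (xs ! s)" "p = offset f xs s + p'"
proof -
  have "\<exists>s p'. s < length xs \<and> p' < f (xs ! s) \<and> p = offset f xs s + p'"
    using assms
  proof (induction xs arbitrary: p)
    case (Cons x xs)
    show ?case
    proof (cases "p < f x")
      case True
      then show ?thesis by (intro exI[of _ 0] exI[of _ p]) auto
    next
      case False
      then have "p - f x < sum_list (map f xs)" using Cons.prems by simp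
      from Cons.IH[OF this] obtain s p' where "s < length xs" "p' < f (xs ! s)" "p - f x = offset f xs s + p'"
        by blast
      then show ?thesis using False by (intro exI[of _ "Suc s"] exI[of _ p']) auto
    qed
  qed simp
  then show ?thesis using that by blast
qed

lemma entry_direct_sum_list:
  assumes "s < length Ts" "s' < length Ts" "s'' < length Ts"
    "p < dim1 (Ts ! s)" "q < dim2 (Ts ! s')" "r < dim3 (Ts ! s'')"
  shows "entry (direct_sum_list Ts) (offset dim1 Ts s + p) (offset dim2 Ts s' + q) (offset dim3 Ts s'' + r)
    = (if s = s' \<and> s = s'' then entry (Ts ! s) p q r else 0)"
  using assms
proof (induction Ts arbitrary: s s' s'')
  case (Cons T Ts)
  show ?case
    by (cases s; cases s'; cases s'') (use Cons in \<open>auto simp: entry_direct_sum\<close>)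
qed simp

abbreviation matmuls :: "(nat \<times> nat \<times> nat) list \<Rightarrow> tensor" where
  "matmuls abcs \<equiv> direct_sum_list (map (\<lambda>(a, b, c). matmul a b c) abcs)"

lemma dims_matmul [simp]: "dim1 (matmul a b c) = a * b" "dim2 (matmul a b c) = b * c" "dim3 (matmul a b c) = c * a"
  by (simp_all add: matmul_def)

lemma sum_powr_omega_le:
  assumes "brk_le R (entry (matmuls abcs))" "\<forall>(a, b, c)\<in>set abcs. 1 \<le> a \<and> 1 \<le> b \<and> 1 \<le> c"
  shows "(\<Sum>(a, b, c)\<leftarrow>abcs. real (a * b * c) powr (omega / 3)) \<le> real R"
proof -
  obtain S where S: "\<And>n. rk_le R (S n)" "\<And>i j k. (\<lambda>n. S n i j k) \<longlonglongrightarrow> entry (matmuls abcs) i j k"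
    using brk_le_seq[OF assms(1)] by blast
  define Ts where "Ts = map (\<lambda>(a, b, c). matmul a b c) abcs"
  define a b c where "a = (\<lambda>s. fst (abcs ! s))" and "b = (\<lambda>s. fst (snd (abcs ! s)))" and "c = (\<lambda>s. snd (snd (abcs ! s)))"
  have Ts: "Ts ! s = matmul (a s) (b s) (c s)" if "s < length abcs" for s
    using that by (simp add: Ts_def a_def b_def c_def split_def)
  define S' where "S' = (\<lambda>n (s, i, j) (s', j', k) (s'', k', i').
     S n (offset dim1 Ts s + (i * b s + j)) (offset dim2 Ts s' + (j' * c s' + k)) (offset dim3 Ts s'' + (k' * a s'' + i')))"
  have "(\<Sum>s<length abcs. real (a s * b s * c s) powr (omega / 3)) \<le> real R"
  proof (rule sum_powr_omega_le_matmul_sum)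
    show "a s \<ge> 1 \<and> b s \<ge> 1 \<and> c s \<ge> 1" if "s < length abcs" for s
      using assms(2) that nth_mem[of s abcs] by (auto simp: a_def b_def c_def split_def)
    have "S' n = (\<lambda>x y z. S n (case x of (s, i, j) \<Rightarrow> offset dim1 Ts s + (i * b s + j))
        (case y of (s', j', k) \<Rightarrow> offset dim2 Ts s' + (j' * c s' + k))
        (case z of (s'', k', i') \<Rightarrow> offset dim3 Ts s'' + (k' * a s'' + i')))" for n
      by (auto simp: S'_def split: prod.splits intro!: ext)
    then show "rk_le R (S' n)" for n
      using rk_le_reindex[OF S(1)] by simp
    fix s i j s' j' k s'' k' i'
    assume *: "s < length abcs" "s' < length abcs" "s'' < length abcs" "i < a s" "j < b s"
      "j' < b s'" "k < c s'" "k' < c s''" "i' < a s''"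
    have "entry (matmuls abcs) (offset dim1 Ts s + (i * b s + j)) (offset dim2 Ts s' + (j' * c s' + k))
        (offset dim3 Ts s'' + (k' * a s'' + i'))
      = (if s = s' \<and> s = s'' then entry (Ts ! s) (i * b s + j) (j' * c s' + k) (k' * a s'' + i') else 0)"
      unfolding Ts_def[symmetric] using * Ts
      by (intro entry_direct_sum_list) (auto simp: index_less Ts_def simp del: nth_map)
    also have "\<dots> = matmul_sum (length abcs) a b c (s, i, j) (s', j', k) (s'', k', i')"
      using * Ts by (auto simp: matmul_sum_def entry_matmul)
    finally have eq: "entry (matmuls abcs) (offset dim1 Ts s + (i * b s + j)) (offset dim2 Ts s' + (j' * c s' + k))
        (offset dim3 Ts s'' + (k' * a s'' + i')) = matmul_sum (length abcs) a b c (s, i, j) (s', j', k) (s'', k', i')" .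
    show "(\<lambda>n. S' n (s, i, j) (s', j', k) (s'', k', i')) \<longlonglongrightarrow>
        matmul_sum (length abcs) a b c (s, i, j) (s', j', k) (s'', k', i')"
      unfolding S'_def eq[symmetric] by (simp add: S(2))
  qed
  also have "(\<Sum>s<length abcs. real (a s * b s * c s) powr (omega / 3))
    = (\<Sum>(a, b, c)\<leftarrow>abcs. real (a * b * c) powr (omega / 3))"
    by (simp add: sum_list_sum_nth a_def b_def c_def split_def atLeast0LessThan)
  finally show ?thesis .
qed

section \<open>Kronecker products, degenerations and border rank\<close>

lemma entry_kron: "entry (kron T T') i j k =
   of_bool (i < dim1 T * dim1 T') * of_bool (j < dim2 T * dim2 T') * of_bool (k < dim3 T * dim3 T') *
   (entry T (i div dim1 T') (j div dim2 T') (k div dim3 T') * entry T' (i mod dim1 T') (j mod dim2 T') (k mod dim3 T'))"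
  by (simp add: kron_def entry_def)

lemma entry_cyclic_perm: "entry (cyclic_perm T) j k i = entry T i j k"
  by (simp add: cyclic_perm_def entry_def)

lemma dims_simps [simp]:
  "dim1 (kron T T') = dim1 T * dim1 T'" "dim2 (kron T T') = dim2 T * dim2 T'" "dim3 (kron T T') = dim3 T * dim3 T'"
  "dim1 (cyclic_perm T) = dim2 T" "dim2 (cyclic_perm T) = dim3 T" "dim3 (cyclic_perm T) = dim1 T"
  by (simp_all add: kron_def cyclic_perm_def)

lemma rk_le_kron:
  assumes "rk_le r (entry T)" "rk_le s (entry T')"
  shows "rk_le (r * s) (entry (kron T T'))"
proof -
  have "rk_le (r * s) (\<lambda>i j k. of_bool (i < dim1 T * dim1 T') * of_bool (j < dim2 T * dim2 T') * of_bool (k < dim3 T * dim3 T') *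
   (entry T (i div dim1 T') (j div dim2 T') (k div dim3 T') * entry T' (i mod dim1 T') (j mod dim2 T') (k mod dim3 T')))"
    by (intro rk_le_scale rk_le_mult assms)
  then show ?thesis unfolding entry_kron[abs_def] .
qed

lemma rk_le_cyclic_perm: "rk_le r (entry T) \<Longrightarrow> rk_le r (entry (cyclic_perm T))"
  unfolding entry_cyclic_perm[abs_def] by (rule rk_le_rotate)

lemma rk_le_symmetrization: "rk_le r (entry T) \<Longrightarrow> rk_le (r ^ 3) (entry (symmetrization T))"
  unfolding symmetrization_def power3_eq_cube by (intro rk_le_kron rk_le_cyclic_perm)

lemma rk_le_kron_power: "rk_le r (entry T) \<Longrightarrow> rk_le (r ^ N) (entry (kron_power T N))"
proof (induction N)
  case 0
  show ?case by (rule rk_le_mono[OF rk_le_box[of _ 1 1]]) (auto simp: entry_def split: if_splits)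
qed (auto intro: rk_le_kron)

lemma dims_kron_power [simp]: "dim1 (kron_power T N) = dim1 T ^ N" "dim2 (kron_power T N) = dim2 T ^ N"
  "dim3 (kron_power T N) = dim3 T ^ N"
  by (induction N) auto

text \<open>The coefficient function is kept as a variable: entries of the power are polynomials in
  it, so limits pass through.\<close>

abbreviation sym_power :: "nat \<Rightarrow> nat \<Rightarrow> (nat \<Rightarrow> nat \<Rightarrow> nat \<Rightarrow> complex) \<Rightarrow> tensor" where
  "sym_power d N t \<equiv> kron_power (symmetrization (Tensor d d d t)) N"

lemma continuous_entry_symmetrization:
  "continuous_on UNIV (\<lambda>t. entry (symmetrization (Tensor d d d t)) i j k)"
proof -
  have "continuous_on UNIV (\<lambda>t. entry (Tensor d d d t) i j k)" for i j k
    by (cases "i < d \<and> j < d \<and> k < d") (auto simp: entry_def intro!: continuous_on_tensor_coord continuous_on_const)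
  then show ?thesis
    unfolding symmetrization_def entry_kron entry_cyclic_perm dims_simps
    by (auto intro!: continuous_intros)
qed

lemma continuous_entry_sym_power: "continuous_on UNIV (\<lambda>t. entry (sym_power d N t) i j k)"
proof (induction N arbitrary: i j k)
  case (Suc N)
  have "dim1 (symmetrization (Tensor d d d t)) = d ^ 3" "dim2 (symmetrization (Tensor d d d t)) = d ^ 3"
    "dim3 (symmetrization (Tensor d d d t)) = d ^ 3" for t
    by (simp_all add: symmetrization_def power3_eq_cube)
  then show ?case
    unfolding kron_power.simps entry_kron dims_kron_power
    by (auto intro!: continuous_intros continuous_entry_symmetrization Suc)
qed simp

lemma rk_le_gl_act: "rk_le r t \<Longrightarrow> rk_le r (gl_act A B C t)"
proof -
  assume "rk_le r t"
  then have "rk_le r (\<lambda>i j k. of_bool (i < dim_row A) * of_bool (j < dim_row B) * of_bool (k < dim_row C) *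
    (\<Sum>i'<dim_col A. \<Sum>j'<dim_col B. \<Sum>k'<dim_col C. A $$ (i, i') * B $$ (j, j') * C $$ (k, k') * t i' j' k'))"
    by (intro rk_le_scale rk_le_linear)
  also have "(\<lambda>i j k. of_bool (i < dim_row A) * of_bool (j < dim_row B) * of_bool (k < dim_row C) *
    (\<Sum>i'<dim_col A. \<Sum>j'<dim_col B. \<Sum>k'<dim_col C. A $$ (i, i') * B $$ (j, j') * C $$ (k, k') * t i' j' k')) = gl_act A B C t"
    by (intro ext) (simp add: gl_act_def)
  finally show ?thesis .
qed

lemma continuous_gl_act: "continuous_on UNIV (\<lambda>t. gl_act A B C t i j k)"
  by (cases "i < dim_row A \<and> j < dim_row B \<and> k < dim_row C")
    (auto simp: gl_act_def intro!: continuous_intros continuous_on_tensor_coord)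

text \<open>Every point of the orbit satisfies the bound, and the bound defines a closed
  set.\<close>

lemma brk_le_degeneration:
  assumes "brk_le r (entry T)" "T \<unrhd> T'"
  shows "brk_le r (entry T')"
proof -
  obtain n1 n2 n3 where cl: "entry T' \<in> closure {gl_act A B C (entry T) | A B C. A \<in> GL n1 \<and> B \<in> GL n2 \<and> C \<in> GL n3}"
    using assms(2) unfolding degenerates_to_def by blast
  have "brk_le r (gl_act A B C (entry T))" for A B C
    by (rule brk_le_image[OF assms(1) continuous_gl_act rk_le_gl_act])
  then have "{gl_act A B C (entry T) | A B C. A \<in> GL n1 \<and> B \<in> GL n2 \<and> C \<in> GL n3} \<subseteq> closure (Collect (rk_le r))"
    by (auto simp: brk_le_def)
  from closure_mono[OF this] cl show ?thesis by (auto simp: brk_le_def)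
qed

lemma brk_le_sym_power_T_A:
  assumes "1 \<le> m"
  shows "brk_le ((3*m+3) ^ (3 * N)) (entry (kron_power (symmetrization (T_A m)) N))"
proof -
  let ?d = "3*m+3"
  have rk: "rk_le (?d ^ (3 * N)) (entry (sym_power ?d N t))" if "rk_le ?d t" for t
  proof -
    have "rk_le ?d (\<lambda>i j k. of_bool (i < ?d) * of_bool (j < ?d) * of_bool (k < ?d) * t i j k)"
      by (rule rk_le_scale[OF that])
    also have "(\<lambda>i j k. of_bool (i < ?d) * of_bool (j < ?d) * of_bool (k < ?d) * t i j k) = entry (Tensor ?d ?d ?d t)"
      by (intro ext) (simp add: entry_def)
    finally show ?thesis
      unfolding power_mult by (intro rk_le_kron_power rk_le_symmetrization)
  qed
  have "brk_le (?d ^ (3 * N)) (entry (sym_power ?d N (entry (T_A m))))"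
    by (rule brk_le_image[OF brk_le_T_A[OF assms] continuous_entry_sym_power rk])
  moreover have "symmetrization (Tensor ?d ?d ?d (entry (T_A m))) = symmetrization (T_A m)"
  proof -
    have "entry (Tensor ?d ?d ?d (entry (T_A m))) = entry (T_A m)"
      by (intro ext) (simp add: entry_def)
    then show ?thesis by (simp add: symmetrization_def kron_def cyclic_perm_def)
  qed
  ultimately show ?thesis by simp
qed

lemma value_level_sum_le:
  assumes "1 \<le> m" "\<forall>(a, b, c)\<in>set abcs. 1 \<le> a \<and> 1 \<le> b \<and> 1 \<le> c"
    and "kron_power (symmetrization (T_A m)) N \<unrhd> matmuls abcs"
  shows "(\<Sum>(a, b, c)\<leftarrow>abcs. real (a * b * c) powr (omega / 3)) \<le> ((3 * real m + 3) ^ 3) ^ N"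
proof -
  have "(\<Sum>(a, b, c)\<leftarrow>abcs. real (a * b * c) powr (omega / 3)) \<le> real ((3*m+3) ^ (3 * N))"
    by (rule sum_powr_omega_le[OF brk_le_degeneration[OF brk_le_sym_power_T_A[OF assms(1)] assms(3)] assms(2)])
  also have "\<dots> = ((3 * real m + 3) ^ 3) ^ N" by (simp add: power_mult add.commute)
  finally show ?thesis .
qed

section \<open>Monomial degenerations\<close>

lemma det_nonzero_imp_GL:
  assumes A: "A \<in> carrier_mat n n" and "det A \<noteq> 0"
  shows "A \<in> GL n"
proof -
  have "A \<in> Units (ring_mat TYPE(complex) n ())" using assms by (rule det_non_zero_imp_unit)
  then obtain B where "B \<in> carrier_mat n n" "B * A = 1\<^sub>m n" "A * B = 1\<^sub>m n"
    by (auto simp: Units_def ring_mat_def)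
  then show ?thesis using A by (auto simp: GL_def invertible_mat_def inverts_mat_def)
qed

text \<open>Subtracting \<open>x\<close> times the identity gives a singular matrix only if
  \<open>x\<close> is one of the finitely many eigenvalues.\<close>

lemma eventually_shift_GL:
  assumes A: "A \<in> carrier_mat n n"
  shows "eventually (\<lambda>x. char_matrix A x \<in> GL n) (at 0)"
proof -
  let ?F = "{x. poly (char_poly A) x = 0}"
  have "char_poly A \<noteq> 0" using degree_monic_char_poly[OF A] by auto
  then have "finite ?F" by (rule poly_roots_finite)
  then have "open (- (?F - {0}))" by (intro open_Compl finite_imp_closed) auto
  then have "eventually (\<lambda>x. x \<in> - (?F - {0})) (nhds 0)" by (intro eventually_nhds_in_open) auto
  then show ?thesis
    unfolding eventually_at_filter
  proof eventually_elim
    case (elim x)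
    show ?case
    proof (intro impI)
      assume "x \<noteq> 0"
      then have "\<not> eigenvalue A x" using elim eigenvalue_root_char_poly[OF A] by auto
      then show "char_matrix A x \<in> GL n" using A by (intro det_nonzero_imp_GL) (auto simp: eigenvalue_det)
    qed
  qed
qed

text \<open>Invertible matrices are dense, so an orbit closure also contains the images under
  singular matrices such as coordinate projections.\<close>

lemma gl_act_in_closure:
  assumes A: "A \<in> carrier_mat n1 n1" and B: "B \<in> carrier_mat n2 n2" and C: "C \<in> carrier_mat n3 n3"
  shows "gl_act A B C t \<in> closure {gl_act A B C t | A B C. A \<in> GL n1 \<and> B \<in> GL n2 \<and> C \<in> GL n3}"
    (is "_ \<in> closure ?S")
proof -
  define s where "s = (\<lambda>n. inverse (of_nat (Suc n)) :: complex)"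
  have s0: "s \<longlonglongrightarrow> 0" unfolding s_def by (rule LIMSEQ_Suc[OF lim_inverse_n])
  then have "filterlim s (at 0) sequentially"
    unfolding filterlim_at by (auto simp: s_def simp del: of_nat_Suc)
  then have "eventually (\<lambda>n. char_matrix A (s n) \<in> GL n1 \<and> char_matrix B (s n) \<in> GL n2 \<and> char_matrix C (s n) \<in> GL n3) sequentially"
    using eventually_conj[OF eventually_shift_GL[OF A] eventually_conj[OF eventually_shift_GL[OF B] eventually_shift_GL[OF C]]]
    by (auto simp: filterlim_iff)
  then obtain K where K: "\<And>n. n \<ge> K \<Longrightarrow> char_matrix A (s n) \<in> GL n1 \<and> char_matrix B (s n) \<in> GL n2 \<and> char_matrix C (s n) \<in> GL n3"
    unfolding eventually_sequentially by blast
  have sK: "(\<lambda>n. s (n + K)) \<longlonglongrightarrow> 0" using s0 by (rule LIMSEQ_ignore_initial_segment)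
  have ent: "(\<lambda>n. char_matrix D (s (n + K)) $$ (i, j)) \<longlonglongrightarrow> D $$ (i, j)"
    if "D \<in> carrier_mat d d" "i < d" "j < d" for D d i j
  proof -
    have "(\<lambda>n. D $$ (i, j) + (- s (n + K)) * (if i = j then 1 else 0)) \<longlonglongrightarrow> D $$ (i, j) + (- 0) * (if i = j then 1 else 0)"
      by (intro tendsto_intros sK)
    then show ?thesis using that by (simp add: char_matrix_def)
  qed
  have dims: "dim_row (char_matrix D x) = d" "dim_col (char_matrix D x) = d" if "D \<in> carrier_mat d d" for D d x
    using char_matrix_closed[OF that, of x] by auto
  have "(\<lambda>n. gl_act (char_matrix A (s (n + K))) (char_matrix B (s (n + K))) (char_matrix C (s (n + K))) t) \<longlonglongrightarrow> gl_act A B C t"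
  proof (intro tendsto_funI)
    fix i j k
    show "(\<lambda>n. gl_act (char_matrix A (s (n + K))) (char_matrix B (s (n + K))) (char_matrix C (s (n + K))) t i j k)
      \<longlonglongrightarrow> gl_act A B C t i j k"
    proof (cases "i < n1 \<and> j < n2 \<and> k < n3")
      case True
      have carr: "dim_row A = n1" "dim_col A = n1" "dim_row B = n2" "dim_col B = n2" "dim_row C = n3" "dim_col C = n3"
        using A B C by auto
      show ?thesis
        unfolding gl_act_def dims[OF A] dims[OF B] dims[OF C] carr
        using True by (auto intro!: tendsto_intros ent[OF A] ent[OF B] ent[OF C])
    next
      case False
      then show ?thesis unfolding gl_act_def dims[OF A] dims[OF B] dims[OF C] using A B C by auto
    qed
  qed
  moreover have mem: "gl_act (char_matrix A (s (n + K))) (char_matrix B (s (n + K))) (char_matrix C (s (n + K))) t \<in> ?S" for n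
    using K[of "n + K"] by auto
  ultimately show ?thesis
    unfolding closure_sequential
    by (intro exI[of _ "\<lambda>n. gl_act (char_matrix A (s (n + K))) (char_matrix B (s (n + K))) (char_matrix C (s (n + K))) t"]
        conjI allI mem)
qed

text \<open>Coordinates are selected by \<open>f\<close>, \<open>g\<close>, \<open>h\<close>, which
  may repeat values, and scaled by powers of a parameter. As the parameter tends to 0, entries of
  total weight 0 stay fixed and those of positive weight vanish.\<close>

lemma degenerates_to_monomial:
  fixes w1 w2 w3 :: "nat \<Rightarrow> int"
  assumes f: "\<And>i. i < dim1 T' \<Longrightarrow> f i < dim1 T" and g: "\<And>j. j < dim2 T' \<Longrightarrow> g j < dim2 T"
    and h: "\<And>k. k < dim3 T' \<Longrightarrow> h k < dim3 T"
    and nonneg: "\<And>i j k. i < dim1 T' \<Longrightarrow> j < dim2 T' \<Longrightarrow> k < dim3 T' \<Longrightarrow>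
      entry T (f i) (g j) (h k) \<noteq> 0 \<Longrightarrow> w1 i + w2 j + w3 k \<ge> 0"
    and eq: "\<And>i j k. i < dim1 T' \<Longrightarrow> j < dim2 T' \<Longrightarrow> k < dim3 T' \<Longrightarrow>
      entry T' i j k = (if w1 i + w2 j + w3 k = 0 then entry T (f i) (g j) (h k) else 0)"
  shows "T \<unrhd> T'"
proof -
  define n1 n2 n3 where "n1 = max (dim1 T) (dim1 T')" and "n2 = max (dim2 T) (dim2 T')" and "n3 = max (dim3 T) (dim3 T')"
  let ?S = "{gl_act A B C (entry T) | A B C. A \<in> GL n1 \<and> B \<in> GL n2 \<and> C \<in> GL n3}"
  \<comment> \<open>Integer powers are required because single weights may be negative; only their
    sums on the support are not. Rows beyond \<open>d\<close> are zero, so these matrices are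
    singular in general.\<close>
  define mt where "mt = (\<lambda>n d f w (s :: complex). mat n n (\<lambda>(p, p'). if p < d \<and> p' = f p then s powi (w p) else 0))"
  define act where "act = (\<lambda>s. gl_act (mt n1 (dim1 T') f w1 s) (mt n2 (dim2 T') g w2 s) (mt n3 (dim3 T') h w3 s) (entry T))"
  have act: "act s i j k = s powi (w1 i) * s powi (w2 j) * s powi (w3 k) * entry T (f i) (g j) (h k)"
    if "i < dim1 T'" "j < dim2 T'" "k < dim3 T'" for s i j k
  proof -
    have fm: "f i < n1" "g j < n2" "h k < n3"
      using f[of i] g[of j] h[of k] that by (auto simp: n1_def n2_def n3_def)
    have "i < n1" "j < n2" "k < n3" using that by (auto simp: n1_def n2_def n3_def)
    then have "act s i j k = (\<Sum>i'<n1. \<Sum>j'<n2. \<Sum>k'<n3. (if i' = f i then s powi (w1 i) else 0) *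
        (if j' = g j then s powi (w2 j) else 0) * (if k' = h k then s powi (w3 k) else 0) * entry T i' j' k')"
      using that by (simp add: act_def gl_act_def mt_def)
    also have "\<dots> = (\<Sum>i'<n1. \<Sum>j'<n2. \<Sum>k'<n3. if k' = h k then if i' = f i then if j' = g j then
          s powi (w1 i) * s powi (w2 j) * s powi (w3 k) * entry T i' j' k' else 0 else 0 else 0)"
      by (intro sum.cong refl) auto
    also have "\<dots> = (\<Sum>i'<n1. \<Sum>j'<n2. if j' = g j then if i' = f i then
          s powi (w1 i) * s powi (w2 j) * s powi (w3 k) * entry T i' j' (h k) else 0 else 0)"
      using fm by (intro sum.cong refl) auto
    also have "\<dots> = s powi (w1 i) * s powi (w2 j) * s powi (w3 k) * entry T (f i) (g j) (h k)"
      using fm by auto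
    finally show ?thesis .
  qed
  have act0: "act s i j k = 0" if out: "\<not> (i < dim1 T' \<and> j < dim2 T' \<and> k < dim3 T')" for s i j k
  proof -
    consider "\<not> i < dim1 T'" | "\<not> j < dim2 T'" | "\<not> k < dim3 T'" using out by blast
    then show ?thesis by cases (auto simp: act_def gl_act_def mt_def)
  qed
  define s where "s = (\<lambda>n. inverse (of_nat (Suc n)) :: complex)"
  have s0: "s \<longlonglongrightarrow> 0" unfolding s_def by (rule LIMSEQ_Suc[OF lim_inverse_n])
  have snz: "s n \<noteq> 0" for n by (simp add: s_def del: of_nat_Suc)
  have "(\<lambda>n. act (s n)) \<longlonglongrightarrow> entry T'"
  proof (intro tendsto_funI)
    fix i j k
    show "(\<lambda>n. act (s n) i j k) \<longlonglongrightarrow> entry T' i j k"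
    proof (cases "i < dim1 T' \<and> j < dim2 T' \<and> k < dim3 T'")
      case True
      let ?w = "w1 i + w2 j + w3 k"
      have *: "act (s n) i j k = s n powi ?w * entry T (f i) (g j) (h k)" for n
        using True snz by (simp add: act power_int_add)
      consider "entry T (f i) (g j) (h k) = 0" | "?w = 0" | "?w > 0" using nonneg[of i j k] True by linarith
      then show ?thesis
      proof cases
        case 3
        then have "s n powi ?w = s n ^ nat ?w" for n by (simp add: power_int_def)
        moreover have "(\<lambda>n. s n ^ nat ?w * entry T (f i) (g j) (h k)) \<longlonglongrightarrow> 0 ^ nat ?w * entry T (f i) (g j) (h k)"
          by (intro tendsto_intros s0)
        ultimately show ?thesis using 3 True by (simp add: * eq zero_power)
      qed (use True in \<open>auto simp: * eq\<close>)
    next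
      case False
      then have "act (s n) i j k = 0" for n by (rule act0)
      moreover have "entry T' i j k = 0" using False by (auto simp: entry_def)
      ultimately show ?thesis by simp
    qed
  qed
  moreover have "act (s n) \<in> closure ?S" for n
    unfolding act_def mt_def by (intro gl_act_in_closure) auto
  ultimately have "entry T' \<in> closure (closure ?S)"
    unfolding closure_sequential[of _ "closure ?S"] by (intro exI[of _ "\<lambda>n. act (s n)"] conjI allI)
  then show ?thesis
    unfolding degenerates_to_def
    by (intro exI[of _ n1] exI[of _ n2] exI[of _ n3]) (auto simp: n1_def n2_def n3_def)
qed

primrec locate :: "('x \<Rightarrow> nat) \<Rightarrow> 'x list \<Rightarrow> nat \<Rightarrow> nat \<times> nat" where
  "locate f [] p = (0, p)"
| "locate f (x # xs) p = (if p < f x then (0, p) else map_prod Suc id (locate f xs (p - f x)))"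

lemma locate_offset: "s < length xs \<Longrightarrow> p < f (xs ! s) \<Longrightarrow> locate f xs (offset f xs s + p) = (s, p)"
proof (induction xs arbitrary: s)
  case (Cons x xs)
  then show ?case by (cases s) auto
qed simp

text \<open>Weights are attached to summands rather than to single indices. Any triple that mixes
  summands and meets the support must have positive total weight, and inside a summand the weights
  balance.\<close>

lemma degenerates_to_matmuls:
  fixes w1 w2 w3 :: "nat \<Rightarrow> int" and F G H :: "nat \<Rightarrow> nat \<Rightarrow> nat \<Rightarrow> nat"
  assumes dims: "\<And>\<kappa>. \<kappa> < length abcs \<Longrightarrow> abcs ! \<kappa> = (a \<kappa>, b \<kappa>, c \<kappa>)"
    and F: "\<And>\<kappa> i j. \<kappa> < length abcs \<Longrightarrow> i < a \<kappa> \<Longrightarrow> j < b \<kappa> \<Longrightarrow> F \<kappa> i j < dim1 T"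
    and G: "\<And>\<kappa> j k. \<kappa> < length abcs \<Longrightarrow> j < b \<kappa> \<Longrightarrow> k < c \<kappa> \<Longrightarrow> G \<kappa> j k < dim2 T"
    and H: "\<And>\<kappa> k i. \<kappa> < length abcs \<Longrightarrow> k < c \<kappa> \<Longrightarrow> i < a \<kappa> \<Longrightarrow> H \<kappa> k i < dim3 T"
    and nonneg: "\<And>\<kappa> \<kappa>' \<kappa>'' i j j' k k' i'. \<kappa> < length abcs \<Longrightarrow> \<kappa>' < length abcs \<Longrightarrow> \<kappa>'' < length abcs \<Longrightarrow>
      i < a \<kappa> \<Longrightarrow> j < b \<kappa> \<Longrightarrow> j' < b \<kappa>' \<Longrightarrow> k < c \<kappa>' \<Longrightarrow> k' < c \<kappa>'' \<Longrightarrow> i' < a \<kappa>'' \<Longrightarrow>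
      entry T (F \<kappa> i j) (G \<kappa>' j' k) (H \<kappa>'' k' i') \<noteq> 0 \<Longrightarrow>
      w1 \<kappa> + w2 \<kappa>' + w3 \<kappa>'' \<ge> 0 \<and> (w1 \<kappa> + w2 \<kappa>' + w3 \<kappa>'' = 0 \<longrightarrow> \<kappa> = \<kappa>' \<and> \<kappa> = \<kappa>'')"
    and diag: "\<And>\<kappa> i j j' k k' i'. \<kappa> < length abcs \<Longrightarrow>
      i < a \<kappa> \<Longrightarrow> j < b \<kappa> \<Longrightarrow> j' < b \<kappa> \<Longrightarrow> k < c \<kappa> \<Longrightarrow> k' < c \<kappa> \<Longrightarrow> i' < a \<kappa> \<Longrightarrow>
      w1 \<kappa> + w2 \<kappa> + w3 \<kappa> = 0 \<and>
      entry T (F \<kappa> i j) (G \<kappa> j' k) (H \<kappa> k' i') = of_bool (i = i' \<and> j = j' \<and> k = k')"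
  shows "T \<unrhd> matmuls abcs"
proof -
  define Ts where "Ts = map (\<lambda>(a, b, c). matmul a b c) abcs"
  have Ts: "Ts ! \<kappa> = matmul (a \<kappa>) (b \<kappa>) (c \<kappa>)" if "\<kappa> < length abcs" for \<kappa>
    using that dims by (simp add: Ts_def)
  have len: "length Ts = length abcs" by (simp add: Ts_def)
  define f where "f = (\<lambda>p. case locate dim1 Ts p of (\<kappa>, r) \<Rightarrow> F \<kappa> (r div b \<kappa>) (r mod b \<kappa>))"
  define g where "g = (\<lambda>p. case locate dim2 Ts p of (\<kappa>, r) \<Rightarrow> G \<kappa> (r div c \<kappa>) (r mod c \<kappa>))"
  define h where "h = (\<lambda>p. case locate dim3 Ts p of (\<kappa>, r) \<Rightarrow> H \<kappa> (r div a \<kappa>) (r mod a \<kappa>))"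
  have f: "f (offset dim1 Ts \<kappa> + (i * b \<kappa> + j)) = F \<kappa> i j" and w1: "fst (locate dim1 Ts (offset dim1 Ts \<kappa> + (i * b \<kappa> + j))) = \<kappa>"
    if "\<kappa> < length abcs" "i < a \<kappa>" "j < b \<kappa>" for \<kappa> i j
    using that Ts[of \<kappa>] by (simp_all add: f_def len locate_offset index_less)
  have g: "g (offset dim2 Ts \<kappa> + (i * c \<kappa> + j)) = G \<kappa> i j" and w2: "fst (locate dim2 Ts (offset dim2 Ts \<kappa> + (i * c \<kappa> + j))) = \<kappa>"
    if "\<kappa> < length abcs" "i < b \<kappa>" "j < c \<kappa>" for \<kappa> i j
    using that Ts[of \<kappa>] by (simp_all add: g_def len locate_offset index_less)
  have h: "h (offset dim3 Ts \<kappa> + (i * a \<kappa> + j)) = H \<kappa> i j" and w3: "fst (locate dim3 Ts (offset dim3 Ts \<kappa> + (i * a \<kappa> + j))) = \<kappa>"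
    if "\<kappa> < length abcs" "i < c \<kappa>" "j < a \<kappa>" for \<kappa> i j
    using that Ts[of \<kappa>] by (simp_all add: h_def len locate_offset index_less)
  have dec1: "\<exists>\<kappa> i j. \<kappa> < length abcs \<and> i < a \<kappa> \<and> j < b \<kappa> \<and> p = offset dim1 Ts \<kappa> + (i * b \<kappa> + j)"
    if "p < dim1 (direct_sum_list Ts)" for p
  proof -
    have "\<exists>\<kappa> p'. \<kappa> < length abcs \<and> p' < dim1 (Ts ! \<kappa>) \<and> p = offset dim1 Ts \<kappa> + p'"
      by (rule offset_obtain[of p dim1 Ts]) (use that len in \<open>auto simp: dims_direct_sum_list\<close>)
    then obtain \<kappa> p' where "\<kappa> < length abcs" "p' < dim1 (Ts ! \<kappa>)" "p = offset dim1 Ts \<kappa> + p'"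
      by blast
    then show ?thesis using index_obtain[of p' "a \<kappa>" "b \<kappa>"] Ts[of \<kappa>] by (metis dims_matmul(1))
  qed
  have dec2: "\<exists>\<kappa> i j. \<kappa> < length abcs \<and> i < b \<kappa> \<and> j < c \<kappa> \<and> p = offset dim2 Ts \<kappa> + (i * c \<kappa> + j)"
    if "p < dim2 (direct_sum_list Ts)" for p
  proof -
    have "\<exists>\<kappa> p'. \<kappa> < length abcs \<and> p' < dim2 (Ts ! \<kappa>) \<and> p = offset dim2 Ts \<kappa> + p'"
      by (rule offset_obtain[of p dim2 Ts]) (use that len in \<open>auto simp: dims_direct_sum_list\<close>)
    then obtain \<kappa> p' where "\<kappa> < length abcs" "p' < dim2 (Ts ! \<kappa>)" "p = offset dim2 Ts \<kappa> + p'"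
      by blast
    then show ?thesis using index_obtain[of p' "b \<kappa>" "c \<kappa>"] Ts[of \<kappa>] by (metis dims_matmul(2))
  qed
  have dec3: "\<exists>\<kappa> i j. \<kappa> < length abcs \<and> i < c \<kappa> \<and> j < a \<kappa> \<and> p = offset dim3 Ts \<kappa> + (i * a \<kappa> + j)"
    if "p < dim3 (direct_sum_list Ts)" for p
  proof -
    have "\<exists>\<kappa> p'. \<kappa> < length abcs \<and> p' < dim3 (Ts ! \<kappa>) \<and> p = offset dim3 Ts \<kappa> + p'"
      by (rule offset_obtain[of p dim3 Ts]) (use that len in \<open>auto simp: dims_direct_sum_list\<close>)
    then obtain \<kappa> p' where "\<kappa> < length abcs" "p' < dim3 (Ts ! \<kappa>)" "p = offset dim3 Ts \<kappa> + p'"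
      by blast
    then show ?thesis using index_obtain[of p' "c \<kappa>" "a \<kappa>"] Ts[of \<kappa>] by (metis dims_matmul(3))
  qed
  have "T \<unrhd> direct_sum_list Ts"
  proof (rule degenerates_to_monomial[where f = f and g = g and h = h and ?w1.0 = "\<lambda>p. w1 (fst (locate dim1 Ts p))"
        and ?w2.0 = "\<lambda>p. w2 (fst (locate dim2 Ts p))" and ?w3.0 = "\<lambda>p. w3 (fst (locate dim3 Ts p))"])
    show "f p < dim1 T" if "p < dim1 (direct_sum_list Ts)" for p using dec1[OF that] f F by auto
    show "g p < dim2 T" if "p < dim2 (direct_sum_list Ts)" for p using dec2[OF that] g G by auto
    show "h p < dim3 T" if "p < dim3 (direct_sum_list Ts)" for p using dec3[OF that] h H by auto
  next
    fix p q r assume "p < dim1 (direct_sum_list Ts)" "q < dim2 (direct_sum_list Ts)" "r < dim3 (direct_sum_list Ts)"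
    then obtain \<kappa> i j \<kappa>' j' k \<kappa>'' k' i' where *:
      "\<kappa> < length abcs" "i < a \<kappa>" "j < b \<kappa>" "p = offset dim1 Ts \<kappa> + (i * b \<kappa> + j)"
      "\<kappa>' < length abcs" "j' < b \<kappa>'" "k < c \<kappa>'" "q = offset dim2 Ts \<kappa>' + (j' * c \<kappa>' + k)"
      "\<kappa>'' < length abcs" "k' < c \<kappa>''" "i' < a \<kappa>''" "r = offset dim3 Ts \<kappa>'' + (k' * a \<kappa>'' + i')"
      using dec1[of p] dec2[of q] dec3[of r] by blast
    then have fgh: "f p = F \<kappa> i j" "g q = G \<kappa>' j' k" "h r = H \<kappa>'' k' i'" "fst (locate dim1 Ts p) = \<kappa>"
      "fst (locate dim2 Ts q) = \<kappa>'" "fst (locate dim3 Ts r) = \<kappa>''"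
      using f g h w1 w2 w3 by simp_all
    let ?w = "w1 \<kappa> + w2 \<kappa>' + w3 \<kappa>''"
    note non = nonneg[OF *(1,5,9,2,3,6,7,10,11)]
    show "w1 (fst (locate dim1 Ts p)) + w2 (fst (locate dim2 Ts q)) + w3 (fst (locate dim3 Ts r)) \<ge> 0"
      if "entry T (f p) (g q) (h r) \<noteq> 0"
      using that non unfolding fgh by blast
    have "entry (direct_sum_list Ts) p q r =
        (if \<kappa> = \<kappa>' \<and> \<kappa> = \<kappa>'' then entry (Ts ! \<kappa>) (i * b \<kappa> + j) (j' * c \<kappa>' + k) (k' * a \<kappa>'' + i') else 0)"
      unfolding *(4) *(8) *(12) by (rule entry_direct_sum_list) (use * Ts len in \<open>simp_all add: index_less\<close>)
    also have "\<dots> = of_bool (\<kappa> = \<kappa>' \<and> \<kappa> = \<kappa>'' \<and> i = i' \<and> j = j' \<and> k = k')"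
      using * Ts by (auto simp: entry_matmul)
    also have "\<dots> = (if ?w = 0 then entry T (f p) (g q) (h r) else 0)"
    proof (cases "\<kappa> = \<kappa>' \<and> \<kappa> = \<kappa>''")
      case True
      then show ?thesis using diag[of \<kappa> i j j' k k' i'] * unfolding fgh by auto
    next
      case False
      then show ?thesis using non unfolding fgh by auto
    qed
    finally show "entry (direct_sum_list Ts) p q r = (if w1 (fst (locate dim1 Ts p)) + w2 (fst (locate dim2 Ts q)) +
        w3 (fst (locate dim3 Ts r)) = 0 then entry T (f p) (g q) (h r) else 0)"
      unfolding fgh .
  qed
  then show ?thesis by (simp add: Ts_def)
qed

section \<open>Extracting independent triples by hashing\<close>

lemma exists_ge_average:
  fixes f :: "'w \<Rightarrow> nat"
  assumes "finite W" "W \<noteq> {}" "c \<le> (\<Sum>w\<in>W. f w)"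
  shows "\<exists>w\<in>W. c \<le> card W * f w"
proof (rule ccontr)
  assume "\<not> ?thesis"
  then have "\<And>w. w \<in> W \<Longrightarrow> card W * f w < c" by auto
  then have "(\<Sum>w\<in>W. card W * f w) < (\<Sum>w\<in>W. c)" using assms by (intro sum_strict_mono) auto
  then have "card W * (\<Sum>w\<in>W. f w) < card W * c" by (simp add: sum_distrib_left)
  then show False using assms(3) by simp
qed

lemma exists_le_average:
  fixes f :: "'w \<Rightarrow> nat"
  assumes "finite W" "W \<noteq> {}" "(\<Sum>w\<in>W. f w) \<le> c"
  shows "\<exists>w\<in>W. card W * f w \<le> c"
proof (rule ccontr)
  assume "\<not> ?thesis"
  then have "\<And>w. w \<in> W \<Longrightarrow> c < card W * f w" by auto
  then have "(\<Sum>w\<in>W. c) < (\<Sum>w\<in>W. card W * f w)" using assms by (intro sum_strict_mono) auto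
  then have "card W * c < card W * (\<Sum>w\<in>W. f w)" by (simp add: sum_distrib_left)
  then show False using assms(3) by simp
qed

lemma sum_card_swap:
  assumes "finite A" "finite B"
  shows "(\<Sum>a\<in>A. card {b \<in> B. R a b}) = (\<Sum>b\<in>B. card {a \<in> A. R a b})"
proof -
  have "card {b \<in> B. R a b} = (\<Sum>b\<in>B. of_bool (R a b))" "card {a \<in> A. R a b} = (\<Sum>a\<in>A. of_bool (R a b))" for a b
    using assms by (simp_all add: Int_def)
  then show ?thesis using sum.swap[of "\<lambda>a b. of_bool (R a b) :: nat" B A] by (simp only:)
qed

text \<open>The differences of blocks have entries of absolute value at most \<open>2\<close>, which are units modulo
  any odd number, so no prime modulus is needed.\<close>

lemma card_hash_collisions:
  fixes d :: "'d \<Rightarrow> int" and M :: nat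
  assumes D: "finite D" "p \<in> D" "d p \<noteq> 0" "\<bar>d p\<bar> \<le> 2" and M: "odd M"
  shows "M * card {w \<in> D \<rightarrow>\<^sub>E {0..<int M}. int M dvd (\<Sum>p\<in>D. w p * d p)} \<le> M ^ card D"
proof -
  let ?W = "{w \<in> D \<rightarrow>\<^sub>E {0..<int M}. int M dvd (\<Sum>p\<in>D. w p * d p)}"
  let ?r = "\<lambda>w. restrict w (D - {p})"
  \<comment> \<open>The coefficient \<open>d p\<close> is a unit modulo \<open>M\<close>, so the
    congruence determines \<open>w p\<close> from the other values.\<close>
  have "inj_on ?r ?W"
  proof (rule inj_onI)
    fix w w' assume w: "w \<in> ?W" "w' \<in> ?W" and eq: "?r w = ?r w'"
    have eq': "w q = w' q" if "q \<in> D - {p}" for q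
      using fun_cong[OF eq, of q] that by auto
    have "(\<Sum>q\<in>D. w q * d q) - (\<Sum>q\<in>D. w' q * d q) = (w p - w' p) * d p"
      using D eq' by (simp add: sum.remove[of D p] algebra_simps)
    moreover have "int M dvd (\<Sum>q\<in>D. w q * d q) - (\<Sum>q\<in>D. w' q * d q)"
      using w by (intro dvd_diff) auto
    moreover have "coprime (int M) (d p)"
    proof -
      have "d p = 1 \<or> d p = -1 \<or> d p = 2 \<or> d p = -2" using D by linarith
      then show ?thesis using M by auto
    qed
    ultimately have "int M dvd w p - w' p" by (simp add: coprime_dvd_mult_left_iff)
    moreover have "\<bar>w p - w' p\<bar> < int M" using w D(2) by (fastforce simp: PiE_iff)
    ultimately have "w p = w' p" using dvd_imp_le_int[of "w p - w' p" "int M"] by fastforce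
    then show "w = w'" using w eq' by (intro PiE_ext[of w D "\<lambda>_. {0..<int M}" w']) auto
  qed
  moreover have "?r ` ?W \<subseteq> (D - {p}) \<rightarrow>\<^sub>E {0..<int M}" by (auto simp: PiE_iff split: if_splits)
  ultimately have "card ?W \<le> card ((D - {p}) \<rightarrow>\<^sub>E {0..<int M})"
    using D by (intro card_inj_on_le[of ?r]) (auto intro: finite_PiE)
  also have "\<dots> = M ^ (card D - 1)" using D by (simp add: card_PiE)
  finally have "M * card ?W \<le> M * M ^ (card D - 1)" by simp
  also have "\<dots> = M ^ card D" using D by (metis card_Suc_Diff1 power_Suc card_Diff_singleton)
  finally show ?thesis .
qed

text \<open>Strassen's degeneration of the polynomial multiplication tensor takes the place of a set free of
  arithmetic progressions: for hash values \<open>a, b\<close> and \<open>a + b\<close> one has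
  \<open>2 a^2 + 2 b^2 - (a + b)^2 = (a - b)^2\<close>. So it is enough that the triples with hash values
  \<open>a = b\<close> are independent of each other.\<close>

lemma exists_independent_triples:
  fixes X Y Z :: "'e \<Rightarrow> 'd \<Rightarrow> int"
  assumes fin: "finite S" "finite D"
    and sum2: "\<And>e p. e \<in> S \<Longrightarrow> p \<in> D \<Longrightarrow> X e p + Y e p + Z e p = 2"
    and range: "\<And>e p. e \<in> S \<Longrightarrow> p \<in> D \<Longrightarrow> X e p \<in> {0..2} \<and> Y e p \<in> {0..2} \<and> Z e p \<in> {0..2}"
    and inj: "\<And>e e'. e \<in> S \<Longrightarrow> e' \<in> S \<Longrightarrow> \<forall>p\<in>D. X e p = X e' p \<and> Y e p = Y e' p \<Longrightarrow> e = e'"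
    and deg: "\<And>e. e \<in> S \<Longrightarrow> card {e' \<in> S. \<forall>p\<in>D. X e' p = X e p} \<le> \<Delta>"
      "\<And>e. e \<in> S \<Longrightarrow> card {e' \<in> S. \<forall>p\<in>D. Y e' p = Y e p} \<le> \<Delta>"
      "\<And>e. e \<in> S \<Longrightarrow> card {e' \<in> S. \<forall>p\<in>D. Z e' p = Z e p} \<le> \<Delta>"
  shows "\<exists>S' a. S' \<subseteq> S \<and> card S \<le> 4 * (6 * \<Delta> + 1) * card S' \<and>
    (\<forall>e\<in>S. \<forall>e1\<in>S'. \<forall>e2\<in>S'. \<forall>e3\<in>S'.
      (\<forall>p\<in>D. X e p = X e1 p \<and> Y e p = Y e2 p \<and> Z e p = Z e3 p) \<longrightarrow>
      a e1 + a e2 = 2 * (a e3 :: int) \<and> (a e1 = a e2 \<longrightarrow> e = e1 \<and> e = e2 \<and> e = e3))"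
proof -
  \<comment> \<open>At most 3 \<open>\<Delta>\<close> elements share a coordinate with a given one,
    so \<open>h\<close> bounds the collision candidates per element. The modulus M = 2 h + 1 exceeds
    twice this number, hence on average fewer than half of the elements collide. Hash values are
    later restricted to 0..h, so that the sum of two of them is below \<open>M\<close> and
    congruences become equations.\<close>
  define h where "h = 3 * \<Delta>"
  define M where "M = 2 * h + 1"
  have M: "M = 6 * \<Delta> + 1" "odd M" by (auto simp: M_def h_def)
  define W where "W = (D \<rightarrow>\<^sub>E {0..<int M})"
  have W: "finite W" "W \<noteq> {}" "card W = M ^ card D"
    using fin \<open>odd M\<close> by (auto simp: W_def finite_PiE card_PiE PiE_eq_empty_iff odd_pos)
  define L where "L = (\<lambda>(w :: 'd \<Rightarrow> int) v. \<Sum>p\<in>D. w p * v p)"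
  define cX where "cX = (\<lambda>e e'. \<forall>p\<in>D. X e' p = X e p)"
  define cY where "cY = (\<lambda>e e'. \<forall>p\<in>D. Y e' p = Y e p)"
  define cZ where "cZ = (\<lambda>e e'. \<forall>p\<in>D. Z e' p = Z e p)"
  define Q where "Q = {(e, e') \<in> S \<times> S. e \<noteq> e' \<and> (cX e e' \<or> cY e e' \<or> cZ e e')}"
  \<comment> \<open>If the first coordinates agree, so do the first hash values, and the second
    coordinates are compared instead. In all other cases comparing the first ones is enough: if
    these agreed too, \<open>sum2\<close> or the shared coordinate would make the pair
    equal.\<close>
  define dif where "dif = (\<lambda>(e, e') p. if cX e e' then Y e p - Y e' p else X e p - X e' p)"
  have finQ: "finite Q" unfolding Q_def using fin by (auto intro: finite_subset[of _ "S \<times> S"])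
  have cardQ: "card Q \<le> card S * (3 * \<Delta>)"
  proof -
    have "Q \<subseteq> (SIGMA e:S. {e' \<in> S. cX e e'} \<union> {e' \<in> S. cY e e'} \<union> {e' \<in> S. cZ e e'})"
      by (auto simp: Q_def)
    then have "card Q \<le> card (SIGMA e:S. {e' \<in> S. cX e e'} \<union> {e' \<in> S. cY e e'} \<union> {e' \<in> S. cZ e e'})"
      using fin by (intro card_mono) auto
    also have "\<dots> = (\<Sum>e\<in>S. card ({e' \<in> S. cX e e'} \<union> {e' \<in> S. cY e e'} \<union> {e' \<in> S. cZ e e'}))"
      using fin by (intro card_SigmaI) auto
    also have "\<dots> \<le> (\<Sum>e\<in>S. 3 * \<Delta>)"
    proof (rule sum_mono)
      fix e assume e: "e \<in> S"
      have "card ({e' \<in> S. cX e e'} \<union> {e' \<in> S. cY e e'} \<union> {e' \<in> S. cZ e e'})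
        \<le> card {e' \<in> S. cX e e'} + card {e' \<in> S. cY e e'} + card {e' \<in> S. cZ e e'}"
        by (meson card_Un_le order_trans add_right_mono)
      then show "card ({e' \<in> S. cX e e'} \<union> {e' \<in> S. cY e e'} \<union> {e' \<in> S. cZ e e'}) \<le> 3 * \<Delta>"
        using deg[OF e] unfolding cX_def cY_def cZ_def by linarith
    qed
    finally show ?thesis by simp
  qed
  have coll: "M * card {w \<in> W. int M dvd L w (dif q)} \<le> M ^ card D" if "q \<in> Q" for q
  proof -
    obtain e e' where q: "q = (e, e')" by (cases q)
    have e: "e \<in> S" "e' \<in> S" "e \<noteq> e'" "cX e e' \<or> cY e e' \<or> cZ e e'" using that by (auto simp: Q_def q)
    have "\<exists>p\<in>D. dif q p \<noteq> 0"
    proof (rule ccontr)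
      assume no: "\<not> (\<exists>p\<in>D. dif q p \<noteq> 0)"
      have "\<forall>p\<in>D. X e p = X e' p \<and> Y e p = Y e' p"
      proof (cases "cX e e'")
        case True
        then show ?thesis using no by (auto simp: q dif_def cX_def)
      next
        case False
        then have XX: "\<forall>p\<in>D. X e p = X e' p" using no by (auto simp: q dif_def)
        show ?thesis
        proof (cases "cY e e'")
          case False
          then have "cZ e e'" using e \<open>\<not> cX e e'\<close> by simp
          then have "Y e p = Y e' p" if "p \<in> D" for p
            using that XX sum2[OF e(1) that] sum2[OF e(2) that] by (auto simp: cZ_def)
          then show ?thesis using XX by simp
        qed (use XX in \<open>auto simp: cY_def\<close>)
      qed
      then show False using inj e by blast
    qed
    then obtain p where p: "p \<in> D" "dif q p \<noteq> 0" by blast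
    have "\<bar>dif q p\<bar> \<le> 2" using range[OF e(1) p(1)] range[OF e(2) p(1)] by (auto simp: q dif_def)
    from card_hash_collisions[where D = D and p = p and d = "dif q" and M = M, OF fin(2) p this M(2)] show ?thesis by (simp add: W_def L_def)
  qed
  have "(\<Sum>w\<in>W. M * card {q \<in> Q. int M dvd L w (dif q)}) = (\<Sum>q\<in>Q. M * card {w \<in> W. int M dvd L w (dif q)})"
    using sum_card_swap[OF W(1) finQ, of "\<lambda>w q. int M dvd L w (dif q)"] by (simp add: sum_distrib_left[symmetric])
  also have "\<dots> \<le> (\<Sum>q\<in>Q. M ^ card D)" by (intro sum_mono coll)
  also have "\<dots> = card W * card Q" by (simp add: W(3))
  finally obtain w where w: "w \<in> W" "card W * (M * card {q \<in> Q. int M dvd L w (dif q)}) \<le> card W * card Q"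
    using exists_le_average[OF W(1,2)] by blast
  define B where "B = {q \<in> Q. int M dvd L w (dif q)}"
  have "card W > 0" unfolding card_gt_0_iff using W(1,2) by blast
  then have "M * card B \<le> card Q" using w(2) by (simp add: B_def)
  then have "M * (2 * card B) \<le> M * card S"
    using cardQ by (simp add: M_def h_def algebra_simps)
  then have B2: "2 * card B \<le> card S" by (rule mult_left_le_imp_le) (simp add: M_def)
  \<comment> \<open>Deleting the first member of each colliding ordered pair leaves elements without
    collisions in all of \<open>S\<close>, not merely among themselves; at least half of
    \<open>S\<close> survives.\<close>
  define S1 where "S1 = S - fst ` B"
  have S1: "card S \<le> 2 * card S1"
  proof -
    have "card (fst ` B) \<le> card B" using finQ by (intro card_image_le) (auto simp: B_def)
    moreover have "card S - card (fst ` B) \<le> card S1" unfolding S1_def by (rule diff_card_le_card_Diff) (use finQ in \<open>auto simp: B_def\<close>)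
    ultimately show ?thesis using B2 by linarith
  qed
  define R where "R = {0..<int M} \<times> {0..<int M}"
  define hx where "hx = (\<lambda>w0 e. (L w (X e) + w0) mod int M)"
  define hy where "hy = (\<lambda>w1 e. (L w (Y e) + w1) mod int M)"
  \<comment> \<open>The linear part \<open>w\<close> is now fixed and only the shifts vary. For each
    value in 0..h exactly one pair of shifts gives \<open>e\<close> this value as both hashes, so
    \<open>e\<close> is good for at least h + 1 of the M^2 shifts.\<close>
  define good where "good = (\<lambda>(w0, w1) e. hx w0 e = hy w1 e \<and> hx w0 e \<le> int h)"
  have finS1: "finite S1" and finR: "finite R" and neR: "R \<noteq> {}" and cardR: "card R = M * M"
    using fin \<open>odd M\<close> by (auto simp: S1_def R_def card_cartesian_product odd_pos)
  have "(\<Sum>r\<in>R. card {e \<in> S1. good r e}) = (\<Sum>e\<in>S1. card {r \<in> R. good r e})"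
    by (rule sum_card_swap[OF finR finS1])
  moreover have "h + 1 \<le> card {r \<in> R. good r e}" for e
  proof -
    let ?f = "\<lambda>a. ((a - L w (X e)) mod int M, (a - L w (Y e)) mod int M)"
    have inj: "inj_on ?f {0..int h}"
    proof (rule inj_onI)
      fix a b assume ab: "a \<in> {0..int h}" "b \<in> {0..int h}" "?f a = ?f b"
      then have "int M dvd (a - L w (X e)) - (b - L w (X e))" by (simp add: mod_eq_dvd_iff)
      then have "int M dvd a - b" by simp
      moreover have "\<bar>a - b\<bar> < int M" using ab by (auto simp: M_def)
      ultimately show "a = b" using dvd_imp_le_int[of "a - b" "int M"] by fastforce
    qed
    have sub: "?f ` {0..int h} \<subseteq> {r \<in> R. good r e}"
    proof
      fix r assume "r \<in> ?f ` {0..int h}"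
      then obtain a where a: "0 \<le> a" "a \<le> int h" "r = ?f a" by auto
      have "hx (fst r) e = a mod int M" "hy (snd r) e = a mod int M"
        unfolding hx_def hy_def a by (simp_all add: mod_add_right_eq)
      moreover have "a mod int M = a" using a by (auto simp: M_def)
      ultimately show "r \<in> {r \<in> R. good r e}" using a by (auto simp: R_def good_def M_def)
    qed
    have "card {0..int h} \<le> card {r \<in> R. good r e}"
      using inj sub finR by (intro card_inj_on_le) auto
    then show ?thesis by simp
  qed
  ultimately have "card S1 * (h + 1) \<le> (\<Sum>r\<in>R. card {e \<in> S1. good r e})"
    using sum_mono[of S1 "\<lambda>_. h + 1" "\<lambda>e. card {r \<in> R. good r e}"] by simp
  from exists_ge_average[OF finR neR this] obtain r where r: "r \<in> R" "card S1 * (h + 1) \<le> card R * card {e \<in> S1. good r e}"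
    by blast
  obtain w0 w1 where w01: "r = (w0, w1)" by (cases r)
  define S' where "S' = {e \<in> S1. good r e}"
  define a where "a = hx w0"
  \<comment> \<open>The final 4 is the factor 2 lost by the deletion times the 2 in M <= 2 (h +
    1).\<close>
  have "card S * M \<le> 2 * card S1 * (2 * (h + 1))"
    using S1 by (intro mult_le_mono) (auto simp: M_def)
  also have "\<dots> = 4 * (card S1 * (h + 1))" by simp
  also have "\<dots> \<le> 4 * (M * M * card S')" using r(2) unfolding cardR S'_def[symmetric] by (rule mult_le_mono2)
  finally have "M * card S \<le> M * (4 * M * card S')" by (simp add: mult_ac)
  then have "card S \<le> 4 * M * card S'" by (rule mult_left_le_imp_le) (simp add: M_def)
  then have size: "card S \<le> 4 * (6 * \<Delta> + 1) * card S'" unfolding M(1) .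
  have S'S: "S' \<subseteq> S" by (auto simp: S'_def S1_def)
  have aS: "hx w0 e = a e" "hy w1 e = a e" "0 \<le> a e" "2 * a e < int M" if "e \<in> S'" for e
  proof -
    have "0 \<le> hx w0 e" unfolding hx_def by (rule pos_mod_sign) (simp add: M_def)
    then show "hx w0 e = a e" "hy w1 e = a e" "0 \<le> a e" "2 * a e < int M"
      using that by (auto simp: S'_def good_def w01 a_def M_def)
  qed
  have Lcong: "L w v = L w v'" if "\<forall>p\<in>D. v p = v' p" for v v'
    unfolding L_def using that by (intro sum.cong) auto
  \<comment> \<open>The sum of the first two hashes depends on the third coordinate only. This links
    the three hash values of a compatible triple.\<close>
  have Ladd: "L w (X e) + L w (Y e) = L w (\<lambda>p. 2 - Z e p)" if "e \<in> S" for e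
  proof -
    have "L w (X e) + L w (Y e) = L w (\<lambda>p. X e p + Y e p)"
      by (simp add: L_def sum.distrib distrib_left)
    also have "\<dots> = L w (\<lambda>p. 2 - Z e p)"
      by (rule Lcong) (use sum2[OF that] in \<open>auto simp: algebra_simps\<close>)
    finally show ?thesis .
  qed
  have modeq: "x = y" if "x mod int M = y mod int M" "0 \<le> x" "x < int M" "0 \<le> y" "y < int M" for x y
    using that by simp
  have no_coll: "e = e'" if "e \<in> S'" "e' \<in> S" "cX e e' \<or> cY e e' \<or> cZ e e'" "int M dvd L w (dif (e, e'))" for e e'
  proof (rule ccontr)
    assume "e \<noteq> e'"
    then have "(e, e') \<in> B" using that S'S by (auto simp: B_def Q_def)
    then show False using that(1) by (force simp: S'_def S1_def)
  qed
  have Ldif: "L w (\<lambda>p. v p - v' p) = L w v - L w v'" for v v'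
    by (simp add: L_def sum_subtractf right_diff_distrib)
  have Ldif': "L w (dif (e, e')) = (if cX e e' then L w (Y e) - L w (Y e') else L w (X e) - L w (X e'))" for e e'
    by (cases "cX e e'") (simp_all add: dif_def Ldif)
  have dvdX: "int M dvd L w (X e) - L w (X e')" if "hx w0 e = hx w0 e'" for e e'
    using that by (simp add: hx_def mod_eq_dvd_iff)
  have dvdY: "int M dvd L w (Y e) - L w (Y e')" if "hy w1 e = hy w1 e'" for e e'
    using that by (simp add: hy_def mod_eq_dvd_iff)
  have "a e1 + a e2 = 2 * a e3 \<and> (a e1 = a e2 \<longrightarrow> e = e1 \<and> e = e2 \<and> e = e3)"
    if e: "e \<in> S" "e1 \<in> S'" "e2 \<in> S'" "e3 \<in> S'" and eq: "\<forall>p\<in>D. X e p = X e1 p \<and> Y e p = Y e2 p \<and> Z e p = Z e3 p" for e e1 e2 e3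
  proof -
    have x: "hx w0 e = a e1" and y: "hy w1 e = a e2"
      using aS[OF e(2)] aS[OF e(3)] Lcong[of "X e" "X e1"] Lcong[of "Y e" "Y e2"] eq by (auto simp: hx_def hy_def)
    have hsum: "(hx w0 e + hy w1 e) mod int M = (L w (X e) + L w (Y e) + (w0 + w1)) mod int M" for e
      unfolding hx_def hy_def by (simp add: mod_add_eq algebra_simps)
    have "L w (\<lambda>p. 2 - Z e p) = L w (\<lambda>p. 2 - Z e3 p)" using eq by (intro Lcong) auto
    then have "L w (X e) + L w (Y e) = L w (X e3) + L w (Y e3)" using Ladd[OF e(1)] Ladd[of e3] S'S e by auto
    moreover have "(a e1 + a e2) mod int M = (L w (X e) + L w (Y e) + (w0 + w1)) mod int M"
      using hsum[of e] unfolding x y .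
    moreover have "(a e3 + a e3) mod int M = (L w (X e3) + L w (Y e3) + (w0 + w1)) mod int M"
      using hsum[of e3] unfolding aS(1,2)[OF e(4)] .
    ultimately have "(a e1 + a e2) mod int M = (2 * a e3) mod int M"
      by (simp only: mult_2)
    then have sum: "a e1 + a e2 = 2 * a e3"
    proof (rule modeq)
      show "0 \<le> a e1 + a e2" "0 \<le> 2 * a e3" "a e1 + a e2 < int M" "2 * a e3 < int M"
        using aS(3,4)[OF e(2)] aS(3,4)[OF e(3)] aS(3,4)[OF e(4)] by linarith+
    qed
    moreover have "e = e1 \<and> e = e2 \<and> e = e3" if same: "a e1 = a e2"
    proof -
      \<comment> \<open>Each of \<open>e1\<close>, \<open>e2\<close>, \<open>e3\<close> shares a
        coordinate with \<open>e\<close> and has the same hash values as \<open>e\<close>, so any of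
        them different from \<open>e\<close> would have been deleted.\<close>
      have a3: "a e3 = a e1" using sum same by simp
      have cx: "cX e1 e" and cy: "cY e2 e" and cz: "cZ e3 e" using eq by (auto simp: cX_def cY_def cZ_def)
      have "int M dvd L w (dif (e1, e))"
        using cx dvdY[of e1 e] y aS[OF e(2)] same by (simp add: Ldif')
      then have 1: "e1 = e" using no_coll[OF e(2,1)] cx by blast
      have "int M dvd L w (dif (e2, e))"
        using dvdX[of e2 e] dvdY[of e2 e] x y aS[OF e(3)] same by (simp add: Ldif')
      then have 2: "e2 = e" using no_coll[OF e(3,1)] cy by blast
      have "int M dvd L w (dif (e3, e))"
        using dvdX[of e3 e] dvdY[of e3 e] x y aS[OF e(4)] same a3 by (simp add: Ldif')
      then have 3: "e3 = e" using no_coll[OF e(4,1)] cz by blast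
      show ?thesis using 1 2 3 by simp
    qed
    ultimately show ?thesis by blast
  qed
  then show ?thesis
    by (intro exI[of _ S'] exI[of _ a]) (use S'S size in blast)
qed

section \<open>Type classes\<close>

text \<open>Permuting positions carries the fibre over one arrangement of the image multiset onto
  the fibre over any other, so all fibres have equal size.\<close>

lemma card_fibre:
  assumes l0: "l0 \<in> permutations_of_multiset M"
  shows "card {l \<in> permutations_of_multiset M. map f l = map f l0} * card (permutations_of_multiset (image_mset f M))
    = card (permutations_of_multiset M)"
proof -
  let ?P = "permutations_of_multiset M" and ?Q = "permutations_of_multiset (image_mset f M)"
  let ?fib = "\<lambda>v. {l \<in> ?P. map f l = v}"
  have le: "card (?fib v) \<le> card (?fib v')" if "v \<in> ?Q" "v' \<in> ?Q" for v v'
  proof -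
    have "mset v' = mset v" using that by (simp add: permutations_of_multiset_def)
    then obtain p where p: "p permutes {..<length v}" "permute_list p v = v'"
      by (rule mset_eq_permutation)
    have len: "length l = length v" if "l \<in> ?fib v" for l using that by auto
    have "inj_on (permute_list p) (?fib v)"
    proof (rule inj_onI)
      fix l l' assume l: "l \<in> ?fib v" "l' \<in> ?fib v" "permute_list p l = permute_list p l'"
      show "l = l'"
      proof (rule nth_equalityI)
        show "length l = length l'" using len l by simp
        fix i assume i: "i < length l"
        then obtain j where j: "j < length l" "p j = i"
          using p(1) len[OF l(1)] permutes_image[OF p(1)] by (metis imageE lessThan_iff)
        have "permute_list p l ! j = permute_list p l' ! j" using l(3) by simp
        then show "l ! i = l' ! i"
          using j p(1) len[OF l(1)] len[OF l(2)] by (simp add: permute_list_nth)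
      qed
    qed
    moreover have "permute_list p ` ?fib v \<subseteq> ?fib v'"
    proof
      fix x assume "x \<in> permute_list p ` ?fib v"
      then obtain l where l: "l \<in> ?fib v" "x = permute_list p l" by blast
      have pl: "p permutes {..<length l}" using p(1) len[OF l(1)] by simp
      have "mset x = M" using l mset_permute_list[OF pl] by (simp add: permutations_of_multiset_def)
      moreover have "map f x = permute_list p (map f l)" using l permute_list_map[OF pl, of f] by simp
      then have "map f x = v'" using l(1) p(2) by simp
      ultimately show "x \<in> ?fib v'" by (simp add: permutations_of_multiset_def)
    qed
    ultimately show ?thesis by (intro card_inj_on_le) auto
  qed
  have Q0: "map f l0 \<in> ?Q" using l0 by (auto simp: permutations_of_multiset_def)
  have "card ?P = (\<Sum>v\<in>?Q. card (?fib v))"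
  proof -
    have "(\<Sum>v\<in>?Q. \<Sum>l\<in>?fib v. 1) = (\<Sum>l\<in>?P. 1 :: nat)"
      by (rule sum.group, simp, simp, auto simp: permutations_of_multiset_def)
    then show ?thesis by simp
  qed
  also have "\<dots> = (\<Sum>v\<in>?Q. card (?fib (map f l0)))"
    by (intro sum.cong refl antisym le Q0)
  finally show ?thesis by (simp add: mult.commute)
qed

text \<open>The value 2 in a coordinate occurs in a single element of \<open>Phi\<close>, which
  fixes three counts. The value 1 in a coordinate gives the pairwise sums of the other three counts,
  and pairwise sums determine the summands.\<close>

lemma multiset_Phi_eqI_fst_snd:
  assumes sub: "set_mset M \<subseteq> Phi" "set_mset M' \<subseteq> Phi"
    and "image_mset fst M = image_mset fst M'" "image_mset (fst \<circ> snd) M = image_mset (fst \<circ> snd) M'"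
      "image_mset (snd \<circ> snd) M = image_mset (snd \<circ> snd) M'"
  shows "M = M'"
proof -
  have fin: "finite Phi" by (simp add: Phi_def)
  have cnt: "count (image_mset f M) y = (\<Sum>x\<in>Phi. if f x = y then count M x else 0)"
    if "set_mset M \<subseteq> Phi" for M and f :: "_ \<Rightarrow> nat" and y
  proof -
    have "count (image_mset f M) y = (\<Sum>x\<in>f -` {y} \<inter> set_mset M. count M x)" by (rule count_image_mset)
    also have "\<dots> = (\<Sum>x\<in>Phi. if f x = y then count M x else 0)"
      using that fin by (intro sum.mono_neutral_cong_left) (auto simp: not_in_iff[symmetric] split: if_splits)
    finally show ?thesis .
  qed
  have eq: "(\<Sum>x\<in>Phi. if f x = y then count M x else 0) = (\<Sum>x\<in>Phi. if f x = y then count M' x else 0)"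
    if "image_mset f M = image_mset f M'" for f :: "_ \<Rightarrow> nat" and y
    using cnt[OF sub(1), of f y] cnt[OF sub(2), of f y] that by simp
  have "count M x = count M' x" if "x \<in> Phi" for x
    using that eq[OF assms(3), of 1] eq[OF assms(3), of 2] eq[OF assms(4), of 1] eq[OF assms(4), of 2] eq[OF assms(5), of 1]
      eq[OF assms(5), of 2]
    by (auto simp: Phi_def)
  moreover have "count M x = count M' x" if "x \<notin> Phi" for x
    using that sub by (metis count_inI subsetD)
  ultimately show ?thesis by (intro multiset_eqI) blast
qed

section \<open>The block structure of the structure tensor\<close>

text \<open>The three factors of a tensor are numbered \<open>0, 1, 2\<close>, and copy \<open>c\<close> of the symmetrization uses its
  \<open>x\<close>-, \<open>y\<close>- and \<open>z\<close>-index as the factors \<open>c\<close>, \<open>c + 1\<close> and \<open>c + 2\<close> modulo \<open>3\<close> of the original tensor.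
  The grading takes the value \<open>0\<close> on \<open>1\<close>, \<open>1\<close> on the \<open>a_i\<close> with \<open>i \<le> 3 m\<close>, and \<open>2\<close> on the last two
  basis elements; it is reversed in the third factor.\<close>

definition proj :: "nat \<Rightarrow> nat \<times> nat \<times> nat \<Rightarrow> nat" where
  "proj a \<phi> = (if a = 0 then fst \<phi> else if a = 1 then fst (snd \<phi>) else snd (snd \<phi>))"

definition unrotate :: "nat \<Rightarrow> nat \<Rightarrow> nat \<Rightarrow> nat \<Rightarrow> nat \<times> nat \<times> nat" where
  "unrotate c x y z = (if c = 0 then (x, y, z) else if c = 1 then (z, x, y) else (y, z, x))"

definition rotated_entry :: "nat \<Rightarrow> nat \<Rightarrow> nat \<Rightarrow> nat \<Rightarrow> nat \<Rightarrow> complex" where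
  "rotated_entry m c x y z = (case unrotate c x y z of (i, j, k) \<Rightarrow> entry (T_A m) i j k)"

definition grade :: "nat \<Rightarrow> nat \<Rightarrow> nat \<Rightarrow> nat" where
  "grade m a x = (let d = (if x = 0 then 0 else if x \<le> 3*m then 1 else 2) in if a = 2 then 2 - d else d)"

lemma less3_cases: "c < 3 \<Longrightarrow> c = 0 \<or> c = 1 \<or> c = (2 :: nat)" by linarith

lemma proj_unrotate:
  assumes "c < 3"
  shows "proj c (unrotate c x y z) = x" "proj ((c+1) mod 3) (unrotate c x y z) = y" "proj ((c+2) mod 3) (unrotate c x y z) = z"
  using less3_cases[OF assms] by (auto simp: proj_def unrotate_def)

text \<open>Multiplication adds degrees. As the grade is reversed in the third factor, the three
  grades of a nonzero entry add up to 2, and \<open>Phi\<close> contains all such triples.\<close>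

lemma entry_T_A_grades:
  assumes "1 \<le> m" "entry (T_A m) i j k \<noteq> 0"
  shows "(grade m 0 i, grade m 1 j, grade m 2 k) \<in> Phi"
proof -
  have *: "i < 3*m+3" "j < 3*m+3" "k < 3*m+3" "str_rel m i j k"
    using assms by (auto simp: entry_T_A split: if_splits)
  then consider "i = 0" "j = k" | "j = 0" "i = k" |
    l where "k = 3*m+1" "l \<in> {1..m}" "i = l \<and> j = m+l \<or> i = m+l \<and> j = l" |
    l where "k = 3*m+2" "l \<in> {1..m}" "i = l \<and> j = 2*m+l \<or> i = 2*m+l \<and> j = l"
    unfolding str_rel_def by blast
  then show ?thesis
    by cases (use * in \<open>auto simp: grade_def Let_def Phi_def\<close>)
qed

lemma rotated_entry_grades:
  assumes "1 \<le> m" "c < 3" "rotated_entry m c x y z \<noteq> 0"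
  shows "unrotate c (grade m c x) (grade m ((c+1) mod 3) y) (grade m ((c+2) mod 3) z) \<in> Phi"
  using less3_cases[OF assms(2)] assms(3) entry_T_A_grades[OF assms(1), of x y z]
    entry_T_A_grades[OF assms(1), of z x y] entry_T_A_grades[OF assms(1), of y z x]
  by (elim disjE) (simp_all add: rotated_entry_def unrotate_def numeral_2_eq_2)

text \<open>Each component is a matrix multiplication tensor, except that the component \<open>(1, 1, 0)\<close> is a sum of
  \<open>M_(1, m, 2)\<close> and \<open>M_(2, m, 1)\<close> with a common third factor; the label \<open>s\<close> selects the summand.\<close>

definition block_dim :: "nat \<Rightarrow> nat \<times> nat \<times> nat \<Rightarrow> bool \<Rightarrow> nat \<Rightarrow> nat" where
  "block_dim m \<phi> s d =
    (if \<phi> = (1,1,0) then (if d = 0 then (if s then 2 else 1) else if d = 1 then m else (if s then 1 else 2))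
     else if \<phi> = (2,0,0) then (if d = 0 then 2 else 1)
     else if \<phi> = (0,2,0) then (if d = 2 then 2 else 1)
     else if \<phi> = (1,0,1) then (if d = 0 then 3*m else 1)
     else if \<phi> = (0,1,1) then (if d = 2 then 3*m else 1)
     else 1)"

text \<open>Here \<open>a\<close> is a factor of the structure tensor and \<open>i\<close>,
  \<open>j\<close> are the two matrix indices. For (1,1,0) with label true, the first factor runs
  through \<open>a_(m+1), ..., a_(3m)\<close> as a 2 by m matrix and the second through
  \<open>a_1, ..., a_m\<close>; with label false the two factors exchange these roles. The third
  factor takes the values \<open>a_(3m+1)\<close>, \<open>a_(3m+2)\<close> under both
  labels.\<close>

definition block_index :: "nat \<Rightarrow> nat \<Rightarrow> nat \<times> nat \<times> nat \<Rightarrow> bool \<Rightarrow> nat \<Rightarrow> nat \<Rightarrow> nat" where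
  "block_index m a \<phi> s i j =
    (if \<phi> = (1,1,0) then
       (if a = 0 then (if s then (if i = 0 then m+1+j else 2*m+1+j) else 1+j)
        else if a = 1 then (if s then 1+i else if j = 0 then m+1+i else 2*m+1+i)
        else if s then 3*m+1+j else 3*m+1+i)
     else if \<phi> = (2,0,0) then (if a = 0 then 3*m+1+i else if a = 1 then 0 else 3*m+1+j)
     else if \<phi> = (0,2,0) then (if a = 0 then 0 else if a = 1 then 3*m+1+j else 3*m+1+i)
     else if \<phi> = (1,0,1) then (if a = 0 then 1+i else if a = 1 then 0 else 1+j)
     else if \<phi> = (0,1,1) then (if a = 0 then 0 else if a = 1 then 1+j else 1+i)
     else 0)"

text \<open>For (1,1,0) this is the volume of one summand, the same for both labels; the number of
  summands is accounted for by the labels.\<close>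

definition block_vol :: "nat \<Rightarrow> nat \<times> nat \<times> nat \<Rightarrow> nat" where
  "block_vol m \<phi> = (if \<phi> = (1,1,0) then 2*m else if \<phi> = (2,0,0) \<or> \<phi> = (0,2,0) then 2
     else if \<phi> = (1,0,1) \<or> \<phi> = (0,1,1) then 3*m else 1)"

lemma block_dim_pos: "1 \<le> m \<Longrightarrow> 0 < block_dim m \<phi> s d"
  by (auto simp: block_dim_def)

lemma block_dim_prod: "c < 3 \<Longrightarrow> block_dim m \<phi> s c * block_dim m \<phi> s ((c+1) mod 3) * block_dim m \<phi> s ((c+2) mod 3) = block_vol m \<phi>"
  using less3_cases[of c] by (auto simp: block_dim_def block_vol_def)

lemma Phi_cases:
  assumes "\<phi> \<in> Phi"
  obtains "\<phi> = (0,0,2)" | "\<phi> = (0,2,0)" | "\<phi> = (2,0,0)" | "\<phi> = (1,1,0)" | "\<phi> = (1,0,1)" | "\<phi> = (0,1,1)"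
  using assms by (auto simp: Phi_def)

lemma block_index_less:
  assumes "1 \<le> m" "a < 3" "i < block_dim m \<phi> s a" "j < block_dim m \<phi> s ((a+1) mod 3)"
  shows "block_index m a \<phi> s i j < 3*m+3"
  using less3_cases[OF assms(2)] assms(1,3,4)
  by (elim disjE; hypsubst) (auto simp: block_index_def block_dim_def split: if_splits)

lemma grade_block_index:
  assumes "1 \<le> m" "a < 3" "\<phi> \<in> Phi" "i < block_dim m \<phi> s a" "j < block_dim m \<phi> s ((a+1) mod 3)"
  shows "grade m a (block_index m a \<phi> s i j) = proj a \<phi>"
  using assms(3)
  by (cases rule: Phi_cases)
    (use less3_cases[OF assms(2)] assms in \<open>auto simp: block_index_def block_dim_def grade_def proj_def split: if_splits\<close>)

lemma str_rel_block_index: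
  assumes "1 \<le> m" "\<phi> \<in> Phi" "i < block_dim m \<phi> s 0" "j < block_dim m \<phi> s 1" "j' < block_dim m \<phi> s 1" "k < block_dim m \<phi> s 2"
    "k' < block_dim m \<phi> s 2" "i' < block_dim m \<phi> s 0"
  shows "str_rel m (block_index m 0 \<phi> s i j) (block_index m 1 \<phi> s j' k) (block_index m 2 \<phi> s k' i') \<longleftrightarrow> i = i' \<and> j = j' \<and> k = k'"
  using assms(2)
proof (cases rule: Phi_cases)
  case 4
  have two: "x = 0 \<or> x = 1" if "x < 2" for x :: nat using that by linarith
  show ?thesis
  proof (cases s)
    case True
    then show ?thesis
      using 4 assms two[of i] two[of i'] by (auto simp: block_index_def block_dim_def str_rel_def)
  next
    case False
    then show ?thesis
      using 4 assms two[of k] two[of k'] by (auto simp: block_index_def block_dim_def str_rel_def)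
  qed
qed (use assms in \<open>auto simp: block_index_def block_dim_def str_rel_def\<close>)

lemma rotated_entry_block_index:
  assumes m: "1 \<le> m" and \<phi>: "\<phi> \<in> Phi" and c: "c < 3"
    and "i < block_dim m \<phi> s c" "i' < block_dim m \<phi> s c" "j < block_dim m \<phi> s ((c+1) mod 3)" "j' < block_dim m \<phi> s ((c+1) mod 3)"
      "k < block_dim m \<phi> s ((c+2) mod 3)" "k' < block_dim m \<phi> s ((c+2) mod 3)"
  shows "rotated_entry m c (block_index m c \<phi> s i j) (block_index m ((c+1) mod 3) \<phi> s j' k) (block_index m ((c+2) mod 3) \<phi> s k' i')
    = of_bool (i = i' \<and> j = j' \<and> k = k')"
proof -
  have base: "entry (T_A m) (block_index m 0 \<phi> s i j) (block_index m 1 \<phi> s j' k) (block_index m 2 \<phi> s k' i') = of_bool (i = i' \<and> j = j' \<and> k = k')"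
    if "i < block_dim m \<phi> s 0" "j < block_dim m \<phi> s 1" "j' < block_dim m \<phi> s 1" "k < block_dim m \<phi> s 2"
    "k' < block_dim m \<phi> s 2" "i' < block_dim m \<phi> s 0" for i j j' k k' i'
  proof -
    have "block_index m 0 \<phi> s i j < 3*m+3" "block_index m 1 \<phi> s j' k < 3*m+3" "block_index m 2 \<phi> s k' i' < 3*m+3"
      by (rule block_index_less[OF m]; use that in \<open>simp add: numeral_2_eq_2\<close>)+
    then show ?thesis
      unfolding entry_T_A[OF m] str_rel_block_index[OF m \<phi> that] by simp
  qed
  consider "c = 0" | "c = 1" | "c = 2" using c by linarith
  then show ?thesis
  proof cases
    case 1
    have "entry (T_A m) (block_index m 0 \<phi> s i j) (block_index m 1 \<phi> s j' k) (block_index m 2 \<phi> s k' i') = of_bool (i = i' \<and> j = j' \<and> k = k')"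
      by (rule base) (use assms 1 in \<open>simp_all add: numeral_2_eq_2\<close>)
    then show ?thesis using 1 by (auto simp: rotated_entry_def unrotate_def numeral_2_eq_2)
  next
    case 2
    have "entry (T_A m) (block_index m 0 \<phi> s k' i') (block_index m 1 \<phi> s i j) (block_index m 2 \<phi> s j' k) = of_bool (k' = k \<and> i' = i \<and> j = j')"
      by (rule base) (use assms 2 in \<open>simp_all add: numeral_2_eq_2\<close>)
    then show ?thesis using 2 by (auto simp: rotated_entry_def unrotate_def numeral_2_eq_2)
  next
    case 3
    have "entry (T_A m) (block_index m 0 \<phi> s j' k) (block_index m 1 \<phi> s k' i') (block_index m 2 \<phi> s i j) = of_bool (j' = j \<and> k = k' \<and> i' = i)"
      by (rule base) (use assms 3 in \<open>simp_all add: numeral_2_eq_2\<close>)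
    then show ?thesis using 3 by (auto simp: rotated_entry_def unrotate_def numeral_2_eq_2)
  qed
qed

text \<open>With different labels both basis elements come from \<open>a_1, ..., a_m\<close>, or
  both from \<open>a_(m+1), ..., a_(3m)\<close>; such products vanish in the algebra.\<close>

lemma entry_label_mismatch:
  assumes m: "1 \<le> m" and ij: "s \<noteq> s'" "i < block_dim m (1,1,0) s 0" "j < block_dim m (1,1,0) s 1"
    "j' < block_dim m (1,1,0) s' 1" "k < block_dim m (1,1,0) s' 2"
  shows "entry (T_A m) (block_index m 0 (1,1,0) s i j) (block_index m 1 (1,1,0) s' j' k) l = 0"
proof -
  have "\<not> str_rel m (block_index m 0 (1,1,0) s i j) (block_index m 1 (1,1,0) s' j' k) l"
    using ij m by (cases s) (auto simp: block_index_def block_dim_def str_rel_def)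
  then show ?thesis using m by (simp add: entry_T_A)
qed

section \<open>Indexing Kronecker powers of the symmetrization\<close>

text \<open>Digits in base \<open>d\<close> with the most significant one first, as dictated by the
  order of factors in \<open>kron_power\<close>.\<close>

primrec encode :: "nat \<Rightarrow> nat \<Rightarrow> (nat \<Rightarrow> nat) \<Rightarrow> nat" where
  "encode d 0 x = 0"
| "encode d (Suc N) x = x 0 * d ^ N + encode d N (\<lambda>n. x (Suc n))"

lemma index_div_mod:
  fixes n :: nat
  assumes "j < n"
  shows "(i * n + j) div n = i" "(i * n + j) mod n = j"
  using assms by auto

lemma encode_less: "(\<And>n. n < N \<Longrightarrow> x n < d) \<Longrightarrow> encode d N x < d ^ N"
  by (induction N arbitrary: x) (auto intro!: index_less)

lemma entry_kron_power_encode: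
  assumes "\<And>n. n < N \<Longrightarrow> x n < dim1 T" "\<And>n. n < N \<Longrightarrow> y n < dim2 T" "\<And>n. n < N \<Longrightarrow> z n < dim3 T"
  shows "entry (kron_power T N) (encode (dim1 T) N x) (encode (dim2 T) N y) (encode (dim3 T) N z)
    = (\<Prod>n<N. entry T (x n) (y n) (z n))"
  using assms
proof (induction N arbitrary: x y z)
  case 0
  show ?case by (simp add: entry_def)
next
  case (Suc N)
  have e: "encode (dim1 T) N (\<lambda>n. x (Suc n)) < dim1 T ^ N" "encode (dim2 T) N (\<lambda>n. y (Suc n)) < dim2 T ^ N"
    "encode (dim3 T) N (\<lambda>n. z (Suc n)) < dim3 T ^ N"
    using Suc.prems by (auto intro!: encode_less)
  have lt: "x 0 < dim1 T" "y 0 < dim2 T" "z 0 < dim3 T" using Suc.prems by auto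
  show ?case
    unfolding kron_power.simps entry_kron encode.simps dims_kron_power prod.lessThan_Suc_shift
    using e lt index_less[OF lt(1) e(1)] index_less[OF lt(2) e(2)] index_less[OF lt(3) e(3)] Suc.IH[of "\<lambda>n. x (Suc n)" "\<lambda>n. y (Suc n)" "\<lambda>n. z (Suc n)"] Suc.prems
    by (simp add: index_div_mod)
qed

lemma entry_symmetrization:
  fixes x y z :: "nat \<Rightarrow> nat"
  assumes "dim1 T = d" "dim2 T = d" "dim3 T = d"
    and "\<And>c. c < 3 \<Longrightarrow> x c < d \<and> y c < d \<and> z c < d"
  shows "entry (symmetrization T) ((x 0 * d + x 1) * d + x 2) ((y 0 * d + y 1) * d + y 2) ((z 0 * d + z 1) * d + z 2)
    = entry T (x 0) (y 0) (z 0) * entry T (z 1) (x 1) (y 1) * entry T (y 2) (z 2) (x 2)"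
proof -
  have lt: "x 0 < d" "x 1 < d" "x 2 < d" "y 0 < d" "y 1 < d" "y 2 < d" "z 0 < d" "z 1 < d" "z 2 < d"
    using assms(4) by auto
  show ?thesis
    unfolding symmetrization_def entry_kron entry_cyclic_perm dims_simps assms(1-3)
    using lt by (simp add: index_less index_div_mod)
qed

definition encode3 :: "nat \<Rightarrow> nat \<Rightarrow> (nat \<Rightarrow> nat \<Rightarrow> nat) \<Rightarrow> nat" where
  "encode3 m N x = encode ((3*m+3)^3) N (\<lambda>n. (x 0 n * (3*m+3) + x 1 n) * (3*m+3) + x 2 n)"

lemma dims_symmetrization_T_A: "dim1 (symmetrization (T_A m)) = (3*m+3)^3"
  "dim2 (symmetrization (T_A m)) = (3*m+3)^3" "dim3 (symmetrization (T_A m)) = (3*m+3)^3"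
  by (simp_all add: symmetrization_def power3_eq_cube)

lemma digit3_less:
  fixes x :: "nat \<Rightarrow> nat"
  assumes "\<And>c. c < 3 \<Longrightarrow> x c < d"
  shows "(x 0 * d + x 1) * d + x 2 < d ^ 3"
  using index_less[OF index_less[of "x 0" d "x 1" d], of "x 2" d] assms[of 0] assms[of 1] assms[of 2]
  by (simp add: power3_eq_cube)

lemma encode3_less:
  assumes "\<And>c n. c < 3 \<Longrightarrow> n < N \<Longrightarrow> x c n < 3*m+3"
  shows "encode3 m N x < ((3*m+3)^3)^N"
  unfolding encode3_def by (intro encode_less digit3_less assms)

lemma entry_sym_power:
  assumes "\<And>c n. c < 3 \<Longrightarrow> n < N \<Longrightarrow> x c n < 3*m+3 \<and> y c n < 3*m+3 \<and> z c n < 3*m+3"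
  shows "entry (kron_power (symmetrization (T_A m)) N) (encode3 m N x) (encode3 m N y) (encode3 m N z)
    = (\<Prod>(c, n)\<in>{..<3} \<times> {..<N}. rotated_entry m c (x c n) (y c n) (z c n))"
proof -
  let ?D = "3*m+3"
  let ?d = "\<lambda>x n. (x 0 n * ?D + x 1 n) * ?D + x (2 :: nat) n"
  have "entry (kron_power (symmetrization (T_A m)) N) (encode3 m N x) (encode3 m N y) (encode3 m N z)
    = (\<Prod>n<N. entry (symmetrization (T_A m)) (?d x n) (?d y n) (?d z n))"
    using entry_kron_power_encode[of N "?d x" "symmetrization (T_A m)" "?d y" "?d z"] assms
      digit3_less[of "\<lambda>c. x c n" ?D for n] digit3_less[of "\<lambda>c. y c n" ?D for n] digit3_less[of "\<lambda>c. z c n" ?D for n]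
    unfolding encode3_def dims_symmetrization_T_A by simp
  also have "\<dots> = (\<Prod>n<N. \<Prod>c<3. rotated_entry m c (x c n) (y c n) (z c n))"
  proof (rule prod.cong[OF refl])
    fix n assume "n \<in> {..<N}"
    then have "entry (symmetrization (T_A m)) (?d x n) (?d y n) (?d z n)
      = entry (T_A m) (x 0 n) (y 0 n) (z 0 n) * entry (T_A m) (z 1 n) (x 1 n) (y 1 n) * entry (T_A m) (y 2 n) (z 2 n) (x 2 n)"
      using entry_symmetrization[of "T_A m" ?D "\<lambda>c. x c n" "\<lambda>c. y c n" "\<lambda>c. z c n"] assms by simp
    then show "entry (symmetrization (T_A m)) (?d x n) (?d y n) (?d z n) = (\<Prod>c<3. rotated_entry m c (x c n) (y c n) (z c n))"
      by (simp add: numeral_3_eq_3 rotated_entry_def unrotate_def numeral_2_eq_2)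
  qed
  also have "\<dots> = (\<Prod>(c, n)\<in>{..<3} \<times> {..<N}. rotated_entry m c (x c n) (y c n) (z c n))"
    by (subst prod.swap) (simp add: prod.cartesian_product)
  finally show ?thesis .
qed

text \<open>A pair with p + q < K extends uniquely to a label triple with sum K - 1, so at least
  half of K^2 triples are available.\<close>

lemma card_triangle: "K * K \<le> 2 * card {(p, q). p + q < (K :: nat)}"
proof -
  have "{(p, q). p + q < K} = (SIGMA p:{..<K}. {..<K - p})" by auto
  then have "card {(p, q). p + q < K} = (\<Sum>p<K. K - p)" by simp
  moreover have "2 * (\<Sum>p<K. K - p) = K * (K + 1)" for K :: nat
  proof (induction K)
    case (Suc K)
    have "(\<Sum>p<Suc K. Suc K - p) = (\<Sum>p<K. (K - p) + 1) + 1" by (simp add: Suc_diff_le)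
    also have "\<dots> = (\<Sum>p<K. K - p) + K + 1" by (simp only: sum.distrib) simp
    finally show ?case using Suc by simp
  qed simp
  ultimately show ?thesis by simp
qed

section \<open>The laser method\<close>

lemma proj_ext:
  assumes "c < 3" "proj c \<phi> = proj c \<psi>" "proj ((c+1) mod 3) \<phi> = proj ((c+1) mod 3) \<psi>" "proj ((c+2) mod 3) \<phi> = proj ((c+2) mod 3) \<psi>"
  shows "\<phi> = \<psi>"
proof -
  consider "c = 0" | "c = 1" | "c = 2" using assms(1) by linarith
  then show ?thesis using assms(2-) by cases (auto simp: proj_def prod_eq_iff)
qed

lemma proj_sum_Phi:
  assumes "c < 3" "\<phi> \<in> Phi"
  shows "proj c \<phi> + proj ((c+1) mod 3) \<phi> + proj ((c+2) mod 3) \<phi> = 2"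
proof -
  consider "c = 0" | "c = 1" | "c = 2" using assms(1) by linarith
  then show ?thesis using assms(2) by cases (auto simp: proj_def Phi_def)
qed

lemma multiset_Phi_eqI:
  assumes "set_mset M \<subseteq> Phi" "set_mset M' \<subseteq> Phi" "c < 3"
    "image_mset (proj c) M = image_mset (proj c) M'"
    "image_mset (proj ((c+1) mod 3)) M = image_mset (proj ((c+1) mod 3)) M'"
    "image_mset (proj ((c+2) mod 3)) M = image_mset (proj ((c+2) mod 3)) M'"
  shows "M = M'"
proof -
  have proj: "proj 0 = fst" "proj 1 = fst \<circ> snd" "proj 2 = snd \<circ> snd" by (auto simp: proj_def)
  consider "c = 0" | "c = 1" | "c = 2" using assms(3) by linarith
  then have "image_mset (proj 0) M = image_mset (proj 0) M' \<and> image_mset (proj 1) M = image_mset (proj 1) M' \<and>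
      image_mset (proj 2) M = image_mset (proj 2) M'"
    using assms(4-) by cases (simp_all add: numeral_2_eq_2)
  then show ?thesis using assms(1,2) unfolding proj by (intro multiset_Phi_eqI_fst_snd) auto
qed

lemma prod_lessThan_3: "(\<Prod>c<3. g c) = g 0 * g 1 * g (2 :: nat)"
  by (simp add: eval_nat_numeral)

lemma card_nth_eq: "card {n \<in> {..<length l}. l ! n = x} = count (mset l) x"
  by (simp add: count_mset count_list_eq_length_filter length_filter_conv_card eq_commute[of x])

lemma exists_bits:
  assumes "finite P"
  shows "\<exists>h :: nat \<Rightarrow> 'x \<Rightarrow> bool. \<forall>u<2 ^ card P. \<forall>v<2 ^ card P. (\<forall>n\<in>P. h u n = h v n) \<longrightarrow> u = v"
proof -
  have "card (P \<rightarrow>\<^sub>E (UNIV :: bool set)) = 2 ^ card P" using assms by (simp add: card_PiE)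
  moreover have "finite (P \<rightarrow>\<^sub>E (UNIV :: bool set))" using assms by (intro finite_PiE) auto
  ultimately have "\<exists>h. bij_betw h {..<2 ^ card P :: nat} (P \<rightarrow>\<^sub>E (UNIV :: bool set))"
    by (intro finite_same_card_bij) auto
  then obtain h where h: "bij_betw h {..<2 ^ card P :: nat} (P \<rightarrow>\<^sub>E (UNIV :: bool set))" by blast
  have "u = v" if "u < 2 ^ card P" "v < 2 ^ card P" "\<forall>n\<in>P. h u n = h v n" for u v
  proof -
    have "h u \<in> P \<rightarrow>\<^sub>E UNIV" "h v \<in> P \<rightarrow>\<^sub>E UNIV" using h that by (auto simp: bij_betw_def)
    then have "h u = h v" using that(3) by (intro PiE_ext) auto
    then show ?thesis using h that by (auto simp: bij_betw_def inj_on_def)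
  qed
  then show ?thesis by blast
qed

text \<open>Each of the three negative terms is at least -2 C^2. This crude bound for unrelated
  labels is the source of the constant 6 C^2 + 1 that multiplies the hash weights.\<close>

lemma strassen_weight_lower:
  fixes C :: int
  assumes "0 \<le> p" "p \<le> C" "0 \<le> q" "0 \<le> p'" "0 \<le> r'" "r' \<le> C" "0 \<le> q''" "q'' \<le> C" "0 \<le> r''"
  shows "(p^2 + 2*p*q - 2*C*p) + (r'^2 + 2*p'*r' - 2*C*r') + (q''^2 + 2*q''*r'' - 2*C*q'' + C^2) \<ge> - (6 * C^2)"
proof -
  have "C * p \<le> C * C" "C * r' \<le> C * C" "C * q'' \<le> C * C" using assms by (auto intro!: mult_left_mono)
  moreover have "0 \<le> p * q" "0 \<le> p' * r'" "0 \<le> q'' * r''" "0 \<le> p * p" "0 \<le> r' * r'" "0 \<le> q'' * q''" "0 \<le> C * C"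
    using assms by auto
  moreover have "(p^2 + 2*p*q - 2*C*p) + (r'^2 + 2*p'*r' - 2*C*r') + (q''^2 + 2*q''*r'' - 2*C*q'' + C^2)
    = p * p + 2 * (p * q) - 2 * (C * p) + (r' * r' + 2 * (p' * r') - 2 * (C * r'))
      + (q'' * q'' + 2 * (q'' * r'') - 2 * (C * q'')) + C * C" and "C^2 = C * C"
    by (simp_all add: power2_eq_square algebra_simps)
  ultimately show ?thesis by linarith
qed

text \<open>The square is split so that each part uses only labels visible in one factor of the
  power: the first factor sees the labels of copies 0 and 1, the second those of 0 and 2, the third
  those of 1 and 2.\<close>

lemma strassen_weight_eq:
  fixes C :: int
  shows "(p^2 + 2*p*q - 2*C*p) + (r^2 + 2*p*r - 2*C*r) + (q^2 + 2*q*r - 2*C*q + C^2) = (p + q + r - C)^2"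
  by (simp add: power2_eq_square algebra_simps)

text \<open>The three copies are hashed jointly. Over the copies, each factor of the power meets all
  three projections once, so blocks have the same degree in every factor even if the marginals of
  \<open>M\<close> differ.\<close>

lemma independent_blocks:
  assumes M: "set_mset M \<subseteq> Phi"
  defines "L \<equiv> permutations_of_multiset M" and "N \<equiv> size M"
  shows "\<exists>S' a. S' \<subseteq> ({..<3} \<rightarrow>\<^sub>E L) \<and>
    card (permutations_of_multiset (image_mset (proj 0) M)) * card (permutations_of_multiset (image_mset (proj 1) M)) *
      card (permutations_of_multiset (image_mset (proj 2) M)) \<le> 28 * card S' \<and>
    (\<forall>e1\<in>S'. \<forall>e2\<in>S'. \<forall>e3\<in>S'.
      (\<forall>c<3. \<forall>n<N. unrotate c (proj c (e1 c ! n)) (proj ((c+1) mod 3) (e2 c ! n)) (proj ((c+2) mod 3) (e3 c ! n)) \<in> Phi) \<longrightarrow>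
      a e1 + a e2 = 2 * (a e3 :: int) \<and> (a e1 = a e2 \<longrightarrow> e1 = e2 \<and> e2 = e3))"
proof -
  define S where "S = ({..<3 :: nat} \<rightarrow>\<^sub>E L)"
  define D where "D = {..<3 :: nat} \<times> {..<N}"
  have finL: "finite L" by (simp add: L_def)
  have finS: "finite S" "finite D" using finL by (auto simp: S_def D_def finite_PiE)
  have lenL: "length l = N" and msetL: "mset l = M" if "l \<in> L" for l
    using that unfolding L_def N_def by (auto simp: permutations_of_multiset_def)
  have PhiL: "l ! n \<in> Phi" if "l \<in> L" "n < N" for l n
  proof -
    have "l ! n \<in> set l" using that lenL by auto
    then show ?thesis using M msetL[OF that(1)] by auto
  qed
  have eL: "e c \<in> L" if "e \<in> S" "c < 3" for e c using that by (auto simp: S_def PiE_iff)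
  \<comment> \<open>Factor \<open>d\<close> of the power is factor (c + d) mod 3 of the structure
    tensor in copy \<open>c\<close>.\<close>
  define crd where "crd = (\<lambda>d (e :: nat \<Rightarrow> (nat \<times> nat \<times> nat) list) (c, n). int (proj ((c+d) mod 3) (e c ! n)))"
  define B where "B = (\<lambda>a. card (permutations_of_multiset (image_mset (proj a) M)))"
  define f where "f = (\<lambda>a. card L div B a)"
  have Bpos: "B a > 0" for a by (auto simp: B_def card_gt_0_iff permutations_of_multiset_not_empty)
  have neL: "card L > 0" by (auto simp: L_def card_gt_0_iff permutations_of_multiset_not_empty)
  have fib: "card {l' \<in> L. map (proj a) l' = map (proj a) l} = f a" and fB: "f a * B a = card L" if "l \<in> L" for a l
  proof -
    have *: "card {l' \<in> L. map (proj a) l' = map (proj a) l} * B a = card L"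
      using card_fibre[of l M "proj a"] that unfolding L_def B_def by simp
    have eq: "f a = card {l' \<in> L. map (proj a) l' = map (proj a) l}"
      unfolding f_def *[symmetric] by (rule nonzero_mult_div_cancel_right) (use Bpos[of a] in simp)
    show "card {l' \<in> L. map (proj a) l' = map (proj a) l} = f a" "f a * B a = card L" unfolding eq by (rule refl, rule *)
  qed
  \<comment> \<open>The common degree: \<open>f a\<close> sequences of type \<open>M\<close> share a
    given projection \<open>a\<close>, and the three copies involve each projection once.\<close>
  define \<Delta> where "\<Delta> = f 0 * f 1 * f 2"
  have deg: "card {e' \<in> S. \<forall>p\<in>D. crd d e' p = crd d e p} = \<Delta>" if e: "e \<in> S" and d: "d < 3" for e d
  proof -
    have eqset: "{e' \<in> S. \<forall>p\<in>D. crd d e' p = crd d e p}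
      = PiE {..<3} (\<lambda>c. {l' \<in> L. map (proj ((c+d) mod 3)) l' = map (proj ((c+d) mod 3)) (e c)})"
      (is "?A = ?B")
    proof (intro equalityI subsetI)
      fix e' assume "e' \<in> ?A"
      then have e': "e' \<in> S" "\<And>c n. c < 3 \<Longrightarrow> n < N \<Longrightarrow> proj ((c+d) mod 3) (e' c ! n) = proj ((c+d) mod 3) (e c ! n)"
        by (auto simp: D_def crd_def)
      have "map (proj ((c+d) mod 3)) (e' c) = map (proj ((c+d) mod 3)) (e c)" if "c < 3" for c
        using e'(2)[OF that] lenL[OF eL[OF e'(1) that]] lenL[OF eL[OF e that]] by (intro nth_equalityI) auto
      then show "e' \<in> ?B" using e'(1) by (auto simp: S_def PiE_iff)
    next
      fix e' assume e': "e' \<in> ?B"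
      then have "e' \<in> S" by (auto simp: S_def PiE_iff)
      moreover have "proj ((c+d) mod 3) (e' c ! n) = proj ((c+d) mod 3) (e c ! n)" if "c < 3" "n < N" for c n
      proof -
        have "map (proj ((c+d) mod 3)) (e' c) = map (proj ((c+d) mod 3)) (e c)" using e' that by (auto simp: PiE_iff)
        then have "map (proj ((c+d) mod 3)) (e' c) ! n = map (proj ((c+d) mod 3)) (e c) ! n" by simp
        then show ?thesis using lenL[OF eL[OF \<open>e' \<in> S\<close> that(1)]] lenL[OF eL[OF e that(1)]] that(2) by simp
      qed
      ultimately show "e' \<in> ?A" by (auto simp: D_def crd_def)
    qed
    then have "card {e' \<in> S. \<forall>p\<in>D. crd d e' p = crd d e p} = (\<Prod>c<3. f ((c+d) mod 3))"
    proof -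
      have "card (PiE {..<3} (\<lambda>c. {l' \<in> L. map (proj ((c+d) mod 3)) l' = map (proj ((c+d) mod 3)) (e c)}))
        = (\<Prod>c<3. card {l' \<in> L. map (proj ((c+d) mod 3)) l' = map (proj ((c+d) mod 3)) (e c)})"
        by (rule card_PiE) simp
      also have "\<dots> = (\<Prod>c<3. f ((c+d) mod 3))"
        by (rule prod.cong[OF refl], rule fib, rule eL[OF e]) simp
      finally show ?thesis using eqset by (simp only:)
    qed
    also have "\<dots> = \<Delta>"
    proof -
      consider "d = 0" | "d = 1" | "d = 2" using d by linarith
      then show ?thesis unfolding prod_lessThan_3 \<Delta>_def by cases (simp_all add: numeral_2_eq_2)
    qed
    finally show ?thesis .
  qed
  have prc: "crd 0 e (c, n) = int (proj c (e c ! n))" if "c < 3" for e c n using that by (simp add: crd_def)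
  have ex: "\<exists>S' a. S' \<subseteq> S \<and> card S \<le> 4 * (6 * \<Delta> + 1) * card S' \<and>
    (\<forall>e\<in>S. \<forall>e1\<in>S'. \<forall>e2\<in>S'. \<forall>e3\<in>S'.
      (\<forall>p\<in>D. crd 0 e p = crd 0 e1 p \<and> crd 1 e p = crd 1 e2 p \<and> crd 2 e p = crd 2 e3 p) \<longrightarrow>
      a e1 + a e2 = 2 * (a e3 :: int) \<and> (a e1 = a e2 \<longrightarrow> e = e1 \<and> e = e2 \<and> e = e3))"
  proof (rule exists_independent_triples[OF finS])
    fix e p assume e: "e \<in> S" "p \<in> D"
    then obtain c n where p: "p = (c, n)" "c < 3" "n < N" by (auto simp: D_def)
    have sum: "proj c (e c ! n) + proj ((c+1) mod 3) (e c ! n) + proj ((c+2) mod 3) (e c ! n) = 2"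
      using proj_sum_Phi[OF p(2) PhiL[OF eL[OF e(1) p(2)] p(3)]] .
    then show "crd 0 e p + crd 1 e p + crd 2 e p = 2"
      unfolding p(1) prc[OF p(2)] by (simp only: crd_def prod.case)
    show "crd 0 e p \<in> {0..2} \<and> crd 1 e p \<in> {0..2} \<and> crd 2 e p \<in> {0..2}"
      using sum unfolding p(1) prc[OF p(2)] by (simp only: crd_def prod.case atLeastAtMost_iff) linarith
  next
    fix e e' assume e: "e \<in> S" "e' \<in> S" and eq: "\<forall>p\<in>D. crd 0 e p = crd 0 e' p \<and> crd 1 e p = crd 1 e' p"
    have "e c = e' c" if c: "c < 3" for c
    proof (rule nth_equalityI)
      show "length (e c) = length (e' c)" using lenL eL e c by simp
      fix n assume "n < length (e c)"
      then have n: "n < N" using lenL eL e c by simp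
      have "crd 0 e (c, n) = crd 0 e' (c, n)" "crd 1 e (c, n) = crd 1 e' (c, n)" using eq c n by (auto simp: D_def)
      then have 1: "proj c (e c ! n) = proj c (e' c ! n)" and 2: "proj ((c+1) mod 3) (e c ! n) = proj ((c+1) mod 3) (e' c ! n)"
        unfolding prc[OF c] by (simp_all add: crd_def)
      moreover have "proj ((c+2) mod 3) (e c ! n) = proj ((c+2) mod 3) (e' c ! n)"
        using proj_sum_Phi[OF c PhiL[OF eL[OF e(1) c] n]] proj_sum_Phi[OF c PhiL[OF eL[OF e(2) c] n]] 1 2 by linarith
      ultimately show "e c ! n = e' c ! n" by (rule proj_ext[OF c])
    qed
    then show "e = e'" using e unfolding S_def by (intro PiE_ext[of e "{..<3}" "\<lambda>_. L" e']) auto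
  qed (use deg[of _ 0] deg[of _ 1] deg[of _ 2] in auto)
  obtain S' and a :: "_ \<Rightarrow> int" where S': "S' \<subseteq> S" and size: "card S \<le> 4 * (6 * \<Delta> + 1) * card S'"
    and hash: "\<And>e e1 e2 e3. e \<in> S \<Longrightarrow> e1 \<in> S' \<Longrightarrow> e2 \<in> S' \<Longrightarrow> e3 \<in> S' \<Longrightarrow>
      (\<forall>p\<in>D. crd 0 e p = crd 0 e1 p \<and> crd 1 e p = crd 1 e2 p \<and> crd 2 e p = crd 2 e3 p) \<Longrightarrow>
      a e1 + a e2 = 2 * a e3 \<and> (a e1 = a e2 \<longrightarrow> e = e1 \<and> e = e2 \<and> e = e3)"
    using ex by (elim exE conjE) blast
  have "B 0 * B 1 * B 2 \<le> 28 * card S'"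
  proof -
    obtain l where l: "l \<in> L" using neL by (auto simp: card_gt_0_iff)
    \<comment> \<open>Counting \<open>S\<close> by fibres gives \<open>\<Delta>\<close> times the
      product of the marginal counts. The constant 28 comes from 4 (6 \<open>\<Delta>\<close> + 1)
      <= 28 \<open>\<Delta>\<close>.\<close>
    have "card S = (f 0 * B 0) * (f 1 * B 1) * (f 2 * B 2)"
      unfolding fB[OF l] by (simp add: S_def card_PiE power3_eq_cube)
    then have "\<Delta> * (B 0 * B 1 * B 2) = card S" by (simp add: \<Delta>_def mult_ac)
    moreover have D1: "\<Delta> > 0"
    proof -
      have "f a > 0" for a using fB[OF l, of a] neL by (cases "f a") auto
      then show ?thesis by (simp add: \<Delta>_def)
    qed
    moreover have "4 * (6 * \<Delta> + 1) * card S' \<le> \<Delta> * (28 * card S')"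
    proof -
      have "4 * (6 * \<Delta> + 1) \<le> 28 * \<Delta>" using D1 by simp
      then have "4 * (6 * \<Delta> + 1) * card S' \<le> 28 * \<Delta> * card S'" by (rule mult_le_mono1)
      then show ?thesis by (simp add: mult_ac)
    qed
    ultimately have "\<Delta> * (B 0 * B 1 * B 2) \<le> \<Delta> * (28 * card S')" using size by linarith
    then show ?thesis by (rule mult_left_le_imp_le) (rule D1)
  qed
  moreover have "a e1 + a e2 = 2 * a e3 \<and> (a e1 = a e2 \<longrightarrow> e1 = e2 \<and> e2 = e3)"
    if e: "e1 \<in> S'" "e2 \<in> S'" "e3 \<in> S'" and
      supp: "\<forall>c<3. \<forall>n<N. unrotate c (proj c (e1 c ! n)) (proj ((c+1) mod 3) (e2 c ! n)) (proj ((c+2) mod 3) (e3 c ! n)) \<in> Phi"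
    for e1 e2 e3
  proof -
    define \<tau> where "\<tau> = (\<lambda>c n. unrotate c (proj c (e1 c ! n)) (proj ((c+1) mod 3) (e2 c ! n)) (proj ((c+2) mod 3) (e3 c ! n)))"
    \<comment> \<open>The three given blocks may belong to different elements of \<open>S'\<close>.
      Read together they form one sequence of elements of \<open>Phi\<close> per copy, and the point
      is that this again belongs to \<open>S\<close>.\<close>
    define e0 where "e0 = (\<lambda>c\<in>{..<3 :: nat}. map (\<tau> c) [0..<N])"
    have eS: "e1 \<in> S" "e2 \<in> S" "e3 \<in> S" using e S' by auto
    have \<tau>: "proj c (\<tau> c n) = proj c (e1 c ! n)" "proj ((c+1) mod 3) (\<tau> c n) = proj ((c+1) mod 3) (e2 c ! n)"
      "proj ((c+2) mod 3) (\<tau> c n) = proj ((c+2) mod 3) (e3 c ! n)" if "c < 3" for c n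
      unfolding \<tau>_def using proj_unrotate[OF that] by blast+
    have "map (\<tau> c) [0..<N] \<in> L" if c: "c < 3" for c
    proof -
      have img: "image_mset (proj a) (mset (map (\<tau> c) [0..<N])) = image_mset (proj a) M"
        if "e' \<in> S" "\<And>n. proj a (\<tau> c n) = proj a (e' c ! n)" for a e'
      proof -
        have "map (proj a) (map (\<tau> c) [0..<N]) = map (proj a) (e' c)"
          using lenL[OF eL[OF that(1) c]] that(2) by (intro nth_equalityI) auto
        then have "mset (map (proj a) (map (\<tau> c) [0..<N])) = mset (map (proj a) (e' c))" by (rule arg_cong)
        then show ?thesis using msetL[OF eL[OF that(1) c]] by (simp only: mset_map)
      qed
      \<comment> \<open>The marginals are those of \<open>M\<close>, because each projection comes
        from a sequence of type \<open>M\<close>. As they determine the type, no block of another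
        type interferes.\<close>
      have "mset (map (\<tau> c) [0..<N]) = M"
      proof (rule multiset_Phi_eqI[OF _ M c])
        show "set_mset (mset (map (\<tau> c) [0..<N])) \<subseteq> Phi" using supp c by (auto simp: \<tau>_def)
      qed (rule img[OF eS(1) \<tau>(1)[OF c]] img[OF eS(2) \<tau>(2)[OF c]] img[OF eS(3) \<tau>(3)[OF c]])+
      then show ?thesis by (simp add: L_def permutations_of_multiset_def)
    qed
    then have "e0 \<in> S" by (auto simp: S_def e0_def)
    moreover have "\<forall>p\<in>D. crd 0 e0 p = crd 0 e1 p \<and> crd 1 e0 p = crd 1 e2 p \<and> crd 2 e0 p = crd 2 e3 p"
    proof
      fix p assume "p \<in> D"
      then obtain c n where p: "p = (c, n)" "c < 3" "n < N" by (auto simp: D_def)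
      have e0n: "e0 c ! n = \<tau> c n" using p by (simp add: e0_def)
      show "crd 0 e0 p = crd 0 e1 p \<and> crd 1 e0 p = crd 1 e2 p \<and> crd 2 e0 p = crd 2 e3 p"
        unfolding p(1) prc[OF p(2)] using \<tau>[OF p(2), of n] by (simp only: crd_def prod.case e0n)
    qed
    ultimately show ?thesis using hash[of e0 e1 e2 e3] e by blast
  qed
  ultimately show ?thesis
    unfolding B_def S_def[symmetric] using S' by (intro exI[of _ S'] exI[of _ a]) blast
qed

lemma power3_powr:
  fixes v :: real
  assumes "0 \<le> v"
  shows "(v ^ 3) powr (s / 3) = v powr s"
proof (cases "v = 0")
  case False
  then show ?thesis using assms by (simp add: powr_realpow[symmetric] powr_powr del: powr_numeral)
qed simp

text \<open>A summand is indexed by an independent block \<open>e\<close> and by labels \<open>p + q + r = K - 1\<close>, where the binary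
  digits of \<open>p\<close>, \<open>q\<close> and \<open>r\<close> select the summands of the components \<open>(1, 1, 0)\<close> in the three copies. Within a
  block the first two factors of each copy determine its label, so every label is shared by two of the
  three factors of the power. Weights adding up to \<open>(p + q + r - (K - 1))^2\<close> remove the other label
  triples. The weight from the hash values is multiplied by a constant \<open>\<Lambda>\<close> that dominates the label
  weights of triples mixing different blocks.\<close>

lemma laser_degeneration:
  assumes m: "1 \<le> m" and M: "set_mset M \<subseteq> Phi"
  defines "K \<equiv> 2 ^ count M (1,1,0)"
  shows "\<exists>abcs. (\<forall>(a, b, c)\<in>set abcs. 1 \<le> a \<and> 1 \<le> b \<and> 1 \<le> c) \<and>
    kron_power (symmetrization (T_A m)) (size M) \<unrhd> matmuls abcs \<and>
    real (card (permutations_of_multiset (image_mset (proj 0) M)) * card (permutations_of_multiset (image_mset (proj 1) M)) *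
      card (permutations_of_multiset (image_mset (proj 2) M)) * (K * K)) * real (\<Prod>\<phi>\<in>#M. block_vol m \<phi>) powr omega
    \<le> 56 * (\<Sum>(a, b, c)\<leftarrow>abcs. real (a * b * c) powr (omega / 3))"
proof -
  define L where "L = permutations_of_multiset M"
  define N where "N = size M"
  define D where "D = {..<3 :: nat} \<times> {..<N}"
  obtain S' and a :: "_ \<Rightarrow> int" where S': "S' \<subseteq> ({..<3} \<rightarrow>\<^sub>E L)"
    and size: "card (permutations_of_multiset (image_mset (proj 0) M)) * card (permutations_of_multiset (image_mset (proj 1) M)) *
      card (permutations_of_multiset (image_mset (proj 2) M)) \<le> 28 * card S'"
    and hash': "\<forall>e1\<in>S'. \<forall>e2\<in>S'. \<forall>e3\<in>S'.
      (\<forall>c<3. \<forall>n<N. unrotate c (proj c (e1 c ! n)) (proj ((c+1) mod 3) (e2 c ! n)) (proj ((c+2) mod 3) (e3 c ! n)) \<in> Phi) \<longrightarrow>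
      a e1 + a e2 = 2 * a e3 \<and> (a e1 = a e2 \<longrightarrow> e1 = e2 \<and> e2 = e3)"
    using independent_blocks[OF M] unfolding L_def[symmetric] N_def[symmetric] by (elim exE conjE) (rule that)
  have hash: "a e1 + a e2 = 2 * a e3 \<and> (a e1 = a e2 \<longrightarrow> e1 = e2 \<and> e2 = e3)"
    if "e1 \<in> S'" "e2 \<in> S'" "e3 \<in> S'"
      "\<And>c n. c < 3 \<Longrightarrow> n < N \<Longrightarrow> unrotate c (proj c (e1 c ! n)) (proj ((c+1) mod 3) (e2 c ! n)) (proj ((c+2) mod 3) (e3 c ! n)) \<in> Phi"
    for e1 e2 e3
    using hash'[rule_format, OF that(1-3)] that(4) by blast
  have finL: "finite L" by (simp add: L_def)
  have finD: "finite D" by (simp add: D_def)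
  have finS': "finite S'" by (rule finite_subset[OF S' finite_PiE]) (use finL in simp_all)
  have lenL: "length l = N" and msetL: "mset l = M" if "l \<in> L" for l
    using that unfolding L_def N_def by (auto simp: permutations_of_multiset_def)
  have PhiL: "l ! n \<in> Phi" if "l \<in> L" "n < N" for l n
  proof -
    have "l ! n \<in> set l" using that lenL by auto
    then show ?thesis using M msetL[OF that(1)] by auto
  qed
  have eL: "e c \<in> L" if "e \<in> S'" "c < 3" for e c using that S' by (auto simp: PiE_iff)
  define P where "P = (\<lambda>l. {n \<in> {..<N}. l ! n = (1 :: nat, 1 :: nat, 0 :: nat)})"
  have cardP: "2 ^ card (P l) = K" if "l \<in> L" for l
    using card_nth_eq[of l "(1,1,0)"] lenL[OF that] msetL[OF that] by (simp add: P_def K_def)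
  have "\<exists>h. \<forall>u<2 ^ card (P l). \<forall>v<2 ^ card (P l). (\<forall>n\<in>P l. (h :: nat \<Rightarrow> nat \<Rightarrow> bool) u n = h v n) \<longrightarrow> u = v" for l
    by (rule exists_bits) (simp add: P_def)
  then obtain bt :: "_ \<Rightarrow> nat \<Rightarrow> nat \<Rightarrow> bool" where bt':
    "\<And>l. \<forall>u<2 ^ card (P l). \<forall>v<2 ^ card (P l). (\<forall>n\<in>P l. bt l u n = bt l v n) \<longrightarrow> u = v" by metis
  have bt: "u = v" if "l \<in> L" "u < K" "v < K" "\<And>n. n < N \<Longrightarrow> l ! n = (1,1,0) \<Longrightarrow> bt l u n = bt l v n" for l u v
    using bt'[of l] that unfolding cardP[OF that(1)] by (auto simp: P_def)

  define Ks where "Ks = S' \<times> {(p, q). p + q < K}"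
  have finKs: "finite Ks"
  proof -
    have "{(p, q). p + q < K} \<subseteq> {..<K} \<times> {..<K}" by auto
    then have "finite {(p, q). p + q < K}" by (rule finite_subset) simp
    then show ?thesis using finS' by (simp add: Ks_def)
  qed
  \<comment> \<open>The truncated subtraction is exact, since p + q < K in \<open>Ks\<close>; hence
    the three labels add up to K - 1.\<close>
  define lab where "lab = (\<lambda>(\<kappa> :: (nat \<Rightarrow> (nat \<times> nat \<times> nat) list) \<times> nat \<times> nat) (c :: nat). if c = 0 then fst (snd \<kappa>) else if c = 1 then snd (snd \<kappa>)
      else K - 1 - fst (snd \<kappa>) - snd (snd \<kappa>))"
  have labK: "lab \<kappa> c < K" if "\<kappa> \<in> Ks" for \<kappa> c
    using that by (auto simp: Ks_def lab_def)
  define sb where "sb = (\<lambda>\<kappa> c n. bt (fst \<kappa> c) (lab \<kappa> c) n)"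
  define dm where "dm = (\<lambda>\<kappa> d (c, n). block_dim m (fst \<kappa> c ! n) (sb \<kappa> c n) ((c+d) mod 3))"
  \<comment> \<open>The matrix dimensions of a summand: they multiply over all positions of the
    three copies, and dimension \<open>d\<close> of the power is dimension (c + d) mod 3 in copy
    \<open>c\<close>.\<close>
  define A where "A = (\<lambda>\<kappa> d. \<Prod>p\<in>D. dm \<kappa> d p)"
  have Apos: "1 \<le> A \<kappa> d" for \<kappa> d
    unfolding A_def by (auto simp: Suc_le_eq dm_def intro!: prod_pos block_dim_pos[OF m])
  have "\<exists>h. bij_betw h {..<A \<kappa> d} (PiE D (\<lambda>p. {..<dm \<kappa> d p}))" for \<kappa> d
    using finD by (intro finite_same_card_bij) (auto simp: finite_PiE card_PiE A_def)
  then obtain \<alpha> where \<alpha>: "\<And>\<kappa> d. bij_betw (\<alpha> \<kappa> d) {..<A \<kappa> d} (PiE D (\<lambda>p. {..<dm \<kappa> d p}))" by metis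
  have \<alpha>_less: "\<alpha> \<kappa> d i (c, n) < block_dim m (fst \<kappa> c ! n) (sb \<kappa> c n) ((c+d) mod 3)" if "i < A \<kappa> d" "c < 3" "n < N" for \<kappa> d i c n
  proof -
    have "\<alpha> \<kappa> d i \<in> PiE D (\<lambda>p. {..<dm \<kappa> d p})" using that(1) by (intro bij_betw_apply[OF \<alpha>]) simp
    then have "\<alpha> \<kappa> d i (c, n) \<in> {..<dm \<kappa> d (c, n)}" by (rule PiE_mem) (use that in \<open>simp add: D_def\<close>)
    then show ?thesis by (simp add: dm_def)
  qed
  have \<alpha>_inj: "(\<forall>p\<in>D. \<alpha> \<kappa> d i p = \<alpha> \<kappa> d j p) \<longleftrightarrow> i = j" if "i < A \<kappa> d" "j < A \<kappa> d" for \<kappa> d i j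
  proof
    assume *: "\<forall>p\<in>D. \<alpha> \<kappa> d i p = \<alpha> \<kappa> d j p"
    have "\<alpha> \<kappa> d i \<in> PiE D (\<lambda>p. {..<dm \<kappa> d p})" "\<alpha> \<kappa> d j \<in> PiE D (\<lambda>p. {..<dm \<kappa> d p})"
      using that by (intro bij_betw_apply[OF \<alpha>]; simp)+
    then have "\<alpha> \<kappa> d i = \<alpha> \<kappa> d j" by (rule PiE_ext) (use * in blast)
    then show "i = j" by (rule inj_onD[OF bij_betw_imp_inj_on[OF \<alpha>]]) (use that in simp_all)
  qed simp
  \<comment> \<open>The arguments \<open>i\<close> and \<open>j\<close> number whole index
    sequences, and \<open>\<alpha>\<close> recovers their entries at (c, n). The result is the basis
    index used there in factor \<open>d\<close> of the power.\<close>
  define dg where "dg = (\<lambda>d \<kappa> i j c n. block_index m ((c+d) mod 3) (fst \<kappa> c ! n) (sb \<kappa> c n) (\<alpha> \<kappa> d i (c, n)) (\<alpha> \<kappa> ((d+1) mod 3) j (c, n)))"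
  have dg_less: "dg d \<kappa> i j c n < 3*m+3" and dg_gr: "\<kappa> \<in> Ks \<Longrightarrow> grade m ((c+d) mod 3) (dg d \<kappa> i j c n) = proj ((c+d) mod 3) (fst \<kappa> c ! n)"
    if "i < A \<kappa> d" "j < A \<kappa> ((d+1) mod 3)" "c < 3" "n < N" for d \<kappa> i j c n
  proof -
    have 1: "\<alpha> \<kappa> d i (c, n) < block_dim m (fst \<kappa> c ! n) (sb \<kappa> c n) ((c+d) mod 3)" using \<alpha>_less that by simp
    have 2: "\<alpha> \<kappa> ((d+1) mod 3) j (c, n) < block_dim m (fst \<kappa> c ! n) (sb \<kappa> c n) (((c+d) mod 3 + 1) mod 3)"
    proof -
      have md: "(c + (d+1) mod 3) mod 3 = ((c+d) mod 3 + 1) mod 3" by presburger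
      show ?thesis using \<alpha>_less[OF that(2,3,4)] unfolding md .
    qed
    show "dg d \<kappa> i j c n < 3*m+3" unfolding dg_def by (rule block_index_less[OF m _ 1 2]) simp
    show "grade m ((c+d) mod 3) (dg d \<kappa> i j c n) = proj ((c+d) mod 3) (fst \<kappa> c ! n)" if "\<kappa> \<in> Ks"
      unfolding dg_def by (rule grade_block_index[OF m _ _ 1 2]) (use that PhiL eL \<open>c < 3\<close> \<open>n < N\<close> in \<open>auto simp: Ks_def\<close>)
  qed
  have mods: "(0+1) mod 3 = (1::nat)" "(1+1) mod 3 = (2::nat)" "(2+1) mod 3 = (0::nat)" by simp_all

  obtain \<kappa>s where \<kappa>s: "set \<kappa>s = Ks" "distinct \<kappa>s" using finite_distinct_list[OF finKs] by blast
  have inKs: "\<kappa>s ! t \<in> Ks" if "t < length \<kappa>s" for t using that \<kappa>s(1) nth_mem by blast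
  define abcs where "abcs = map (\<lambda>\<kappa>. (A \<kappa> 0, A \<kappa> 1, A \<kappa> 2)) \<kappa>s"
  have len: "length abcs = length \<kappa>s" by (simp add: abcs_def)
  define C where "C = int K - 1"
  define \<Lambda> where "\<Lambda> = 6 * C^2 + 1"
  define ip where "ip = (\<lambda>\<kappa> c. int (lab \<kappa> c))"
  \<comment> \<open>On the support the hash values satisfy a e + a e' = 2 a e'', so the coefficients
    2, 2 and -4 make the hash parts add up to \<open>\<Lambda>\<close> times (a e - a e')^2. The
    label parts are the three pieces of the square in \<open>strassen_weight_eq\<close>.\<close>
  define wx where "wx = (\<lambda>\<kappa>. \<Lambda> * (2 * (a (fst \<kappa>))^2) + ((ip \<kappa> 0)^2 + 2 * ip \<kappa> 0 * ip \<kappa> 1 - 2 * C * ip \<kappa> 0))"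
  define wy where "wy = (\<lambda>\<kappa>. \<Lambda> * (2 * (a (fst \<kappa>))^2) + ((ip \<kappa> 2)^2 + 2 * ip \<kappa> 0 * ip \<kappa> 2 - 2 * C * ip \<kappa> 2))"
  define wz where "wz = (\<lambda>\<kappa>. - (\<Lambda> * (4 * (a (fst \<kappa>))^2)) + ((ip \<kappa> 1)^2 + 2 * ip \<kappa> 1 * ip \<kappa> 2 - 2 * C * ip \<kappa> 1 + C^2))"
  have ip: "0 \<le> ip \<kappa> c" "ip \<kappa> c \<le> C" if "\<kappa> \<in> Ks" for \<kappa> c
    using labK[OF that, of c] by (auto simp: ip_def C_def)
  have ipsum: "ip \<kappa> 0 + ip \<kappa> 1 + ip \<kappa> 2 = C" if "\<kappa> \<in> Ks" for \<kappa>
    using that by (auto simp: ip_def lab_def C_def Ks_def)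
  have entry_eq: "entry (kron_power (symmetrization (T_A m)) N) (encode3 m N (dg 0 \<kappa> i j)) (encode3 m N (dg 1 \<kappa>' j' k)) (encode3 m N (dg 2 \<kappa>'' k' i'))
    = (\<Prod>(c, n)\<in>D. rotated_entry m c (dg 0 \<kappa> i j c n) (dg 1 \<kappa>' j' k c n) (dg 2 \<kappa>'' k' i' c n))"
    if "i < A \<kappa> 0" "j < A \<kappa> 1" "j' < A \<kappa>' 1" "k < A \<kappa>' 2" "k' < A \<kappa>'' 2" "i' < A \<kappa>'' 0" for \<kappa> \<kappa>' \<kappa>'' i j j' k k' i'
    unfolding D_def
  proof (rule entry_sym_power)
    fix c n :: nat assume cn: "c < 3" "n < N"
    show "dg 0 \<kappa> i j c n < 3*m+3 \<and> dg 1 \<kappa>' j' k c n < 3*m+3 \<and> dg 2 \<kappa>'' k' i' c n < 3*m+3"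
      using dg_less[of i \<kappa> 0 j c n] dg_less[of j' \<kappa>' 1 k c n] dg_less[of k' \<kappa>'' 2 i' c n] that cn unfolding mods by simp
  qed
  have nonneg: "0 \<le> wx \<kappa> + wy \<kappa>' + wz \<kappa>'' \<and> (wx \<kappa> + wy \<kappa>' + wz \<kappa>'' = 0 \<longrightarrow> \<kappa> = \<kappa>' \<and> \<kappa> = \<kappa>'')"
    if \<kappa>: "\<kappa> \<in> Ks" "\<kappa>' \<in> Ks" "\<kappa>'' \<in> Ks"
      and ijk: "i < A \<kappa> 0" "j < A \<kappa> 1" "j' < A \<kappa>' 1" "k < A \<kappa>' 2" "k' < A \<kappa>'' 2" "i' < A \<kappa>'' 0"
      and nz: "entry (kron_power (symmetrization (T_A m)) N) (encode3 m N (dg 0 \<kappa> i j)) (encode3 m N (dg 1 \<kappa>' j' k))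
        (encode3 m N (dg 2 \<kappa>'' k' i')) \<noteq> 0" for \<kappa> \<kappa>' \<kappa>'' i j j' k k' i'
  proof -
    have tcnz: "rotated_entry m c (dg 0 \<kappa> i j c n) (dg 1 \<kappa>' j' k c n) (dg 2 \<kappa>'' k' i' c n) \<noteq> 0" if "c < 3" "n < N" for c n
    proof
      assume "rotated_entry m c (dg 0 \<kappa> i j c n) (dg 1 \<kappa>' j' k c n) (dg 2 \<kappa>'' k' i' c n) = 0"
      then have "(\<Prod>(c, n)\<in>D. rotated_entry m c (dg 0 \<kappa> i j c n) (dg 1 \<kappa>' j' k c n) (dg 2 \<kappa>'' k' i' c n)) = 0"
        using that finD by (intro prod_zero bexI[of _ "(c, n)"]) (simp_all add: D_def)
      then show False using nz unfolding entry_eq[OF ijk] by contradiction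
    qed
    define e e' e'' where "e = fst \<kappa>" and "e' = fst \<kappa>'" and "e'' = fst \<kappa>''"
    have eS: "e \<in> S'" "e' \<in> S'" "e'' \<in> S'" using \<kappa> by (auto simp: Ks_def e_def e'_def e''_def)
    have "unrotate c (proj c (e c ! n)) (proj ((c+1) mod 3) (e' c ! n)) (proj ((c+2) mod 3) (e'' c ! n)) \<in> Phi" if cn: "c < 3" "n < N" for c n
    proof -
      have "grade m c (dg 0 \<kappa> i j c n) = proj c (e c ! n)"
        using dg_gr[of i \<kappa> 0 j c n] ijk cn \<kappa> unfolding mods by (simp add: e_def)
      moreover have "grade m ((c+1) mod 3) (dg 1 \<kappa>' j' k c n) = proj ((c+1) mod 3) (e' c ! n)"
        using dg_gr[of j' \<kappa>' 1 k c n] ijk cn \<kappa> unfolding mods e'_def by blast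
      moreover have "grade m ((c+2) mod 3) (dg 2 \<kappa>'' k' i' c n) = proj ((c+2) mod 3) (e'' c ! n)"
        using dg_gr[of k' \<kappa>'' 2 i' c n] ijk cn \<kappa> unfolding mods e''_def by blast
      ultimately show ?thesis using rotated_entry_grades[OF m cn(1) tcnz[OF cn]] by (simp only:)
    qed
    from hash[OF eS this] have h: "a e + a e' = 2 * a e''" "a e = a e' \<Longrightarrow> e = e' \<and> e' = e''" by blast+
    let ?St = "((ip \<kappa> 0)^2 + 2 * ip \<kappa> 0 * ip \<kappa> 1 - 2 * C * ip \<kappa> 0) + ((ip \<kappa>' 2)^2 + 2 * ip \<kappa>' 0 * ip \<kappa>' 2 - 2 * C * ip \<kappa>' 2)
      + ((ip \<kappa>'' 1)^2 + 2 * ip \<kappa>'' 1 * ip \<kappa>'' 2 - 2 * C * ip \<kappa>'' 1 + C^2)"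
    have w: "wx \<kappa> + wy \<kappa>' + wz \<kappa>'' = \<Lambda> * (a e - a e')^2 + ?St"
    proof -
      have "4 * (a e'')^2 = (a e + a e')^2" unfolding h(1) by (simp add: power2_eq_square)
      then have "\<Lambda> * (4 * (a e'')^2) = \<Lambda> * (a e + a e')^2" by simp
      then have "wx \<kappa> + wy \<kappa>' + wz \<kappa>'' = \<Lambda> * (2 * (a e)^2) + \<Lambda> * (2 * (a e')^2) - \<Lambda> * (a e + a e')^2 + ?St"
        unfolding wx_def wy_def wz_def e_def e'_def e''_def by linarith
      also have "\<Lambda> * (2 * (a e)^2) + \<Lambda> * (2 * (a e')^2) - \<Lambda> * (a e + a e')^2 = \<Lambda> * (a e - a e')^2"
        by (simp add: power2_eq_square algebra_simps)
      finally show ?thesis .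
    qed
    show ?thesis
    proof (cases "a e = a e'")
      case False
      then have "1 \<le> (a e - a e')^2" using zero_less_power2[of "a e - a e'"] by linarith
      then have "\<Lambda> * 1 \<le> \<Lambda> * (a e - a e')^2" by (intro mult_left_mono) (auto simp: \<Lambda>_def)
      moreover have "- (6 * C^2) \<le> ?St" using ip \<kappa> by (intro strassen_weight_lower) auto
      ultimately have "0 < wx \<kappa> + wy \<kappa>' + wz \<kappa>''" unfolding w using \<Lambda>_def by linarith
      then show ?thesis by simp
    next
      case True
      then have ee: "e' = e" "e'' = e" using h(2) by auto
      have fst_eq: "fst \<kappa> = e" "fst \<kappa>' = e" "fst \<kappa>'' = e" using ee by (auto simp: e_def e'_def e''_def)
      \<comment> \<open>Factor (2 c) mod 3 of the power serves as the first factor of the structure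
        tensor in copy \<open>c\<close>, and factor (1 + 2 c) mod 3 as the second. If the labels of
        copy \<open>c\<close> differed, their digits would differ at some position of (1,1,0), where
        the entry vanishes by \<open>entry_label_mismatch\<close>.\<close>
      have labels: "lab \<mu> c = lab \<nu> c"
        if c: "c < 3" and \<mu>: "\<mu> \<in> Ks" "fst \<mu> = e" and \<nu>: "\<nu> \<in> Ks" "fst \<nu> = e"
          and ix: "i1 < A \<mu> ((0+2*c) mod 3)" "j1 < A \<mu> ((1+2*c) mod 3)" "i2 < A \<nu> ((1+2*c) mod 3)" "j2 < A \<nu> ((2+2*c) mod 3)"
          and nz': "\<And>n. n < N \<Longrightarrow> \<exists>l. entry (T_A m) (dg ((0+2*c) mod 3) \<mu> i1 j1 c n) (dg ((1+2*c) mod 3) \<nu> i2 j2 c n) l \<noteq> 0"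
        for c \<mu> \<nu> i1 j1 i2 j2
      proof (rule bt[OF eL[OF eS(1) c] labK[OF \<mu>(1)] labK[OF \<nu>(1)]])
        fix n assume n: "n < N" "e c ! n = (1,1,0)"
        have md: "(c + (0+2*c) mod 3) mod 3 = 0" "(c + (1+2*c) mod 3) mod 3 = 1" "(c + (2+2*c) mod 3) mod 3 = 2"
          "((0+2*c) mod 3 + 1) mod 3 = (1+2*c) mod 3" "((1+2*c) mod 3 + 1) mod 3 = (2+2*c) mod 3"
          using c by presburger+
        show "bt (e c) (lab \<mu> c) n = bt (e c) (lab \<nu> c) n"
        proof (rule ccontr)
          assume "\<not> ?thesis"
          then have ne: "sb \<mu> c n \<noteq> sb \<nu> c n" by (simp add: sb_def \<mu> \<nu>)
          have 1: "\<alpha> \<mu> ((0+2*c) mod 3) i1 (c, n) < block_dim m (1,1,0) (sb \<mu> c n) 0"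
            using \<alpha>_less[OF ix(1) c n(1)] unfolding md \<mu>(2) n(2) .
          have 2: "\<alpha> \<mu> ((1+2*c) mod 3) j1 (c, n) < block_dim m (1,1,0) (sb \<mu> c n) 1"
            using \<alpha>_less[OF ix(2) c n(1)] unfolding md \<mu>(2) n(2) .
          have 3: "\<alpha> \<nu> ((1+2*c) mod 3) i2 (c, n) < block_dim m (1,1,0) (sb \<nu> c n) 1"
            using \<alpha>_less[OF ix(3) c n(1)] unfolding md \<nu>(2) n(2) .
          have 4: "\<alpha> \<nu> ((2+2*c) mod 3) j2 (c, n) < block_dim m (1,1,0) (sb \<nu> c n) 2"
            using \<alpha>_less[OF ix(4) c n(1)] unfolding md \<nu>(2) n(2) .
          have "entry (T_A m) (dg ((0+2*c) mod 3) \<mu> i1 j1 c n) (dg ((1+2*c) mod 3) \<nu> i2 j2 c n) l = 0" for l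
            unfolding dg_def md \<mu>(2) \<nu>(2) n(2) by (rule entry_label_mismatch[OF m ne 1 2 3 4])
          then show False using nz'[OF n(1)] by simp
        qed
      qed
      have l0: "lab \<kappa> 0 = lab \<kappa>' 0"
      proof (rule labels[of 0 \<kappa> \<kappa>' i j j' k])
        fix n assume "n < N"
        then have "entry (T_A m) (dg 0 \<kappa> i j 0 n) (dg 1 \<kappa>' j' k 0 n) (dg 2 \<kappa>'' k' i' 0 n) \<noteq> 0"
          using tcnz[of 0 n] by (simp add: rotated_entry_def unrotate_def)
        then show "\<exists>l. entry (T_A m) (dg ((0+2*0) mod 3) \<kappa> i j 0 n) (dg ((1+2*0) mod 3) \<kappa>' j' k 0 n) l \<noteq> 0"
          by (intro exI) (simp add: numeral_2_eq_2)
      qed (use \<kappa> fst_eq ijk in \<open>auto simp: numeral_2_eq_2\<close>)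
      have l1: "lab \<kappa>'' 1 = lab \<kappa> 1"
      proof (rule labels[of 1 \<kappa>'' \<kappa> k' i' i j])
        fix n assume "n < N"
        then have "entry (T_A m) (dg 2 \<kappa>'' k' i' 1 n) (dg 0 \<kappa> i j 1 n) (dg 1 \<kappa>' j' k 1 n) \<noteq> 0"
          using tcnz[of 1 n] by (simp add: rotated_entry_def unrotate_def)
        then show "\<exists>l. entry (T_A m) (dg ((0+2*1) mod 3) \<kappa>'' k' i' 1 n) (dg ((1+2*1) mod 3) \<kappa> i j 1 n) l \<noteq> 0"
          by (intro exI) (simp add: numeral_2_eq_2)
      qed (use \<kappa> fst_eq ijk in \<open>auto simp: numeral_2_eq_2\<close>)
      have l2: "lab \<kappa>' 2 = lab \<kappa>'' 2"
      proof (rule labels[of 2 \<kappa>' \<kappa>'' j' k k' i'])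
        fix n assume "n < N"
        then have "entry (T_A m) (dg 1 \<kappa>' j' k 2 n) (dg 2 \<kappa>'' k' i' 2 n) (dg 0 \<kappa> i j 2 n) \<noteq> 0"
          using tcnz[of 2 n] by (simp add: rotated_entry_def unrotate_def)
        then show "\<exists>l. entry (T_A m) (dg ((0+2*2) mod 3) \<kappa>' j' k 2 n) (dg ((1+2*2) mod 3) \<kappa>'' k' i' 2 n) l \<noteq> 0"
          by (intro exI) (simp add: numeral_2_eq_2)
      qed (use \<kappa> fst_eq ijk in \<open>auto simp: numeral_2_eq_2\<close>)
      have ipe: "ip \<kappa>' 0 = ip \<kappa> 0" "ip \<kappa>'' 1 = ip \<kappa> 1" "ip \<kappa>'' 2 = ip \<kappa>' 2" using l0 l1 l2 by (auto simp: ip_def)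
      have St: "?St = (ip \<kappa> 0 + ip \<kappa> 1 + ip \<kappa>' 2 - C)^2"
        unfolding ipe by (rule strassen_weight_eq)
      have w': "wx \<kappa> + wy \<kappa>' + wz \<kappa>'' = (ip \<kappa> 0 + ip \<kappa> 1 + ip \<kappa>' 2 - C)^2"
        unfolding w St using True by simp
      have "\<kappa> = \<kappa>' \<and> \<kappa> = \<kappa>''" if "wx \<kappa> + wy \<kappa>' + wz \<kappa>'' = 0"
      proof -
        have s: "ip \<kappa> 0 + ip \<kappa> 1 + ip \<kappa>' 2 = C" using that unfolding w' by simp
        have "ip \<kappa>' 1 = ip \<kappa> 1" "ip \<kappa>'' 0 = ip \<kappa> 0"
          using s ipsum[OF \<kappa>(2)] ipsum[OF \<kappa>(3)] unfolding ipe by linarith+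
        then have "lab \<kappa>' 0 = lab \<kappa> 0" "lab \<kappa>' 1 = lab \<kappa> 1" "lab \<kappa>'' 0 = lab \<kappa> 0" "lab \<kappa>'' 1 = lab \<kappa> 1"
          using ipe by (auto simp: ip_def)
        then show ?thesis using fst_eq by (simp add: lab_def prod_eq_iff)
      qed
      then show ?thesis unfolding w' by simp
    qed
  qed
  have diag_entry: "entry (kron_power (symmetrization (T_A m)) N) (encode3 m N (dg 0 \<kappa> i j)) (encode3 m N (dg 1 \<kappa> j' k))
        (encode3 m N (dg 2 \<kappa> k' i')) = of_bool (i = i' \<and> j = j' \<and> k = k')"
    if \<kappa>: "\<kappa> \<in> Ks" and ijk: "i < A \<kappa> 0" "j < A \<kappa> 1" "j' < A \<kappa> 1" "k < A \<kappa> 2" "k' < A \<kappa> 2" "i' < A \<kappa> 0" for \<kappa> i j j' k k' i'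
  proof -
    have prod_of_bool: "(\<Prod>p\<in>D. of_bool (Q p) :: complex) = of_bool (\<forall>p\<in>D. Q p)" for Q
      using finD by (induction D rule: finite_induct) auto
    have "(\<Prod>(c, n)\<in>D. rotated_entry m c (dg 0 \<kappa> i j c n) (dg 1 \<kappa> j' k c n) (dg 2 \<kappa> k' i' c n))
      = (\<Prod>p\<in>D. of_bool (\<alpha> \<kappa> 0 i p = \<alpha> \<kappa> 0 i' p \<and> \<alpha> \<kappa> 1 j p = \<alpha> \<kappa> 1 j' p \<and> \<alpha> \<kappa> 2 k p = \<alpha> \<kappa> 2 k' p))"
    proof (rule prod.cong[OF refl])
      fix p assume "p \<in> D"
      then obtain c n where p: "p = (c, n)" "c < 3" "n < N" by (auto simp: D_def)
      have "rotated_entry m c (dg 0 \<kappa> i j c n) (dg 1 \<kappa> j' k c n) (dg 2 \<kappa> k' i' c n) =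
        of_bool (\<alpha> \<kappa> 0 i (c, n) = \<alpha> \<kappa> 0 i' (c, n) \<and> \<alpha> \<kappa> 1 j (c, n) = \<alpha> \<kappa> 1 j' (c, n) \<and> \<alpha> \<kappa> 2 k (c, n) = \<alpha> \<kappa> 2 k' (c, n))"
      proof -
        have c0: "(c + 0) mod 3 = c" using p(2) by simp
        have fe: "fst \<kappa> c ! n \<in> Phi" using \<kappa> p PhiL eL by (auto simp: Ks_def)
        note less = \<alpha>_less[OF _ p(2,3), of _ \<kappa> 0, unfolded c0] \<alpha>_less[OF _ p(2,3), of _ \<kappa> 1] \<alpha>_less[OF _ p(2,3), of _ \<kappa> 2]
        show ?thesis
          unfolding dg_def mods c0 by (rule rotated_entry_block_index[OF m fe p(2)]) (use ijk less in blast)+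
      qed
      then show "(case p of (c, n) \<Rightarrow> rotated_entry m c (dg 0 \<kappa> i j c n) (dg 1 \<kappa> j' k c n) (dg 2 \<kappa> k' i' c n)) =
        of_bool (\<alpha> \<kappa> 0 i p = \<alpha> \<kappa> 0 i' p \<and> \<alpha> \<kappa> 1 j p = \<alpha> \<kappa> 1 j' p \<and> \<alpha> \<kappa> 2 k p = \<alpha> \<kappa> 2 k' p)"
        unfolding p(1) prod.case .
    qed
    also have "\<dots> = of_bool (i = i' \<and> j = j' \<and> k = k')"
      unfolding prod_of_bool ball_conj_distrib \<alpha>_inj[OF ijk(1,6)] \<alpha>_inj[OF ijk(2,3)] \<alpha>_inj[OF ijk(4,5)] ..
    finally show ?thesis unfolding entry_eq[OF ijk] .
  qed
  have "kron_power (symmetrization (T_A m)) N \<unrhd> matmuls abcs"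
  proof (rule degenerates_to_matmuls[where a = "\<lambda>t. A (\<kappa>s ! t) 0" and b = "\<lambda>t. A (\<kappa>s ! t) 1" and c = "\<lambda>t. A (\<kappa>s ! t) 2"
        and F = "\<lambda>t i j. encode3 m N (dg 0 (\<kappa>s ! t) i j)" and G = "\<lambda>t i j. encode3 m N (dg 1 (\<kappa>s ! t) i j)"
        and H = "\<lambda>t i j. encode3 m N (dg 2 (\<kappa>s ! t) i j)" and ?w1.0 = "\<lambda>t. wx (\<kappa>s ! t)" and ?w2.0 = "\<lambda>t. wy (\<kappa>s ! t)"
        and ?w3.0 = "\<lambda>t. wz (\<kappa>s ! t)"]; (unfold len)?)
    show "abcs ! t = (A (\<kappa>s ! t) 0, A (\<kappa>s ! t) 1, A (\<kappa>s ! t) 2)" if "t < length \<kappa>s" for t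
      using that by (simp add: abcs_def)
    show "encode3 m N (dg 0 (\<kappa>s ! t) i j) < dim1 (kron_power (symmetrization (T_A m)) N)"
      if "t < length \<kappa>s" "i < A (\<kappa>s ! t) 0" "j < A (\<kappa>s ! t) 1" for t i j
      unfolding dims_kron_power dims_symmetrization_T_A
      by (rule encode3_less, rule dg_less) (use that in \<open>simp_all add: mods\<close>)
    show "encode3 m N (dg 1 (\<kappa>s ! t) i j) < dim2 (kron_power (symmetrization (T_A m)) N)"
      if "t < length \<kappa>s" "i < A (\<kappa>s ! t) 1" "j < A (\<kappa>s ! t) 2" for t i j
      unfolding dims_kron_power dims_symmetrization_T_A
      by (rule encode3_less, rule dg_less) (use that in \<open>simp_all add: numeral_2_eq_2\<close>)
    show "encode3 m N (dg 2 (\<kappa>s ! t) i j) < dim3 (kron_power (symmetrization (T_A m)) N)"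
      if "t < length \<kappa>s" "i < A (\<kappa>s ! t) 2" "j < A (\<kappa>s ! t) 0" for t i j
      unfolding dims_kron_power dims_symmetrization_T_A
      by (rule encode3_less, rule dg_less) (use that in \<open>simp_all add: mods\<close>)
  next
    fix t t' t'' i j j' k k' i'
    assume t: "t < length \<kappa>s" "t' < length \<kappa>s" "t'' < length \<kappa>s" and ijk: "i < A (\<kappa>s ! t) 0" "j < A (\<kappa>s ! t) 1"
      "j' < A (\<kappa>s ! t') 1" "k < A (\<kappa>s ! t') 2" "k' < A (\<kappa>s ! t'') 2" "i' < A (\<kappa>s ! t'') 0"
      and nz: "entry (kron_power (symmetrization (T_A m)) N) (encode3 m N (dg 0 (\<kappa>s ! t) i j)) (encode3 m N (dg 1 (\<kappa>s ! t') j' k))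
        (encode3 m N (dg 2 (\<kappa>s ! t'') k' i')) \<noteq> 0"
    show "0 \<le> wx (\<kappa>s ! t) + wy (\<kappa>s ! t') + wz (\<kappa>s ! t'') \<and>
      (wx (\<kappa>s ! t) + wy (\<kappa>s ! t') + wz (\<kappa>s ! t'') = 0 \<longrightarrow> t = t' \<and> t = t'')"
      using nonneg[OF inKs[OF t(1)] inKs[OF t(2)] inKs[OF t(3)] ijk nz] \<kappa>s(2) t by (simp add: nth_eq_iff_index_eq)
  next
    fix t i j j' k k' i'
    assume t: "t < length \<kappa>s" and ijk: "i < A (\<kappa>s ! t) 0" "j < A (\<kappa>s ! t) 1"
      "j' < A (\<kappa>s ! t) 1" "k < A (\<kappa>s ! t) 2" "k' < A (\<kappa>s ! t) 2" "i' < A (\<kappa>s ! t) 0"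
    have "wx (\<kappa>s ! t) + wy (\<kappa>s ! t) + wz (\<kappa>s ! t) = (ip (\<kappa>s ! t) 0 + ip (\<kappa>s ! t) 1 + ip (\<kappa>s ! t) 2 - C)^2"
      unfolding strassen_weight_eq[symmetric] wx_def wy_def wz_def by simp
    also have "\<dots> = 0" using ipsum[OF inKs[OF t]] by simp
    finally show "wx (\<kappa>s ! t) + wy (\<kappa>s ! t) + wz (\<kappa>s ! t) = 0 \<and>
      entry (kron_power (symmetrization (T_A m)) N) (encode3 m N (dg 0 (\<kappa>s ! t) i j)) (encode3 m N (dg 1 (\<kappa>s ! t) j' k))
        (encode3 m N (dg 2 (\<kappa>s ! t) k' i')) = of_bool (i = i' \<and> j = j' \<and> k = k')"
      using diag_entry[OF inKs[OF t] ijk] by simp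
  qed
  moreover have "\<forall>(a, b, c)\<in>set abcs. 1 \<le> a \<and> 1 \<le> b \<and> 1 \<le> c"
    using Apos by (auto simp: abcs_def)
  moreover have "real (card (permutations_of_multiset (image_mset (proj 0) M)) * card (permutations_of_multiset (image_mset (proj 1) M)) *
      card (permutations_of_multiset (image_mset (proj 2) M)) * (K * K)) * real (\<Prod>\<phi>\<in>#M. block_vol m \<phi>) powr omega
    \<le> 56 * (\<Sum>(a, b, c)\<leftarrow>abcs. real (a * b * c) powr (omega / 3))" (is "real (?B * (K * K)) * ?V \<le> _")
  proof -
    \<comment> \<open>Every copy contributes the full product of block volumes, whatever the labels.
      The resulting cube turns the exponent \<open>omega / 3\<close> into
      \<open>omega\<close>.\<close>
    have volprod: "A \<kappa> 0 * A \<kappa> 1 * A \<kappa> 2 = (\<Prod>\<phi>\<in>#M. block_vol m \<phi>) ^ 3" if "\<kappa> \<in> Ks" for \<kappa>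
    proof -
      have "A \<kappa> 0 * A \<kappa> 1 * A \<kappa> 2 = (\<Prod>p\<in>D. dm \<kappa> 0 p * dm \<kappa> 1 p * dm \<kappa> 2 p)"
        by (simp add: A_def prod.distrib)
      also have "\<dots> = (\<Prod>(c, n)\<in>D. block_vol m (fst \<kappa> c ! n))"
        by (rule prod.cong[OF refl]) (auto simp: D_def dm_def block_dim_prod[simplified])
      also have "\<dots> = (\<Prod>c<3. \<Prod>n<N. block_vol m (fst \<kappa> c ! n))"
        by (simp add: D_def prod.cartesian_product)
      also have "\<dots> = (\<Prod>c<3 :: nat. \<Prod>\<phi>\<in>#M. block_vol m \<phi>)"
      proof (rule prod.cong[OF refl])
        fix c :: nat assume "c \<in> {..<3}"
        then have c: "fst \<kappa> c \<in> L" using that eL by (auto simp: Ks_def)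
        have "(\<Prod>n<N. block_vol m (fst \<kappa> c ! n)) = prod_list (map (block_vol m) (fst \<kappa> c))"
          using lenL[OF c] by (simp add: prod.list_conv_set_nth atLeast0LessThan)
        also have "\<dots> = (\<Prod>\<phi>\<in>#M. block_vol m \<phi>)"
          unfolding msetL[OF c, symmetric] by (simp add: prod_mset_prod_list[symmetric])
        finally show "(\<Prod>n<N. block_vol m (fst \<kappa> c ! n)) = (\<Prod>\<phi>\<in>#M. block_vol m \<phi>)" .
      qed
      finally show ?thesis by simp
    qed
    have "(\<Sum>(a, b, c)\<leftarrow>abcs. real (a * b * c) powr (omega / 3)) = (\<Sum>\<kappa>\<leftarrow>\<kappa>s. real (A \<kappa> 0 * A \<kappa> 1 * A \<kappa> 2) powr (omega / 3))"
      by (simp add: abcs_def comp_def)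
    also have "\<dots> = (\<Sum>\<kappa>\<in>Ks. real (A \<kappa> 0 * A \<kappa> 1 * A \<kappa> 2) powr (omega / 3))"
      unfolding \<kappa>s(1)[symmetric] using \<kappa>s(2) by (rule sum_list_distinct_conv_sum_set)
    also have "\<dots> = (\<Sum>\<kappa>\<in>Ks. ?V)"
    proof (rule sum.cong[OF refl])
      fix \<kappa> assume "\<kappa> \<in> Ks"
      have "real ((\<Prod>\<phi>\<in>#M. block_vol m \<phi>) ^ 3) powr (omega / 3) = ?V"
        using power3_powr[of "real (\<Prod>\<phi>\<in>#M. block_vol m \<phi>)"] by simp
      then show "real (A \<kappa> 0 * A \<kappa> 1 * A \<kappa> 2) powr (omega / 3) = ?V" unfolding volprod[OF \<open>\<kappa> \<in> Ks\<close>] .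
    qed
    also have "\<dots> = real (card Ks) * ?V" by simp
    finally have sum: "(\<Sum>(a, b, c)\<leftarrow>abcs. real (a * b * c) powr (omega / 3)) = real (card Ks) * ?V" .
    \<comment> \<open>56 is the 28 from the independent blocks times the 2 from the triangle of
      labels.\<close>
    have "?B * (K * K) \<le> (28 * card S') * (2 * card {(p, q). p + q < K})"
      by (rule mult_le_mono[OF size card_triangle])
    also have "\<dots> = 56 * card Ks" by (simp add: Ks_def card_cartesian_product)
    finally have "real (?B * (K * K)) \<le> 56 * real (card Ks)" by (metis of_nat_le_iff of_nat_mult of_nat_numeral)
    then have "real (?B * (K * K)) * ?V \<le> 56 * real (card Ks) * ?V" by (rule mult_right_mono) simp
    then show ?thesis unfolding sum by (simp only: mult.assoc)
  qed
  ultimately show ?thesis unfolding N_def by (intro exI[of _ abcs]) blast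
qed

section \<open>The value of the symmetrized structure tensor\<close>

definition value_sums :: "nat \<Rightarrow> nat \<Rightarrow> real set" where
  "value_sums N m = {\<Sum>(a, b, c)\<leftarrow>abcs. real (a * b * c) powr (omega / 3) | abcs.
     (\<forall>(a, b, c)\<in>set abcs. 1 \<le> a \<and> 1 \<le> b \<and> 1 \<le> c) \<and>
     kron_power (symmetrization (T_A m)) N \<unrhd> matmuls abcs}"

lemma value_sums_le: "1 \<le> m \<Longrightarrow> x \<in> value_sums N m \<Longrightarrow> x \<le> ((3 * real m + 3) ^ 3) ^ N"
  unfolding value_sums_def using value_level_sum_le by blast

text \<open>The empty direct sum makes the set under \<open>Sup\<close> nonempty and the value
  nonnegative.\<close>

lemma zero_in_value_sums: "0 \<in> value_sums N m"
proof -
  have "kron_power (symmetrization (T_A m)) N \<unrhd> matmuls []"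
    by (rule degenerates_to_matmuls[where F = "\<lambda>_ _ _. 0" and G = "\<lambda>_ _ _. 0" and H = "\<lambda>_ _ _. 0" and a = "\<lambda>_. 0"
          and b = "\<lambda>_. 0" and c = "\<lambda>_. 0" and ?w1.0 = "\<lambda>_. 0" and ?w2.0 = "\<lambda>_. 0" and ?w3.0 = "\<lambda>_. 0"]) auto
  then show ?thesis unfolding value_sums_def by (intro CollectI exI[of _ "[]"]) simp
qed

lemma value_level_bounds:
  assumes "1 \<le> m"
  shows "x \<in> value_sums N m \<Longrightarrow> x \<le> value_level N (symmetrization (T_A m))"
    and "0 \<le> value_level N (symmetrization (T_A m))"
    and "value_level N (symmetrization (T_A m)) \<le> ((3 * real m + 3) ^ 3) ^ N"
proof -
  have bdd: "bdd_above (value_sums N m)" by (rule bdd_aboveI) (rule value_sums_le[OF assms])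
  have eq: "value_level N (symmetrization (T_A m)) = Sup (value_sums N m)"
    by (simp add: value_level_def value_sums_def)
  show 1: "x \<le> value_level N (symmetrization (T_A m))" if "x \<in> value_sums N m" for x
    unfolding eq using that bdd by (rule cSup_upper)
  show "0 \<le> value_level N (symmetrization (T_A m))" by (rule 1[OF zero_in_value_sums])
  show "value_level N (symmetrization (T_A m)) \<le> ((3 * real m + 3) ^ 3) ^ N"
    unfolding eq
  proof (rule cSup_least)
    show "value_sums N m \<noteq> {}" using zero_in_value_sums[of N m] by auto
  qed (rule value_sums_le[OF assms])
qed

lemma value_level_root_le:
  assumes "1 \<le> m" "1 \<le> N"
  shows "value_level N (symmetrization (T_A m)) powr (1 / real N) \<le> (3 * real m + 3) ^ 3"
proof -
  have "value_level N (symmetrization (T_A m)) powr (1 / real N) \<le> (((3 * real m + 3) ^ 3) ^ N) powr (1 / real N)"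
    using value_level_bounds(2,3)[OF assms(1)] by (intro powr_mono2) auto
  also have "\<dots> = (3 * real m + 3) ^ 3"
  proof -
    have pos: "0 < (3 * real m + 3) ^ 3" by simp
    have "((3 * real m + 3) ^ 3) ^ N = ((3 * real m + 3) ^ 3) powr real N" using powr_realpow[OF pos] by simp
    then show ?thesis using assms(2) pos by (simp only: powr_powr) simp
  qed
  finally show ?thesis .
qed

lemma tensor_value_le:
  assumes "1 \<le> m"
  shows "tensor_value (symmetrization (T_A m)) \<le> (3 * real m + 3) ^ 3"
  unfolding tensor_value_def using value_level_root_le[OF assms] by (intro cSUP_least) auto

lemma tensor_value_ge:
  assumes "1 \<le> m" "1 \<le> N" "x \<in> value_sums N m" "0 \<le> x"
  shows "x powr (1 / real N) \<le> tensor_value (symmetrization (T_A m))"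
proof -
  have "x powr (1 / real N) \<le> value_level N (symmetrization (T_A m)) powr (1 / real N)"
    using value_level_bounds(1)[OF assms(1,3)] assms(4) by (intro powr_mono2) auto
  also have "\<dots> \<le> tensor_value (symmetrization (T_A m))"
    unfolding tensor_value_def
    by (rule cSUP_upper) (use assms(2) value_level_root_le[OF assms(1)] in \<open>auto intro!: bdd_aboveI2\<close>)
  finally show ?thesis .
qed

text \<open>A weak form of Stirling's formula, by induction from ln(1 + x) <= x. An error
  logarithmic in \<open>n\<close> suffices, as it is divided by \<open>N\<close> in the end.\<close>

lemma ln_fact_bounds:
  "real n * ln (real n) - real n \<le> ln (fact n)"
  "ln (fact n) \<le> real n * ln (real n) - real n + 1 + 2 * ln (real n + 1)"
proof -
  have "real n * ln (real n) - real n \<le> ln (fact n) \<and> ln (fact n) \<le> real n * ln (real n) - real n + 1 + 2 * ln (real n + 1)"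
  proof (induction n)
    case (Suc n)
    have f: "ln (fact (Suc n)) = ln (real n + 1) + ln (fact n)"
      by (simp add: ln_mult add.commute)
    have d: "real n * ln (real n + 1) - 1 \<le> real n * ln (real n)"
    proof (cases "n = 0")
      case False
      have "ln (real n + 1) - ln (real n) = ln (1 + 1 / real n)"
      proof -
        have "1 + 1 / real n = (real n + 1) / real n" using False by (simp add: field_simps)
        then show ?thesis using False by (simp add: ln_div)
      qed
      also have "\<dots> \<le> 1 / real n" using False by (intro ln_add_one_self_le_self) simp
      finally have "real n * (ln (real n + 1) - ln (real n)) \<le> real n * (1 / real n)" by (intro mult_left_mono) auto
      then show ?thesis using False by (simp add: algebra_simps)
    qed simp
    have u: "real n * ln (real n) + real n / (real n + 1) \<le> real n * ln (real n + 1)"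
    proof (cases "n = 0")
      case False
      have "ln (real n / (real n + 1)) \<le> real n / (real n + 1) - 1"
        using False by (intro ln_le_minus_one) simp
      then have "ln (real n) - ln (real n + 1) \<le> - (1 / (real n + 1))"
        using False by (simp add: ln_div field_simps)
      then have "real n * (ln (real n) - ln (real n + 1)) \<le> real n * - (1 / (real n + 1))" by (intro mult_left_mono) auto
      then show ?thesis by (simp add: algebra_simps)
    qed simp
    have "ln ((real n + 1) / (real n + 2)) \<le> (real n + 1) / (real n + 2) - 1" by (intro ln_le_minus_one) simp
    then have u2: "ln (real n + 1) + 1 / (real n + 2) \<le> ln (real n + 2)" by (simp add: ln_div field_simps)
    have "real n / (real n + 1) = 1 - 1 / (real n + 1)" by (simp add: field_simps)
    moreover have "1 / (real n + 1) \<le> 2 / (real n + 2)" by (simp add: divide_simps)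
    ultimately have "1 \<le> real n / (real n + 1) + 2 * (1 / (real n + 2))" by simp
    then have "1 + real n * ln (real n) + 2 * ln (real n + 1) \<le> real n * ln (real n + 1) + 2 * ln (real n + 2)"
      using u u2 by linarith
    then show ?case using Suc d unfolding f by (simp add: algebra_simps)
  qed simp
  then show "real n * ln (real n) - real n \<le> ln (fact n)"
    "ln (fact n) \<le> real n * ln (real n) - real n + 1 + 2 * ln (real n + 1)" by blast+
qed

text \<open>A multinomial coefficient with three factorials in the denominator, each of which costs
  an error of 1 + 2 ln(N + 1).\<close>

lemma ln_card_permutations_ge:
  fixes M :: "nat multiset"
  assumes "set_mset M \<subseteq> {..<3}" "size M = N" "N \<ge> 1"
  shows "ln (real (card (permutations_of_multiset M)))
    \<ge> real N * (- (\<Sum>y<3. real (count M y) / real N * ln (real (count M y) / real N))) - 3 - 6 * ln (real N + 1)"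
proof -
  let ?c = "count M"
  have "card (permutations_of_multiset M) * (\<Prod>y\<in>set_mset M. fact (?c y)) = fact N"
    using card_permutations_of_multiset_aux[of M] assms(2) by simp
  also have "(\<Prod>y\<in>set_mset M. fact (?c y) :: nat) = (\<Prod>y<3. fact (?c y))"
    using assms(1) by (intro prod.mono_neutral_left) (auto simp: not_in_iff)
  finally have eq: "card (permutations_of_multiset M) * (\<Prod>y<3. fact (?c y)) = (fact N :: nat)" .
  have pos: "card (permutations_of_multiset M) > 0" by (auto simp: card_gt_0_iff permutations_of_multiset_not_empty)
  have "real (card (permutations_of_multiset M)) * (\<Prod>y<3. fact (?c y)) = fact N"
    using arg_cong[OF eq, of real] by simp
  then have "ln (fact N) = ln (real (card (permutations_of_multiset M)) * (\<Prod>y<3. fact (?c y)))" by simp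
  also have "\<dots> = ln (real (card (permutations_of_multiset M))) + ln (\<Prod>y<3. fact (?c y))"
    by (rule ln_mult_pos) (use pos in \<open>auto intro: prod_pos\<close>)
  also have "ln (\<Prod>y<3. fact (?c y) :: real) = (\<Sum>y<3. ln (fact (?c y)))" by (rule ln_prod) auto
  finally have "ln (real (card (permutations_of_multiset M))) + (\<Sum>y<3. ln (fact (?c y))) = ln (fact N)" by simp
  moreover have "(\<Sum>y<3. ln (fact (?c y))) \<le> (\<Sum>y<3. real (?c y) * ln (real (?c y)) - real (?c y) + 1 + 2 * ln (real N + 1))"
  proof (rule sum_mono)
    fix y
    have "?c y \<le> N" using assms(2) count_le_size by metis
    then have "ln (real (?c y) + 1) \<le> ln (real N + 1)" by simp
    then show "ln (fact (?c y)) \<le> real (?c y) * ln (real (?c y)) - real (?c y) + 1 + 2 * ln (real N + 1)"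
      using ln_fact_bounds(2)[of "?c y"] by linarith
  qed
  moreover have csum: "(\<Sum>y<3. real (?c y)) = real N"
  proof -
    have "size M = (\<Sum>y\<in>set_mset M. ?c y)" by (rule size_multiset_overloaded_eq)
    also have "\<dots> = (\<Sum>y<3. ?c y)" using assms(1) by (intro sum.mono_neutral_left) (auto simp: not_in_iff)
    finally show ?thesis using assms(2) by (metis of_nat_sum)
  qed
  moreover have "real N * (- (\<Sum>y<3. real (?c y) / real N * ln (real (?c y) / real N)))
      = real N * ln (real N) - (\<Sum>y<3. real (?c y) * ln (real (?c y)))"
  proof -
    have "real N * (real (?c y) / real N * ln (real (?c y) / real N)) = real (?c y) * ln (real (?c y)) - real (?c y) * ln (real N)" for y
      using assms(3) by (cases "?c y = 0") (auto simp: ln_div algebra_simps)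
    then have "real N * (\<Sum>y<3. real (?c y) / real N * ln (real (?c y) / real N))
      = (\<Sum>y<3. real (?c y) * ln (real (?c y))) - (\<Sum>y<3. real (?c y)) * ln (real N)"
      unfolding sum_distrib_left sum_distrib_right sum_subtractf[symmetric] by (intro sum.cong) auto
    then show ?thesis unfolding csum by simp
  qed
  ultimately show ?thesis
    using ln_fact_bounds(1)[of N] by (simp add: sum.distrib sum_subtractf)
qed

text \<open>At p = 0 the logarithm is not continuous, and the product is bounded by twice a square
  root instead. Since \<open>ln 0 = 0\<close> in HOL, the convention for entropies holds by
  itself.\<close>

lemma tendsto_x_ln_x:
  fixes x :: "nat \<Rightarrow> real"
  assumes lim: "x \<longlonglongrightarrow> p" and nn: "\<And>n. 0 \<le> x n"
  shows "(\<lambda>n. x n * ln (x n)) \<longlonglongrightarrow> p * ln p"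
proof (cases "p = 0")
  case False
  then show ?thesis by (intro tendsto_mult tendsto_ln lim)
next
  case True
  have b: "\<bar>y * ln y\<bar> \<le> 2 * sqrt y" if "0 \<le> y" "y \<le> 1" for y :: real
  proof (cases "y = 0")
    case False
    then have y: "y > 0" using that by simp
    have "ln (1 / sqrt y) \<le> 1 / sqrt y - 1" using y by (intro ln_le_minus_one) simp
    moreover have "ln (1 / sqrt y) = - ln y / 2" using y by (simp add: ln_div ln_sqrt)
    ultimately have "- ln y \<le> 2 / sqrt y" using y by simp
    then have "y * - ln y \<le> y * (2 / sqrt y)" using y by (intro mult_left_mono) auto
    also have "y * (2 / sqrt y) = 2 * sqrt y" using y by (simp add: field_simps)
    finally have "- (y * ln y) \<le> 2 * sqrt y" by simp
    moreover have "y * ln y \<le> 0" using y that by (simp add: mult_le_0_iff)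
    ultimately show ?thesis by simp
  qed simp
  have "eventually (\<lambda>n. x n < 1) sequentially" using lim True by (intro order_tendstoD(2)[of x 0]) auto
  then have ev: "eventually (\<lambda>n. norm (x n * ln (x n)) \<le> 2 * sqrt (x n)) sequentially"
    by eventually_elim (use b nn in auto)
  have "(\<lambda>n. 2 * sqrt (x n)) \<longlonglongrightarrow> 2 * sqrt 0"
    by (intro tendsto_intros) (use lim True in simp)
  then have "(\<lambda>n. 2 * sqrt (x n)) \<longlonglongrightarrow> 0" by simp
  with ev have "(\<lambda>n. x n * ln (x n)) \<longlonglongrightarrow> 0" by (rule Lim_null_comparison)
  then show ?thesis using True by simp
qed

section \<open>Distributions on the block types and their integer approximations\<close>

definition coord_prob :: "(nat \<times> nat \<times> nat) pmf \<Rightarrow> nat \<Rightarrow> nat \<Rightarrow> real" where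
  "coord_prob P a y = (\<Sum>\<phi>\<in>Phi. if proj a \<phi> = y then pmf P \<phi> else 0)"

lemma finite_Phi [simp]: "finite Phi"
  by (simp add: Phi_def)

lemma pmf_entropy_map_proj:
  assumes "set_pmf P \<subseteq> Phi"
  shows "pmf_entropy (map_pmf (proj a) P) = - (\<Sum>y<3. coord_prob P a y * ln (coord_prob P a y))"
proof -
  have p: "pmf (map_pmf (proj a) P) y = coord_prob P a y" for y
  proof -
    have "pmf (map_pmf (proj a) P) y = measure (measure_pmf P) (proj a -` {y})" by (rule pmf_map)
    also have "\<dots> = measure (measure_pmf P) {\<phi> \<in> Phi. proj a \<phi> = y}"
      by (rule measure_pmf.finite_measure_eq_AE) (use assms in \<open>auto simp: AE_measure_pmf_iff\<close>)
    also have "\<dots> = (\<Sum>\<phi>\<in>{\<phi> \<in> Phi. proj a \<phi> = y}. pmf P \<phi>)" by (rule measure_measure_pmf_finite) simp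
    also have "\<dots> = coord_prob P a y" unfolding coord_prob_def by (rule sum.inter_filter) simp
    finally show ?thesis .
  qed
  have "set_pmf (map_pmf (proj a) P) \<subseteq> {..<3}" using assms by (auto simp: Phi_def proj_def)
  then have "(\<Sum>y\<in>set_pmf (map_pmf (proj a) P). pmf (map_pmf (proj a) P) y * ln (pmf (map_pmf (proj a) P) y))
    = (\<Sum>y<3. pmf (map_pmf (proj a) P) y * ln (pmf (map_pmf (proj a) P) y))"
    by (intro sum.mono_neutral_left) (auto simp: set_pmf_iff simp del: set_map_pmf)
  then show ?thesis unfolding pmf_entropy_def p by simp
qed

lemma marg_eq: "marg1 P = map_pmf (proj 0) P" "marg2 P = map_pmf (proj 1) P" "marg3 P = map_pmf (proj 2) P"
  unfolding marg1_def marg2_def marg3_def by (intro arg_cong[where f = "\<lambda>f. map_pmf f P"] ext; auto simp: proj_def)+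

text \<open>The multiples of the probabilities are rounded down, and (0,0,2) absorbs the remainder,
  so that the counts add up to exactly \<open>N\<close>.\<close>

definition approx_count :: "(nat \<times> nat \<times> nat) pmf \<Rightarrow> nat \<Rightarrow> nat \<times> nat \<times> nat \<Rightarrow> nat" where
  "approx_count P N \<phi> = (if \<phi> = (0,0,2) then N - (\<Sum>\<psi>\<in>Phi - {(0,0,2)}. nat \<lfloor>real N * pmf P \<psi>\<rfloor>)
     else nat \<lfloor>real N * pmf P \<phi>\<rfloor>)"

definition approx_mset :: "(nat \<times> nat \<times> nat) pmf \<Rightarrow> nat \<Rightarrow> (nat \<times> nat \<times> nat) multiset" where
  "approx_mset P N = (\<Sum>\<phi>\<in>Phi. replicate_mset (approx_count P N \<phi>) \<phi>)"

lemma count_approx_mset: "count (approx_mset P N) \<phi> = (if \<phi> \<in> Phi then approx_count P N \<phi> else 0)"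
proof -
  have "count (approx_mset P N) \<phi> = (\<Sum>\<psi>\<in>Phi. if \<psi> = \<phi> then approx_count P N \<psi> else 0)"
    unfolding approx_mset_def count_sum by (intro sum.cong) auto
  then show ?thesis by simp
qed

lemma set_approx_mset: "set_mset (approx_mset P N) \<subseteq> Phi"
  using count_approx_mset by (metis count_eq_zero_iff subsetI)

lemma sum_pmf_Phi: "set_pmf P \<subseteq> Phi \<Longrightarrow> (\<Sum>\<phi>\<in>Phi. pmf P \<phi>) = 1"
  by (rule sum_pmf_eq_1) auto

lemma approx_count_sum:
  assumes "set_pmf P \<subseteq> Phi"
  shows "(\<Sum>\<psi>\<in>Phi - {(0,0,2)}. nat \<lfloor>real N * pmf P \<psi>\<rfloor>) \<le> N" "size (approx_mset P N) = N"
proof -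
  have "real (\<Sum>\<psi>\<in>Phi - {(0,0,2)}. nat \<lfloor>real N * pmf P \<psi>\<rfloor>) \<le> (\<Sum>\<psi>\<in>Phi - {(0,0,2)}. real N * pmf P \<psi>)"
    unfolding of_nat_sum by (intro sum_mono) (simp add: of_nat_floor)
  also have "\<dots> \<le> (\<Sum>\<psi>\<in>Phi. real N * pmf P \<psi>)" by (intro sum_mono2) auto
  also have "\<dots> = real N" unfolding sum_distrib_left[symmetric] sum_pmf_Phi[OF assms] by simp
  finally show le: "(\<Sum>\<psi>\<in>Phi - {(0,0,2)}. nat \<lfloor>real N * pmf P \<psi>\<rfloor>) \<le> N" by (simp only: of_nat_le_iff)
  have "size (approx_mset P N) = (\<Sum>\<phi>\<in>Phi. approx_count P N \<phi>)"
    unfolding approx_mset_def by (simp add: size_multiset_sum)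
  also have "\<dots> = approx_count P N (0,0,2) + (\<Sum>\<phi>\<in>Phi - {(0,0,2)}. approx_count P N \<phi>)"
    by (rule sum.remove) (auto simp: Phi_def)
  also have "(\<Sum>\<phi>\<in>Phi - {(0,0,2)}. approx_count P N \<phi>) = (\<Sum>\<psi>\<in>Phi - {(0,0,2)}. nat \<lfloor>real N * pmf P \<psi>\<rfloor>)"
    by (intro sum.cong refl) (auto simp: approx_count_def)
  finally show "size (approx_mset P N) = N" using le by (simp add: approx_count_def)
qed

lemma approx_count_tendsto:
  assumes P: "set_pmf P \<subseteq> Phi" and "\<phi> \<in> Phi"
  shows "(\<lambda>N. real (approx_count P N \<phi>) / real N) \<longlonglongrightarrow> pmf P \<phi>"
proof -
  have fl: "(\<lambda>N. real (nat \<lfloor>real N * pmf P \<psi>\<rfloor>) / real N) \<longlonglongrightarrow> pmf P \<psi>" for \<psi>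
  proof (rule tendsto_sandwich)
    show "eventually (\<lambda>N. pmf P \<psi> - 1 / real N \<le> real (nat \<lfloor>real N * pmf P \<psi>\<rfloor>) / real N) sequentially"
    proof (intro eventually_sequentiallyI[of 1])
      fix N :: nat assume N: "1 \<le> N"
      have "real N * pmf P \<psi> - 1 \<le> real (nat \<lfloor>real N * pmf P \<psi>\<rfloor>)" by linarith
      then have "(real N * pmf P \<psi> - 1) / real N \<le> real (nat \<lfloor>real N * pmf P \<psi>\<rfloor>) / real N" by (intro divide_right_mono) auto
      then show "pmf P \<psi> - 1 / real N \<le> real (nat \<lfloor>real N * pmf P \<psi>\<rfloor>) / real N" using N by (simp add: diff_divide_distrib)
    qed
    show "eventually (\<lambda>N. real (nat \<lfloor>real N * pmf P \<psi>\<rfloor>) / real N \<le> pmf P \<psi>) sequentially"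
    proof (intro eventually_sequentiallyI[of 1])
      fix N :: nat assume N: "1 \<le> N"
      have "real (nat \<lfloor>real N * pmf P \<psi>\<rfloor>) \<le> real N * pmf P \<psi>" by (simp add: of_nat_floor)
      then show "real (nat \<lfloor>real N * pmf P \<psi>\<rfloor>) / real N \<le> pmf P \<psi>" using N by (simp add: field_simps)
    qed
    have "(\<lambda>N. pmf P \<psi> - 1 / real N) \<longlonglongrightarrow> pmf P \<psi> - 0" by (intro tendsto_diff tendsto_const lim_1_over_n)
    then show "(\<lambda>N. pmf P \<psi> - 1 / real N) \<longlonglongrightarrow> pmf P \<psi>" by simp
  qed simp
  show ?thesis
  proof (cases "\<phi> = (0,0,2)")
    case False
    then show ?thesis using fl by (simp add: approx_count_def)
  next
    case True
    have "(\<lambda>N. 1 - (\<Sum>\<psi>\<in>Phi - {(0,0,2)}. real (nat \<lfloor>real N * pmf P \<psi>\<rfloor>) / real N)) \<longlonglongrightarrow> 1 - (\<Sum>\<psi>\<in>Phi - {(0,0,2)}. pmf P \<psi>)"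
      by (intro tendsto_intros fl)
    also have "1 - (\<Sum>\<psi>\<in>Phi - {(0,0,2)}. pmf P \<psi>) = pmf P \<phi>"
      using sum_pmf_Phi[OF P] sum.remove[of Phi \<phi> "pmf P"] True assms(2) by simp
    finally have lim: "(\<lambda>N. 1 - (\<Sum>\<psi>\<in>Phi - {(0,0,2)}. real (nat \<lfloor>real N * pmf P \<psi>\<rfloor>) / real N)) \<longlonglongrightarrow> pmf P \<phi>" .
    have "eventually (\<lambda>N. 1 - (\<Sum>\<psi>\<in>Phi - {(0,0,2)}. real (nat \<lfloor>real N * pmf P \<psi>\<rfloor>) / real N)
      = real (approx_count P N \<phi>) / real N) sequentially"
    proof (intro eventually_sequentiallyI[of 1])
      fix N :: nat assume "1 \<le> N"
      then show "1 - (\<Sum>\<psi>\<in>Phi - {(0,0,2)}. real (nat \<lfloor>real N * pmf P \<psi>\<rfloor>) / real N) = real (approx_count P N \<phi>) / real N"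
        using approx_count_sum(1)[OF P, of N] True
        by (simp add: approx_count_def of_nat_diff diff_divide_distrib sum_divide_distrib)
    qed
    with lim show ?thesis by (rule Lim_transform_eventually)
  qed
qed

lemma count_image_proj:
  assumes "set_mset M \<subseteq> Phi"
  shows "count (image_mset (proj a) M) y = (\<Sum>\<phi>\<in>Phi. if proj a \<phi> = y then count M \<phi> else 0)"
proof -
  have "count (image_mset (proj a) M) y = (\<Sum>x\<in>proj a -` {y} \<inter> set_mset M. count M x)" by (rule count_image_mset)
  also have "\<dots> = (\<Sum>x\<in>Phi. if proj a x = y then count M x else 0)"
    using assms by (intro sum.mono_neutral_cong_left) (auto simp: not_in_iff[symmetric] split: if_splits)
  finally show ?thesis .
qed

lemma block_vol_pos: "1 \<le> m \<Longrightarrow> 0 < block_vol m \<phi>"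
  by (auto simp: block_vol_def)

lemma prod_block_vol_pos: "1 \<le> m \<Longrightarrow> 0 < real (\<Prod>\<phi>\<in>#M. block_vol m \<phi>)"
  by (induction M) (simp_all add: block_vol_pos)

lemma ln_prod_block_vol:
  assumes "1 \<le> m" "set_mset M \<subseteq> Phi"
  shows "ln (real (\<Prod>\<phi>\<in>#M. block_vol m \<phi>)) = (\<Sum>\<phi>\<in>Phi. real (count M \<phi>) * ln (real (block_vol m \<phi>)))"
proof -
  have "(\<Prod>\<phi>\<in>#M. block_vol m \<phi>) = (\<Prod>\<phi>\<in>set_mset M. block_vol m \<phi> ^ count M \<phi>)" by (rule image_prod_mset_multiplicity)
  also have "\<dots> = (\<Prod>\<phi>\<in>Phi. block_vol m \<phi> ^ count M \<phi>)"
    using assms(2) by (intro prod.mono_neutral_left) (auto simp: not_in_iff)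
  finally have "ln (real (\<Prod>\<phi>\<in>#M. block_vol m \<phi>)) = ln (\<Prod>\<phi>\<in>Phi. real (block_vol m \<phi>) ^ count M \<phi>)" by simp
  also have "\<dots> = (\<Sum>\<phi>\<in>Phi. ln (real (block_vol m \<phi>) ^ count M \<phi>))"
    using block_vol_pos[OF assms(1)] by (intro ln_prod) auto
  also have "\<dots> = (\<Sum>\<phi>\<in>Phi. real (count M \<phi>) * ln (real (block_vol m \<phi>)))"
    using block_vol_pos[OF assms(1)] by (intro sum.cong refl) (simp add: ln_realpow)
  finally show ?thesis .
qed

lemma ln_block_count:
  fixes a b c :: nat and w s :: real
  assumes "0 < a" "0 < b" "0 < c" "0 < w"
  shows "ln (real (a * b * c * (2 ^ k * 2 ^ k)) * w powr s) = ln (real a) + ln (real b) + ln (real c) + 2 * real k * ln 2 + s * ln w"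
  using assms by (simp add: ln_mult_pos ln_realpow)

text \<open>The bound of \<open>laser_degeneration\<close> at the type approximating
  \<open>N\<close> times \<open>P\<close>, divided by \<open>N\<close> after taking logarithms. The
  term with 2 ln 2 stems from the K^2 label triples; positivity is recorded because
  \<open>ln\<close> says nothing about the value otherwise.\<close>

lemma tensor_value_lower:
  assumes m: "1 \<le> m" and P: "set_pmf P \<subseteq> Phi"
  defines "T \<equiv> - (\<Sum>a<3. \<Sum>y<3. coord_prob P a y * ln (coord_prob P a y)) + 2 * pmf P (1,1,0) * ln 2
    + omega * (\<Sum>\<phi>\<in>Phi. pmf P \<phi> * ln (real (block_vol m \<phi>)))"
  shows "0 < tensor_value (symmetrization (T_A m))" "T \<le> ln (tensor_value (symmetrization (T_A m)))"
proof -
  let ?V = "tensor_value (symmetrization (T_A m))"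
  define c where "c = (\<lambda>N \<phi>. real (approx_count P N \<phi>) / real N)"
  define q where "q = (\<lambda>N a y. \<Sum>\<phi>\<in>Phi. if proj a \<phi> = y then c N \<phi> else 0)"
  \<comment> \<open>Three marginals with error 3 + 6 ln(N + 1) each, and the constant 56 of
    \<open>laser_degeneration\<close>.\<close>
  define er where "er = (\<lambda>N. (9 + 18 * ln (real N + 1) + ln 56) / real N)"
  define low where "low = (\<lambda>N. - (\<Sum>a<3. \<Sum>y<3. q N a y * ln (q N a y)) + 2 * c N (1,1,0) * ln 2
    + omega * (\<Sum>\<phi>\<in>Phi. c N \<phi> * ln (real (block_vol m \<phi>))) - er N)"
  have *: "0 < ?V \<and> low N \<le> ln ?V" if N: "1 \<le> N" for N
  proof -
    let ?M = "approx_mset P N"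
    let ?B = "\<lambda>a. card (permutations_of_multiset (image_mset (proj a) ?M))"
    let ?K = "2 ^ count ?M (1,1,0) :: nat"
    let ?W = "real (\<Prod>\<phi>\<in>#?M. block_vol m \<phi>)"
    have sz: "size ?M = N" by (rule approx_count_sum(2)[OF P])
    have cM: "count ?M \<phi> = approx_count P N \<phi>" if "\<phi> \<in> Phi" for \<phi> using that by (simp add: count_approx_mset)
    obtain abcs where abcs: "\<forall>(a, b, c)\<in>set abcs. 1 \<le> a \<and> 1 \<le> b \<and> 1 \<le> c"
      "kron_power (symmetrization (T_A m)) N \<unrhd> matmuls abcs"
      "real (?B 0 * ?B 1 * ?B 2 * (?K * ?K)) * ?W powr omega \<le> 56 * (\<Sum>(a, b, c)\<leftarrow>abcs. real (a * b * c) powr (omega / 3))"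
      using laser_degeneration[OF m set_approx_mset[of P N]] unfolding sz by blast
    let ?x = "\<Sum>(a, b, c)\<leftarrow>abcs. real (a * b * c) powr (omega / 3)"
    have Bpos: "0 < ?B a" for a by (auto simp: card_gt_0_iff permutations_of_multiset_not_empty)
    have Wpos: "0 < ?W" by (rule prod_block_vol_pos[OF m])
    have "0 < ?B 0 * ?B 1 * ?B 2 * (?K * ?K)" by (intro mult_pos_pos Bpos) simp_all
    then have lhs_pos: "0 < real (?B 0 * ?B 1 * ?B 2 * (?K * ?K)) * ?W powr omega"
      using Wpos by (intro mult_pos_pos) (simp_all only: of_nat_0_less_iff powr_gt_zero less_imp_neq[symmetric] not_False_eq_True)
    then have xpos: "0 < ?x" using abcs(3) by linarith
    have "?x \<in> value_sums N m" unfolding value_sums_def using abcs(1,2) by blast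
    from tensor_value_ge[OF m N this] xpos have ge: "?x powr (1 / real N) \<le> ?V" by simp
    have "0 < ?x powr (1 / real N)" using xpos by simp
    then have Vpos: "0 < ?V" using ge by (rule less_le_trans)
    have "ln (real (?B 0 * ?B 1 * ?B 2 * (?K * ?K)) * ?W powr omega) \<le> ln (56 * ?x)"
      using abcs(3) lhs_pos xpos by (subst ln_le_cancel_iff) simp_all
    also have "ln (56 * ?x) = ln 56 + ln ?x" using xpos by (simp add: ln_mult)
    also have "ln (real (?B 0 * ?B 1 * ?B 2 * (?K * ?K)) * ?W powr omega)
      = ln (real (?B 0)) + ln (real (?B 1)) + ln (real (?B 2)) + 2 * real (count ?M (1,1,0)) * ln 2 + omega * ln ?W"
      by (rule ln_block_count) (rule Bpos Wpos)+
    finally have 1: "ln (real (?B 0)) + ln (real (?B 1)) + ln (real (?B 2)) + 2 * real (count ?M (1,1,0)) * ln 2 + omega * ln ?W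
      \<le> ln 56 + ln ?x" .
    have cnt: "real (count (image_mset (proj a) ?M) y) / real N = q N a y" for a y
      unfolding count_image_proj[OF set_approx_mset] q_def c_def of_nat_sum sum_divide_distrib
      by (intro sum.cong refl) (simp add: cM)
    have 2: "real N * (- (\<Sum>y<3. q N a y * ln (q N a y))) - 3 - 6 * ln (real N + 1) \<le> ln (real (?B a))" for a
    proof -
      have "set_mset (image_mset (proj a) ?M) \<subseteq> {..<3}"
        using set_approx_mset[of P N] by (auto simp: Phi_def proj_def)
      from ln_card_permutations_ge[OF this _ N] show ?thesis using sz unfolding cnt by simp
    qed
    have phi: "(1,1,0) \<in> Phi" by (simp add: Phi_def)
    have 3: "2 * real (count ?M (1,1,0)) * ln 2 = real N * (2 * c N (1,1,0) * ln 2)"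
      using N cM[OF phi] by (simp add: c_def)
    have 4: "ln ?W = real N * (\<Sum>\<phi>\<in>Phi. c N \<phi> * ln (real (block_vol m \<phi>)))"
      unfolding ln_prod_block_vol[OF m set_approx_mset] sum_distrib_left
      using N by (intro sum.cong refl) (simp add: cM c_def)
    have S3: "(\<Sum>a<3. g a) = g 0 + g 1 + g (2::nat)" for g :: "nat \<Rightarrow> real" by (simp add: eval_nat_numeral)
    have "real N * low N \<le> ln ?x"
    proof -
      have "real N * low N = real N * (- (\<Sum>y<3. q N 0 y * ln (q N 0 y))) + real N * (- (\<Sum>y<3. q N 1 y * ln (q N 1 y)))
        + real N * (- (\<Sum>y<3. q N 2 y * ln (q N 2 y))) + real N * (2 * c N (1,1,0) * ln 2)
        + omega * (real N * (\<Sum>\<phi>\<in>Phi. c N \<phi> * ln (real (block_vol m \<phi>)))) - (9 + 18 * ln (real N + 1) + ln 56)"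
      proof -
        have "real N * er N = 9 + 18 * ln (real N + 1) + ln 56" using N by (simp add: er_def)
        then show ?thesis
          unfolding low_def S3[of "\<lambda>a. \<Sum>y<3. q N a y * ln (q N a y)"] by (simp add: algebra_simps)
      qed
      then show ?thesis using 1 2[of 0] 2[of 1] 2[of 2] unfolding 3 4 by linarith
    qed
    then have "low N \<le> ln ?x / real N" using N by (simp add: field_simps)
    also have "\<dots> = ln (?x powr (1 / real N))" using xpos by (simp add: ln_powr)
    also have "\<dots> \<le> ln ?V" using ge xpos Vpos by (subst ln_le_cancel_iff) auto
    finally show ?thesis using Vpos by blast
  qed
  show "0 < ?V" using *[of 1] by simp
  have clim: "(\<lambda>N. c N \<phi>) \<longlonglongrightarrow> pmf P \<phi>" if "\<phi> \<in> Phi" for \<phi>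
    unfolding c_def by (rule approx_count_tendsto[OF P that])
  have qlim: "(\<lambda>N. q N a y) \<longlonglongrightarrow> coord_prob P a y" for a y
    unfolding q_def coord_prob_def by (intro tendsto_sum) (use clim in auto)
  have qnn: "0 \<le> q N a y" for N a y unfolding q_def c_def by (intro sum_nonneg) auto
  have err: "er \<longlonglongrightarrow> 0" unfolding er_def by real_asymp
  have "low \<longlonglongrightarrow> T - 0"
    unfolding low_def T_def
    by (intro tendsto_intros tendsto_x_ln_x qlim qnn clim err) (simp_all add: Phi_def)
  moreover have "eventually (\<lambda>N. low N \<le> ln ?V) sequentially"
    using * by (intro eventually_sequentiallyI[of 1]) blast
  ultimately show "T \<le> ln ?V" using tendsto_upperbound[of low "T - 0"] by simp
qed

lemma ln_tensor_value_upper: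
  assumes "1 \<le> m"
  shows "ln (tensor_value (symmetrization (T_A m))) \<le> 3 * ln (3 * real m + 3)"
proof -
  \<comment> \<open>Any distribution on \<open>Phi\<close> will do here: it only serves to show that
    the value is positive, as monotonicity of \<open>ln\<close> requires.\<close>
  have "set_pmf (return_pmf (0,0,2)) \<subseteq> Phi" by (simp add: Phi_def)
  from tensor_value_lower(1)[OF assms this]
  have "ln (tensor_value (symmetrization (T_A m))) \<le> ln ((3 * real m + 3) ^ 3)"
    using tensor_value_le[OF assms] by (subst ln_le_cancel_iff) auto
  then show ?thesis by (simp add: ln_realpow)
qed

lemma ln_tensor_value_lower:
  assumes m: "1 \<le> m" and P: "set_pmf P \<subseteq> Phi"
  shows "pmf_entropy (marg1 P) + pmf_entropy (marg2 P) + pmf_entropy (marg3 P)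
                 + pmf P (1,1,0) * ln (4 * (2 * real m) powr omega)
                 + (pmf P (2,0,0) + pmf P (0,2,0)) * ln (2 powr omega)
                 + (pmf P (1,0,1) + pmf P (0,1,1)) * ln ((3 * real m) powr omega)
    \<le> ln (tensor_value (symmetrization (T_A m)))"
proof -
  have S3: "(\<Sum>a<3. g a) = g 0 + g 1 + g (2::nat)" for g :: "nat \<Rightarrow> real" by (simp add: eval_nat_numeral)
  have "ln 4 = 2 * ln (2::real)" using ln_realpow[of 2 2] by simp
  then have 4: "ln (4 * (2 * real m) powr omega) = 2 * ln 2 + omega * ln (2 * real m)"
    using m by (simp add: ln_mult ln_powr)
  have vols: "(\<Sum>\<phi>\<in>Phi. pmf P \<phi> * ln (real (block_vol m \<phi>))) = pmf P (1,1,0) * ln (2 * real m)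
    + (pmf P (2,0,0) + pmf P (0,2,0)) * ln 2 + (pmf P (1,0,1) + pmf P (0,1,1)) * ln (3 * real m)"
    by (simp add: Phi_def block_vol_def algebra_simps)
  have "pmf_entropy (marg1 P) + pmf_entropy (marg2 P) + pmf_entropy (marg3 P)
                 + pmf P (1,1,0) * ln (4 * (2 * real m) powr omega)
                 + (pmf P (2,0,0) + pmf P (0,2,0)) * ln (2 powr omega)
                 + (pmf P (1,0,1) + pmf P (0,1,1)) * ln ((3 * real m) powr omega)
    = - (\<Sum>a<3. \<Sum>y<3. coord_prob P a y * ln (coord_prob P a y)) + 2 * pmf P (1,1,0) * ln 2
    + omega * (\<Sum>\<phi>\<in>Phi. pmf P \<phi> * ln (real (block_vol m \<phi>)))"
    unfolding marg_eq pmf_entropy_map_proj[OF P] S3[of "\<lambda>a. \<Sum>y<3. coord_prob P a y * ln (coord_prob P a y)"] 4 vols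
    using m by (simp add: ln_powr algebra_simps)
  then show ?thesis using tensor_value_lower(2)[OF m P] by simp
qed

section \<open>The bound on the exponent\<close>

text \<open>Arguments close to 1 need few terms of the series. Together with ln 2 these quotients
  give the logarithms of 3, 5, 19 and 43, and each bound points in the direction that the final
  inequality requires.\<close>

lemma ln_numerical_bounds:
  "0.693146 \<le> ln (2::real)" "ln (3/2::real) \<le> 0.405467" "ln (5/4::real) \<le> 0.223147"
  "ln (19/18::real) \<le> 0.054068" "0.04545 \<le> ln (45/43::real)"
  using ln_approx_bounds[of 2 5] ln_approx_bounds[of "3/2" 3] ln_approx_bounds[of "5/4" 2]
    ln_approx_bounds[of "19/18" 1] ln_approx_bounds[of "45/43" 1]
  by (simp_all add: eval_nat_numeral)

lemma ln_primes: "ln (2 ^ a * 3 ^ b * 5 ^ c * 19 ^ d * 43 ^ e :: real) =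
    real a * ln 2 + real b * ln 3 + real c * ln 5 + real d * ln 19 + real e * ln 43"
  by (simp add: ln_mult_pos ln_realpow)

text \<open>The distribution is a rational approximation of the maximizer of the lower bound for \<open>m = 4\<close>;
  it violates the upper bound if \<open>\<omega> \<ge> 2.431\<close>.\<close>

lemma omega_less: "omega < 2.431"
proof (rule ccontr)
  assume "\<not> omega < 2.431"
  then have om: "2.431 \<le> omega" by simp
  \<comment> \<open>With denominator 320 all marginal probabilities are products of powers of 2, 3,
    5, 19 and 43, so few logarithms have to be estimated.\<close>
  define xs :: "((nat \<times> nat \<times> nat) \<times> real) list" where "xs = [((2,0,0), 4/320), ((0,2,0), 4/320), ((1,1,0), 121/320),
    ((1,0,1), 95/320), ((0,1,1), 95/320), ((0,0,2), 1/320)]"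
  define P where "P = pmf_of_list xs"
  have wf: "pmf_of_list_wf xs" by (rule pmf_of_list_wfI) (auto simp: xs_def)
  have pmfP: "pmf P x = sum_list (map snd (filter (\<lambda>z. fst z = x) xs))" for x
    unfolding P_def by (rule pmf_pmf_of_list[OF wf])
  have "set_pmf P \<subseteq> Phi"
  proof -
    have "set (map fst xs) \<subseteq> Phi" by (simp add: xs_def Phi_def)
    then show ?thesis using set_pmf_of_list[OF wf] unfolding P_def by (rule order_trans[rotated])
  qed
  from tensor_value_lower(2)[OF _ this, of 4] ln_tensor_value_upper[of 4]
  have ineq: "- (\<Sum>a<3. \<Sum>y<3. coord_prob P a y * ln (coord_prob P a y)) + 2 * pmf P (1,1,0) * ln 2
    + omega * (\<Sum>\<phi>\<in>Phi. pmf P \<phi> * ln (real (block_vol 4 \<phi>))) \<le> 3 * ln 15"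
    by simp
  have c: "coord_prob P 0 0 = 5/16" "coord_prob P 0 1 = 27/40" "coord_prob P 0 2 = 1/80"
    "coord_prob P 1 0 = 5/16" "coord_prob P 1 1 = 27/40" "coord_prob P 1 2 = 1/80"
    "coord_prob P 2 0 = 129/320" "coord_prob P 2 1 = 19/32" "coord_prob P 2 2 = 1/320"
    by (simp_all add: coord_prob_def Phi_def proj_def pmfP xs_def)
  have S3: "(\<Sum>a<3. g a) = g 0 + g 1 + g (2::nat)" for g :: "nat \<Rightarrow> real" by (simp add: eval_nat_numeral)
  have ent: "(\<Sum>a<3. \<Sum>y<3. coord_prob P a y * ln (coord_prob P a y)) = 2 * (5/16 * ln (5/16) + 27/40 * ln (27/40) + 1/80 * ln (1/80))
    + (129/320 * ln (129/320) + 19/32 * ln (19/32) + 1/320 * ln (1/320))"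
    unfolding S3 c by simp
  have p110: "pmf P (1,1,0) = 121/320" by (simp add: pmfP xs_def)
  have vols: "(\<Sum>\<phi>\<in>Phi. pmf P \<phi> * ln (real (block_vol 4 \<phi>))) = 121/320 * ln 8 + 8/320 * ln 2 + 190/320 * ln 12"
    by (simp add: Phi_def block_vol_def pmfP xs_def)
  have l: "ln (5/16::real) = ln 5 - 4 * ln 2" "ln (27/40::real) = 3 * ln 3 - 3 * ln 2 - ln 5" "ln (1/80::real) = - 4 * ln 2 - ln 5"
    "ln (129/320::real) = ln 3 + ln 43 - 6 * ln 2 - ln 5" "ln (19/32::real) = ln 19 - 5 * ln 2" "ln (1/320::real) = - 6 * ln 2 - ln 5"
    "ln (8::real) = 3 * ln 2" "ln (12::real) = 2 * ln 2 + ln 3" "ln (15::real) = ln 3 + ln 5"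
    using ln_primes[of 4 0 0 0 0] ln_primes[of 0 3 0 0 0] ln_primes[of 3 0 1 0 0] ln_primes[of 4 0 1 0 0] ln_primes[of 0 1 0 0 1]
      ln_primes[of 6 0 1 0 0] ln_primes[of 5 0 0 0 0] ln_primes[of 3 0 0 0 0] ln_primes[of 2 1 0 0 0] ln_primes[of 0 1 1 0 0]
    by (simp_all add: ln_div)
  have pos: "0 \<le> 751 * ln (2::real) + 190 * ln 3" by simp
  \<comment> \<open>The inequality multiplied by 320, which makes all coefficients integers.\<close>
  have "omega * (751 * ln 2 + 190 * ln 3) \<le> 2385 * ln 3 + 590 * ln 5 + 129 * ln 43 + 190 * ln 19 - 4100 * ln 2"
    using ineq unfolding ent p110 vols l by (simp add: field_simps)
  moreover have "2.431 * (751 * ln 2 + 190 * ln 3) \<le> omega * (751 * ln 2 + 190 * ln 3)"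
    using om pos by (rule mult_right_mono)
  moreover have "ln (3/2::real) = ln 3 - ln 2" "ln (5/4::real) = ln 5 - 2 * ln 2" "ln (19/18::real) = ln 19 - ln 2 - 2 * ln 3"
    "ln (45/43::real) = 2 * ln 3 + ln 5 - ln 43"
    using ln_primes[of 2 0 0 0 0] ln_primes[of 1 2 0 0 0] ln_primes[of 0 2 1 0 0] by (simp_all add: ln_div)
  ultimately show False using ln_numerical_bounds by (simp add: algebra_simps)
qed

theorem mainTheorem1:
  shows "(\<forall>m\<ge>1::nat.
            minimal_border_rank (T_A m) \<and> border_rank (T_A m) = 3 * m + 3 \<and>
            (\<forall>P :: (nat \<times> nat \<times> nat) pmf. set_pmf P \<subseteq> Phi \<longrightarrow>
               3 * ln (3 * real m + 3) \<ge> ln (tensor_value (symmetrization (T_A m))) \<and>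
               ln (tensor_value (symmetrization (T_A m))) \<ge>
                 pmf_entropy (marg1 P) + pmf_entropy (marg2 P) + pmf_entropy (marg3 P)
                 + pmf P (1,1,0) * ln (4 * (2 * real m) powr omega)
                 + (pmf P (2,0,0) + pmf P (0,2,0)) * ln (2 powr omega)
                 + (pmf P (1,0,1) + pmf P (0,1,1)) * ln ((3 * real m) powr omega)))
         \<and> omega < 2.431"
  using minimal_border_rank_T_A border_rank_T_A ln_tensor_value_upper ln_tensor_value_lower omega_less
  by blast

end
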